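(* For all integers $d \ge 2$ and $k \ge 2$ there is a deterministic algorithm that solves $(d,k)$-CSP on formulas with $n$ variables in time $$\left(\frac{d(k-1)}{k}\cdot \frac{k^d}{k^d-1}\right)^n p(n)$$ for some polynomial $p$ (depending on $d$ and $k$ but not on $n$).
   Context: A $(d,k)$-CSP formula is given by $n$ variables $x_1,\dots,x_n$, each taking values ("colors") in $[d]=\{1,\dots,d\}$, together with a conjunction of constraints, where each constraint is a disjunction of at most $k$ literals, and a literal is an expression of the form $(x_i \ne c)$ with $c\in[d]$. An assignment is an element of $[d]^n$; it satisfies the formula if every constraint contains at least one literal $(x_i\ne c)$ with $x_i$ not assigned $c$. The problem $(d,k)$-CSP is to decide whether a given $(d,k)$-CSP formula has a satisfying assignment. *)

theory Defs
  imports
    Complex_Main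
    "HOL-Library.FuncSet"
    "HOL-Library.Log_Nat"
    "HOL-Computational_Algebra.Polynomial"
begin

section \<open>Constraint satisfaction formulas\<close>

text \<open>
  The literal \<open>(i, c)\<close> stands for \<open>x\<^sub>i \<noteq> c\<close>.  A constraint is the disjunction of the literals in
  a list, a formula is the conjunction of the constraints in a list.
\<close>

type_synonym literal = "nat \<times> nat"
type_synonym constraint = "literal list"
type_synonym formula = "constraint list"

text \<open>
  A formula lists its constraints without repetition.  Hence its size is polynomially bounded
  in \<open>n\<close> (for fixed \<open>d\<close> and \<open>k\<close>), which is necessary for a running time bound that
  depends on \<open>n\<close> only.
\<close>

definition csp_formula :: "nat \<Rightarrow> nat \<Rightarrow> nat \<Rightarrow> formula \<Rightarrow> bool" where
  "csp_formula d k n F \<longleftrightarrow>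
     distinct F \<and> (\<forall>C\<in>set F. length C \<le> k \<and> set C \<subseteq> {1..n} \<times> {1..d})"

definition satisfies :: "(nat \<Rightarrow> nat) \<Rightarrow> formula \<Rightarrow> bool" where
  "satisfies \<alpha> F \<longleftrightarrow> (\<forall>C\<in>set F. \<exists>(i, c)\<in>set C. \<alpha> i \<noteq> c)"

definition satisfiable :: "nat \<Rightarrow> nat \<Rightarrow> formula \<Rightarrow> bool" where
  "satisfiable d n F \<longleftrightarrow> (\<exists>\<alpha> \<in> {1..n} \<rightarrow>\<^sub>E {1..d}. satisfies \<alpha> F)"


section \<open>Random access machines with logarithmic cost\<close>

text \<open>
  The model of computation is the random access machine of Cook and Reckhow (see also Aho,
  Hopcroft and Ullman).  The memory is an unbounded array of natural numbers, initially all zero;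
  the input is a sequence of natural numbers that is read once from left to right.  Writing
  \<open>M\<close> for the memory, the instructions mean
    \<^item> \<open>Const i v\<close>: \<open>M[i] := v\<close>
    \<^item> \<open>Add i j l\<close>: \<open>M[i] := M[j] + M[l]\<close>
    \<^item> \<open>Sub i j l\<close>: \<open>M[i] := M[j] - M[l]\<close> (truncated)
    \<^item> \<open>Load i j\<close>: \<open>M[i] := M[M[j]]\<close>
    \<^item> \<open>Store i j\<close>: \<open>M[M[i]] := M[j]\<close>
    \<^item> \<open>Read i\<close>: \<open>M[i]\<close> becomes the next input number, or \<open>0\<close> if the input is exhausted
    \<^item> \<open>Jump l\<close>: continue at program position \<open>l\<close>
    \<^item> \<open>JumpZ i l\<close>: continue at program position \<open>l\<close> if \<open>M[i] = 0\<close>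
\<close>

datatype instr =
    Const nat nat
  | Add nat nat nat
  | Sub nat nat nat
  | Load nat nat
  | Store nat nat
  | Read nat
  | Jump nat
  | JumpZ nat nat

type_synonym program = "instr list"

text \<open>Configurations consist of program counter, memory and remaining input.\<close>

type_synonym config = "nat \<times> (nat \<Rightarrow> nat) \<times> nat list"

fun exec_instr :: "instr \<Rightarrow> config \<Rightarrow> config" where
  "exec_instr (Const i v) (pc, M, xs) = (pc + 1, M(i := v), xs)"
| "exec_instr (Add i j l) (pc, M, xs) = (pc + 1, M(i := M j + M l), xs)"
| "exec_instr (Sub i j l) (pc, M, xs) = (pc + 1, M(i := M j - M l), xs)"
| "exec_instr (Load i j) (pc, M, xs) = (pc + 1, M(i := M (M j)), xs)"
| "exec_instr (Store i j) (pc, M, xs) = (pc + 1, M(M i := M j), xs)"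
| "exec_instr (Read i) (pc, M, xs) =
     (pc + 1, M(i := (case xs of [] \<Rightarrow> 0 | x # _ \<Rightarrow> x)), tl xs)"
| "exec_instr (Jump l) (pc, M, xs) = (l, M, xs)"
| "exec_instr (JumpZ i l) (pc, M, xs) = ((if M i = 0 then l else pc + 1), M, xs)"

definition num_size :: "nat \<Rightarrow> nat" where
  "num_size v = max 1 (floorlog 2 v)"

text \<open>
  The logarithmic cost criterion: an instruction is charged for the binary lengths of all addresses
  and operands that it uses.  In particular, no work can be hidden in arithmetic on long numbers.
\<close>

fun instr_cost :: "instr \<Rightarrow> config \<Rightarrow> nat" where
  "instr_cost (Const i v) (pc, M, xs) = num_size i + num_size v"
| "instr_cost (Add i j l) (pc, M, xs) =
     num_size i + num_size j + num_size (M j) + num_size l + num_size (M l)"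
| "instr_cost (Sub i j l) (pc, M, xs) =
     num_size i + num_size j + num_size (M j) + num_size l + num_size (M l)"
| "instr_cost (Load i j) (pc, M, xs) =
     num_size i + num_size j + num_size (M j) + num_size (M (M j))"
| "instr_cost (Store i j) (pc, M, xs) =
     num_size i + num_size (M i) + num_size j + num_size (M j)"
| "instr_cost (Read i) (pc, M, xs) =
     num_size i + num_size (case xs of [] \<Rightarrow> 0 | x # _ \<Rightarrow> x)"
| "instr_cost (Jump l) (pc, M, xs) = 1"
| "instr_cost (JumpZ i l) (pc, M, xs) = num_size i + num_size (M i)"

text \<open>\<open>runs P s t s'\<close>: program \<open>P\<close> leads from configuration \<open>s\<close> to \<open>s'\<close> at total cost \<open>t\<close>.\<close>

inductive runs :: "program \<Rightarrow> config \<Rightarrow> nat \<Rightarrow> config \<Rightarrow> bool" for P where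
  refl: "runs P s 0 s"
| step: "fst s < length P \<Longrightarrow> runs P (exec_instr (P ! fst s) s) t s'
         \<Longrightarrow> runs P s (instr_cost (P ! fst s) s + t) s'"

text \<open>
  A run halts when the program counter leaves the program; the output is then found in memory
  cell \<open>0\<close>.
\<close>

definition computes_in_time :: "program \<Rightarrow> nat list \<Rightarrow> nat \<Rightarrow> nat \<Rightarrow> bool" where
  "computes_in_time P xs out t \<longleftrightarrow>
     (\<exists>pc M ys. runs P (0, (\<lambda>_. 0), xs) t (pc, M, ys) \<and> length P \<le> pc \<and> M 0 = out)"


section \<open>Deciding constraint satisfaction problems\<close>

text \<open>
  The input is the number of variables, followed by the list of constraints, where each list is
  preceded by its length.
\<close>

definition encode_constraint :: "constraint \<Rightarrow> nat list" where
  "encode_constraint C = length C # concat (map (\<lambda>(i, c). [i, c]) C)"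

definition encode_formula :: "nat \<Rightarrow> formula \<Rightarrow> nat list" where
  "encode_formula n F = n # length F # concat (map encode_constraint F)"

definition solves_csp_in_time :: "program \<Rightarrow> nat \<Rightarrow> nat \<Rightarrow> (nat \<Rightarrow> real) \<Rightarrow> bool" where
  "solves_csp_in_time P d k T \<longleftrightarrow>
     (\<forall>n F. csp_formula d k n F \<longrightarrow>
        (\<exists>t. computes_in_time P (encode_formula n F) (if satisfiable d n F then 1 else 0) t \<and>
             real t \<le> T n))"

end

theory Submission
  imports Defs
begin

text \<open>
  Skewed local search.  Order the colours cyclically and let the distance from \<open>a\<close> to \<open>y\<close> be the
  total number of cyclic increments that lead from \<open>a\<close> to \<open>y\<close>.  If \<open>a\<close> violates a constraint that
  \<open>y\<close> satisfies, then \<open>y\<close> differs from \<open>a\<close> at one of its at most \<open>k\<close> variables, and incrementing that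
  variable decreases the distance by one, whatever the colour in \<open>y\<close> is.  So \<open>k\<^sup>r\<close> branches
  find a solution at distance \<open>r\<close>.  The generating function of the distances from a word of length
  \<open>m\<close> is \<open>(1 + q + \<dots> + q\<^sup>d\<^sup>-\<^sup>1)\<^sup>m\<close>; at \<open>q = 1/k\<close>, pigeonhole over the
  polynomially many radii yields a radius for which a greedy covering code, branching included, costs
  only \<open>(d / (1 + 1/k + \<dots> + 1/k\<^sup>d\<^sup>-\<^sup>1))\<^sup>m\<close> up to a polynomial factor.
  Constructing that code takes time exponential in \<open>m\<close>, so the variables are split into a constant
  number of blocks, and the product of the codes of the blocks provides the starting points.

  On the machine side, the algorithm is a term of a total first-order language on binary trees whose
  only loop is folding over a list.
\<close>

section \<open>Structured programs on the random access machine\<close>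

text \<open>With \<open>q = 1/k\<close> and \<open>G = 1 + q + ... + q^(d-1)\<close>, the base in
  the theorem is \<open>d / G\<close>. A code of radius \<open>r\<close> for blocks of length
  \<open>m\<close> has about \<open>d^m / V\<close> words, \<open>V\<close> being the size of a
  ball, and each starts \<open>k^r\<close> branches. Since \<open>q = 1/k\<close>, this cost is
  \<open>d^m / (q^r * V)\<close>, so a radius with large \<open>q^r * V\<close> is cheap. Such a
  radius is only shown to exist; the program tries all radii and keeps the cheapest code. As the
  distance is cyclic, the words around a given one are distributed in the same way for every word,
  so every word is covered by equally many centres. The greedy analysis rests on this. Constructing
  the code takes about \<open>(d * k^d)^(c * m)\<close> steps for a constant \<open>c\<close>. The
  base exceeds 1, so with sufficiently many blocks this is below the base to the power
  \<open>n\<close>. In a product of codes sizes multiply and radii add, so splitting loses only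
  polynomial factors. Hence the preparation may cost any polynomial in the size of its lists, while
  the search must be linear in the number of words it handles. Run times are exponential, so
  addresses have length linear in \<open>n\<close>; the logarithmic cost thus adds one more
  polynomial factor.\<close>

datatype com = Bas instr | Seq com com (infixr ";;" 60) | IfZ nat com com | While nat com

text \<open>Adding \<open>0\<close> or \<open>1\<close> covers copying and incrementing, and it
  keeps numbers from doubling in one step. Jumps are reserved for the control structures.\<close>

fun admissible :: "instr \<Rightarrow> (nat \<Rightarrow> nat) \<Rightarrow> bool" where
  "admissible (Add i j l) M \<longleftrightarrow> M l \<le> 1"
| "admissible (Jump l) M \<longleftrightarrow> False"
| "admissible (JumpZ i l) M \<longleftrightarrow> False"
| "admissible _ M \<longleftrightarrow> True"

text \<open>The step count is an upper bound on the executed instructions: both branches of a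
  conditional and the exit of a loop are charged for two jumps, even where one suffices.\<close>

inductive exec :: "com \<Rightarrow> (nat \<Rightarrow> nat) \<times> nat list \<Rightarrow> nat \<Rightarrow> (nat \<Rightarrow> nat) \<times> nat list \<Rightarrow> bool" where
  exec_Bas: "admissible ins (fst s) \<Longrightarrow> exec (Bas ins) s 1 (snd (exec_instr ins (0, s)))"
| exec_Seq: "exec a s t s' \<Longrightarrow> exec b s' u s'' \<Longrightarrow> exec (a ;; b) s (t + u) s''"
| exec_If0: "fst s r = 0 \<Longrightarrow> exec a s t s' \<Longrightarrow> exec (IfZ r a b) s (t + 2) s'"
| exec_If1: "fst s r \<noteq> 0 \<Longrightarrow> exec b s t s' \<Longrightarrow> exec (IfZ r a b) s (t + 2) s'"
| exec_While0: "fst s r = 0 \<Longrightarrow> exec (While r a) s 2 s"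
| exec_While1: "fst s r \<noteq> 0 \<Longrightarrow> exec a s t s' \<Longrightarrow> exec (While r a) s' u s'' \<Longrightarrow>
    exec (While r a) s (t + u + 2) s''"

fun csize :: "com \<Rightarrow> nat" where
  "csize (Bas _) = 1"
| "csize (a ;; b) = csize a + csize b"
| "csize (IfZ r a b) = csize a + csize b + 2"
| "csize (While r a) = csize a + 2"

text \<open>Jump targets are absolute, hence the position \<open>l\<close>. The branch for zero
  stands last, so that falling through \<open>JumpZ\<close> runs the other one.\<close>

fun code :: "nat \<Rightarrow> com \<Rightarrow> program" where
  "code l (Bas ins) = [ins]"
| "code l (a ;; b) = code l a @ code (l + csize a) b"
| "code l (IfZ r a b) = [JumpZ r (l + 2 + csize b)] @ code (l + 1) b @
     [Jump (l + 2 + csize b + csize a)] @ code (l + 2 + csize b) a"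
| "code l (While r a) = [JumpZ r (l + 2 + csize a)] @ code (l + 1) a @ [Jump l]"

lemma length_code [simp]: "length (code l c) = csize c"
  by (induction c arbitrary: l) auto

text \<open>The constants of an instruction whose lengths enter its cost; jump targets are free of
  charge in the cost model.\<close>

fun operands :: "instr \<Rightarrow> nat set" where
  "operands (Const i v) = {i, v}"
| "operands (Add i j l) = {i, j, l}"
| "operands (Sub i j l) = {i, j, l}"
| "operands (Load i j) = {i, j}"
| "operands (Store i j) = {i, j}"
| "operands (Read i) = {i}"
| "operands (Jump l) = {}"
| "operands (JumpZ i l) = {i}"

fun operand_set :: "com \<Rightarrow> nat set" where
  "operand_set (Bas ins) = operands ins"
| "operand_set (a ;; b) = operand_set a \<union> operand_set b"
| "operand_set (IfZ r a b) = insert r (operand_set a \<union> operand_set b)"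
| "operand_set (While r a) = insert r (operand_set a)"

lemma finite_operand_set: "finite (operand_set c)"
proof (induction c)
  case (Bas x)
  then show ?case by (cases x) auto
qed auto

lemma runs_append: "runs P s t s' \<Longrightarrow> runs P s' u s'' \<Longrightarrow> runs P s (t + u) s''"
proof (induction rule: runs.induct)
  case (step s t s')
  then show ?case using runs.step[of s P "t + u" s''] by (simp add: add.assoc)
qed simp

lemma runs_single: "fst s < length P \<Longrightarrow> s' = exec_instr (P ! fst s) s \<Longrightarrow>
    runs P s (instr_cost (P ! fst s) s) s'"
  using runs.step[of s P 0] runs.refl by fastforce

lemma num_size_mono: "a \<le> b \<Longrightarrow> num_size a \<le> num_size b"
  unfolding num_size_def by (intro max.mono floorlog_mono) auto

lemma num_size_ge1: "1 \<le> num_size a"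
  by (simp add: num_size_def)

text \<open>The factor is the largest number of lengths charged at once, five for \<open>Add\<close>
  and \<open>Sub\<close>.\<close>

lemma instr_cost_le:
  assumes "\<forall>v\<in>operands ins. v \<le> L" "\<forall>i. M i \<le> L" "\<forall>x\<in>set xs. x \<le> L"
  shows "instr_cost ins (pc, M, xs) \<le> 5 * num_size L"
proof -
  have "num_size v \<le> num_size L" if "v \<le> L" for v using that by (rule num_size_mono)
  note n = this
  have m: "num_size (M i) \<le> num_size L" for i using assms(2) n by blast
  have g: "1 \<le> num_size L" by (rule num_size_ge1)
  show ?thesis
  proof (cases ins)
    case (Const i v) with assms n[of i] n[of v] show ?thesis by auto
  next
    case (Add i j l) with assms n[of i] n[of j] n[of l] m[of j] m[of l] show ?thesis by auto
  next
    case (Sub i j l) with assms n[of i] n[of j] n[of l] m[of j] m[of l] show ?thesis by auto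
  next
    case (Load i j) with assms n[of i] n[of j] m[of "M j"] m[of j] show ?thesis by auto
  next
    case (Store i j) with assms n[of i] n[of j] m[of i] m[of j] show ?thesis by auto
  next
    case (Read i) with assms n[of i] n[of 0] n[of "hd xs"] show ?thesis by (cases xs) auto
  next
    case (Jump l) with g show ?thesis by auto
  next
    case (JumpZ i l) with assms n[of i] m[of i] show ?thesis by auto
  qed
qed

lemma exec_instr_bounded:
  assumes "admissible ins M" "\<forall>v\<in>operands ins. v \<le> B" "\<forall>i. M i \<le> B" "\<forall>x\<in>set xs. x \<le> B"
    "exec_instr ins (pc, M, xs) = (pc', M', xs')"
  shows "pc' = pc + 1" "\<forall>i. M' i \<le> B + 1" "\<forall>x\<in>set xs'. x \<le> B"
proof -
  have s: "M i + u \<le> Suc B" if "u \<le> 1" for i u using assms(3) that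
    by (metis Suc_eq_plus1 add_mono)
  have s': "M i \<le> Suc B" for i using s[of 0 i] by simp
  have d: "M i - u \<le> Suc B" for i u using s'[of i] by linarith
  show "pc' = pc + 1" "\<forall>i. M' i \<le> B + 1" "\<forall>x\<in>set xs'. x \<le> B" using assms
    by (cases ins; cases xs; auto intro: s s' d simp: le_SucI)+
qed

section \<open>Simulation of structured programs by machine code\<close>

definition code_at :: "program \<Rightarrow> nat \<Rightarrow> com \<Rightarrow> bool" where
  "code_at P l c \<longleftrightarrow> (\<exists>pre post. P = pre @ code l c @ post \<and> length pre = l)"

lemma code_at_D:
  assumes "code_at P l c"
  shows "l + csize c \<le> length P" "i < csize c \<Longrightarrow> P ! (l + i) = code l c ! i"
  using assms by (auto simp: code_at_def nth_append)

lemma code_at_sub: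
  assumes "code_at P l c" "code l c = a @ code (l + length a) c' @ b"
  shows "code_at P (l + length a) c'"
proof -
  from assms obtain pre post where p: "P = pre @ code l c @ post" "length pre = l"
    by (auto simp: code_at_def)
  show ?thesis unfolding code_at_def
    by (rule exI[of _ "pre @ a"], rule exI[of _ "b @ post"]) (use p assms(2) in simp)
qed

lemma code_at_Seq:
  assumes "code_at P l (a ;; b)"
  shows "code_at P l a" "code_at P (l + csize a) b"
  using code_at_sub[OF assms, of "[]" a "code (l + csize a) b"]
    code_at_sub[OF assms, of "code l a" b "[]"] by auto

lemma code_at_If:
  assumes "code_at P l (IfZ r a b)"
  shows "code_at P (l + 2 + csize b) a" "code_at P (l + 1) b"
    "P ! l = JumpZ r (l + 2 + csize b)" "P ! (l + 1 + csize b) = Jump (l + 2 + csize b + csize a)"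
proof -
  show "code_at P (l + 2 + csize b) a"
    using code_at_sub[OF assms, of "[JumpZ r (l + 2 + csize b)] @ code (l + 1) b @
     [Jump (l + 2 + csize b + csize a)]" a "[]"] by simp
  show "code_at P (l + 1) b"
    using code_at_sub[OF assms, of "[JumpZ r (l + 2 + csize b)]" b] by simp
  show "P ! l = JumpZ r (l + 2 + csize b)"
    using code_at_D(2)[OF assms, of 0] by simp
  show "P ! (l + 1 + csize b) = Jump (l + 2 + csize b + csize a)"
    using code_at_D(2)[OF assms, of "1 + csize b"] by (simp add: nth_append)
qed

lemma code_at_While:
  assumes "code_at P l (While r a)"
  shows "code_at P (l + 1) a"
    "P ! l = JumpZ r (l + 2 + csize a)" "P ! (l + 1 + csize a) = Jump l"
proof -
  show "code_at P (l + 1) a"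
    using code_at_sub[OF assms, of "[JumpZ r (l + 2 + csize a)]" a] by simp
  show "P ! l = JumpZ r (l + 2 + csize a)"
    using code_at_D(2)[OF assms, of 0] by simp
  show "P ! (l + 1 + csize a) = Jump l"
    using code_at_D(2)[OF assms, of "1 + csize a"] by (simp add: nth_append)
qed

text \<open>
  Admissible instructions increase the largest number in memory by at most one, so a bound on the
  number of steps also bounds the logarithmic cost of each of them.
\<close>

lemma exec_input_subset: "exec c s t s' \<Longrightarrow> set (snd s') \<subseteq> set (snd s)"
proof (induction rule: exec.induct)
  case (exec_Bas ins s)
  then show ?case by (cases s; cases ins; cases "snd s") auto
qed auto

text \<open>\<open>B\<close> bounds all numbers at the start and grows along the induction, whereas
  \<open>L\<close> is fixed and bounds them until the end. So every instruction can be charged with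
  the same \<open>num_size L\<close>.\<close>

lemma exec_runs:
  assumes "exec c s t s'" "code_at P l c" "\<forall>v\<in>operand_set c. v \<le> B" "\<forall>i. fst s i \<le> B"
    "\<forall>x\<in>set (snd s). x \<le> B" "B + t \<le> L"
  shows "(\<exists>u. runs P (l, s) u (l + csize c, s') \<and> u \<le> t * (5 * num_size L)) \<and>
    (\<forall>i. fst s' i \<le> B + t)"
  using assms
proof (induction arbitrary: B l rule: exec.induct)
  case (exec_Bas ins s)
  obtain M xs where s: "s = (M, xs)" by (cases s)
  obtain pc' M' xs' where e: "exec_instr ins (l, M, xs) = (pc', M', xs')"
    by (metis prod_cases3)
  have adm: "admissible ins M" using exec_Bas s by simp
  have e0: "snd (exec_instr ins (0, M, xs)) = (M', xs')"
    using e adm by (cases ins) auto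
  have ops: "\<forall>v\<in>operands ins. v \<le> B" "\<forall>i. M i \<le> B" "\<forall>x\<in>set xs. x \<le> B"
    using exec_Bas.prems s by simp_all
  note b = exec_instr_bounded[OF adm ops e]
  have P: "P ! l = ins" "l < length P"
    using code_at_D(1)[OF exec_Bas(2)] code_at_D(2)[OF exec_Bas(2), of 0] by auto
  have "runs P (l, s) (instr_cost ins (l, s)) (l + 1, M', xs')"
    using runs_single[of "(l, s)" P "(l + 1, M', xs')"] P e b s by simp
  moreover have "instr_cost ins (l, s) \<le> 5 * num_size L"
    unfolding s using exec_Bas.prems(5) ops
    by (intro instr_cost_le) (meson add_leD1 le_trans)+
  ultimately show ?case using e0 s b by auto
next
  case (exec_Seq a s t s' b u s'')
  note c = code_at_Seq[OF exec_Seq.prems(1)]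
  have 1: "(\<exists>v. runs P (l, s) v (l + csize a, s') \<and> v \<le> t * (5 * num_size L)) \<and>
    (\<forall>i. fst s' i \<le> B + t)"
    by (rule exec_Seq.IH(1)[OF c(1)]) (use exec_Seq.prems in auto)
  have 2: "(\<exists>v. runs P (l + csize a, s') v (l + csize a + csize b, s'') \<and> v \<le> u * (5 * num_size L)) \<and>
    (\<forall>i. fst s'' i \<le> B + t + u)"
    by (rule exec_Seq.IH(2)[OF c(2)])
      (use exec_Seq.prems 1 exec_input_subset[OF exec_Seq.hyps(1)] in \<open>auto intro: trans_le_add1\<close>)
  from 1 2 obtain v w where vw: "runs P (l, s) v (l + csize a, s')" "v \<le> t * (5 * num_size L)"
    "runs P (l + csize a, s') w (l + csize a + csize b, s'')" "w \<le> u * (5 * num_size L)" by blast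
  have "runs P (l, s) (v + w) (l + csize (a ;; b), s'')"
    using runs_append[OF vw(1,3)] by (simp add: add.assoc)
  moreover have "v + w \<le> (t + u) * (5 * num_size L)"
    using vw by (simp add: add_mult_distrib)
  ultimately show ?case using 2 by (metis add.assoc)
next
  case (exec_If0 s r a t s' b)
  note c = code_at_If[OF exec_If0.prems(1)]
  obtain M xs where s: "s = (M, xs)" by (cases s)
  have 1: "(\<exists>v. runs P (l + 2 + csize b, s) v (l + 2 + csize b + csize a, s') \<and> v \<le> t * (5 * num_size L)) \<and>
    (\<forall>i. fst s' i \<le> B + t)"
    by (rule exec_If0.IH[OF c(1)]) (use exec_If0.prems in auto)
  let ?j = "instr_cost (JumpZ r (l + 2 + csize b)) (l, s)"
  have 2: "runs P (l, s) ?j (l + 2 + csize b, s)"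
    using runs_single[of "(l, s)" P] c code_at_D(1)[OF exec_If0.prems(1)] exec_If0.hyps(1)
    by (simp add: s)
  have 3: "?j \<le> 5 * num_size L"
    unfolding s using exec_If0.prems(2-5) s by (intro instr_cost_le) (auto intro: le_trans add_leD1)
  from 1 obtain v where v: "runs P (l + 2 + csize b, s) v (l + 2 + csize b + csize a, s')"
     "v \<le> t * (5 * num_size L)" by blast
  have "runs P (l, s) (?j + v) (l + csize (IfZ r a b), s')"
    using runs_append[OF 2 v(1)] by (simp add: ac_simps)
  moreover have "?j + v \<le> (t + 2) * (5 * num_size L)"
    using 3 v(2) unfolding add_mult_distrib by linarith
  ultimately show ?case using 1 by (metis add.assoc trans_le_add1)
next
  case (exec_If1 s r b t s' a)
  note c = code_at_If[OF exec_If1.prems(1)]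
  obtain M xs where s: "s = (M, xs)" by (cases s)
  have 1: "(\<exists>v. runs P (l + 1, s) v (l + 1 + csize b, s') \<and> v \<le> t * (5 * num_size L)) \<and>
    (\<forall>i. fst s' i \<le> B + t)"
    by (rule exec_If1.IH[OF c(2)]) (use exec_If1.prems in auto)
  let ?j = "instr_cost (JumpZ r (l + 2 + csize b)) (l, s)"
  have 2: "runs P (l, s) ?j (l + 1, s)"
    using runs_single[of "(l, s)" P] c code_at_D(1)[OF exec_If1.prems(1)] exec_If1.hyps(1)
    by (simp add: s)
  have 3: "?j \<le> 5 * num_size L"
    unfolding s using exec_If1.prems(2-5) s by (intro instr_cost_le) (auto intro: le_trans add_leD1)
  have 4: "runs P (l + 1 + csize b, s') 1 (l + csize (IfZ r a b), s')"
    using runs_single[of "(l + 1 + csize b, s')" P "(l + csize (IfZ r a b), s')"] c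
      code_at_D(1)[OF exec_If1.prems(1)]
    by (cases s') (simp add: ac_simps)
  from 1 obtain v where v: "runs P (l + 1, s) v (l + 1 + csize b, s')"
     "v \<le> t * (5 * num_size L)" by blast
  have "runs P (l, s) (?j + v + 1) (l + csize (IfZ r a b), s')"
    using runs_append[OF runs_append[OF 2 v(1)] 4] .
  moreover have "?j + v + 1 \<le> (t + 2) * (5 * num_size L)"
    using 3 v(2) num_size_ge1[of L] unfolding add_mult_distrib by linarith
  ultimately show ?case using 1 by (metis add.assoc trans_le_add1)
next
  case (exec_While0 s r a)
  note c = code_at_While[OF exec_While0.prems(1)]
  obtain M xs where s: "s = (M, xs)" by (cases s)
  let ?j = "instr_cost (JumpZ r (l + 2 + csize a)) (l, s)"
  have 2: "runs P (l, s) ?j (l + csize (While r a), s)"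
    using runs_single[of "(l, s)" P] c code_at_D(1)[OF exec_While0.prems(1)] exec_While0.hyps(1)
    by (simp add: s ac_simps)
  have 3: "?j \<le> 5 * num_size L"
    unfolding s using exec_While0.prems(2-5) s by (intro instr_cost_le) (auto intro: le_trans add_leD1)
  have "?j \<le> 2 * (5 * num_size L)" using 3 by linarith
  with 2 show ?case using exec_While0.prems(3) by (metis trans_le_add1)
next
  case (exec_While1 s r a t s' u s'')
  note c = code_at_While[OF exec_While1.prems(1)]
  obtain M xs where s: "s = (M, xs)" by (cases s)
  let ?j = "instr_cost (JumpZ r (l + 2 + csize a)) (l, s)"
  have 1: "(\<exists>v. runs P (l + 1, s) v (l + 1 + csize a, s') \<and> v \<le> t * (5 * num_size L)) \<and>
    (\<forall>i. fst s' i \<le> B + t)"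
    by (rule exec_While1.IH(1)[OF c(1)]) (use exec_While1.prems in auto)
  have 2: "runs P (l, s) ?j (l + 1, s)"
    using runs_single[of "(l, s)" P] c code_at_D(1)[OF exec_While1.prems(1)] exec_While1.hyps(1)
    by (simp add: s)
  have 3: "?j \<le> 5 * num_size L"
    unfolding s using exec_While1.prems(2-5) s by (intro instr_cost_le) (auto intro: le_trans add_leD1)
  have 4: "runs P (l + 1 + csize a, s') 1 (l, s')"
    using runs_single[of "(l + 1 + csize a, s')" P "(l, s')"] c code_at_D(1)[OF exec_While1.prems(1)]
    by (cases s') (simp add: ac_simps)
  have 5: "(\<exists>v. runs P (l, s') v (l + csize (While r a), s'') \<and> v \<le> u * (5 * num_size L)) \<and>
    (\<forall>i. fst s'' i \<le> B + t + u)"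
    by (rule exec_While1.IH(2)[OF exec_While1.prems(1)])
      (use exec_While1.prems 1 exec_input_subset[OF exec_While1.hyps(2)] in \<open>auto intro: trans_le_add1\<close>)
  from 1 obtain v where v: "runs P (l + 1, s) v (l + 1 + csize a, s')"
     "v \<le> t * (5 * num_size L)" by blast
  from 5 obtain w where w: "runs P (l, s') w (l + csize (While r a), s'')"
     "w \<le> u * (5 * num_size L)" by blast
  have "runs P (l, s) (?j + v + 1 + w) (l + csize (While r a), s'')"
    using runs_append[OF runs_append[OF runs_append[OF 2 v(1)] 4] w(1)] .
  moreover have "?j + v + 1 + w \<le> (t + u + 2) * (5 * num_size L)"
    using v(2) w(2) 3 num_size_ge1[of L] unfolding add_mult_distrib by linarith
  ultimately show ?case using 5 by (metis add.assoc trans_le_add1)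
qed

section \<open>A first-order language on trees\<close>

datatype tree = Lf | Nd tree tree

fun spine :: "tree \<Rightarrow> tree list" where
  "spine Lf = []"
| "spine (Nd a b) = a # spine b"

fun left :: "tree \<Rightarrow> tree" where
  "left Lf = Lf"
| "left (Nd a b) = a"

fun right :: "tree \<Rightarrow> tree" where
  "right Lf = Lf"
| "right (Nd a b) = b"

datatype exp = Var nat | Nl | Cns exp exp | Hd exp | Tl exp | Ite exp exp exp
  | Fold exp exp exp | Call exp "exp list"

text \<open>The body of \<open>Fold\<close> sees the current entry and the accumulator as variables
  0 and 1, in front of the outer environment; the body of \<open>Call\<close> sees only its
  arguments. Called terms are inlined, so there is no recursion and every evaluation terminates. The
  arguments of \<open>Call\<close> are mapped in two stages because primitive recursion through
  lists requires the form \<open>map eval es\<close>.\<close>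

primrec eval :: "exp \<Rightarrow> tree list \<Rightarrow> tree" where
  "eval (Var i) vs = (if i < length vs then vs ! i else Lf)"
| "eval Nl vs = Lf"
| "eval (Cns a b) vs = Nd (eval a vs) (eval b vs)"
| "eval (Hd a) vs = left (eval a vs)"
| "eval (Tl a) vs = right (eval a vs)"
| "eval (Ite c a b) vs = (if eval c vs = Lf then eval b vs else eval a vs)"
| "eval (Fold l a f) vs = fold (\<lambda>x a. eval f (x # a # vs)) (spine (eval l vs)) (eval a vs)"
| "eval (Call f es) vs = eval f (map (\<lambda>g. g vs) (map eval es))"

text \<open>The 6 per iteration are four instructions that fetch the entry, move the accumulator and
  advance the list, and two jumps.\<close>

fun fold_cost :: "('a \<Rightarrow> 'b \<Rightarrow> 'b) \<Rightarrow> ('a \<Rightarrow> 'b \<Rightarrow> nat) \<Rightarrow> 'a list \<Rightarrow> 'b \<Rightarrow> nat" where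
  "fold_cost g c [] a = 0"
| "fold_cost g c (x # xs) a = c x a + 6 + fold_cost g c xs (g x a)"

text \<open>The constants are exactly the counts of \<open>exec\<close> for the compiled code: 6 for
  an allocation, 3 for leaving a loop and copying its result, 2 for the dummy instruction after the
  arguments of a call and the copy of its result.\<close>

primrec cost :: "exp \<Rightarrow> tree list \<Rightarrow> nat" where
  "cost (Var i) vs = 1"
| "cost Nl vs = 1"
| "cost (Cns a b) vs = cost a vs + cost b vs + 6"
| "cost (Hd a) vs = cost a vs + 1"
| "cost (Tl a) vs = cost a vs + 2"
| "cost (Ite c a b) vs = cost c vs + (if eval c vs = Lf then cost b vs else cost a vs) + 2"
| "cost (Fold l a f) vs = cost l vs + cost a vs +
     fold_cost (\<lambda>x a. eval f (x # a # vs)) (\<lambda>x a. cost f (x # a # vs)) (spine (eval l vs)) (eval a vs) + 3"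
| "cost (Call f es) vs = sum_list (map (\<lambda>g. g vs) (map cost es)) + cost f (map (\<lambda>e. eval e vs) es) + 2"

text \<open>
  Registers \<open>0\<close> and \<open>1\<close> hold \<open>0\<close>, so that both components of the null pointer are null;
  register \<open>2\<close> holds \<open>1\<close>, register \<open>3\<close> the first free heap cell, register \<open>4\<close> is scratch.
\<close>

definition copy :: "nat \<Rightarrow> nat \<Rightarrow> com" where
  "copy i j = Bas (Add i j 0)"

definition inc :: "nat \<Rightarrow> com" where
  "inc i = Bas (Add i i 2)"

text \<open>The target \<open>h\<close> may be one of the sources, so the address of the new pair
  waits in register 4 until both components are stored.\<close>

definition alloc :: "nat \<Rightarrow> nat \<Rightarrow> nat \<Rightarrow> com" where
  "alloc h a b = Bas (Store 3 a) ;; copy 4 3 ;; inc 3 ;; Bas (Store 3 b) ;; inc 3 ;; copy h 4"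

text \<open>Registers form a stack: \<open>rs\<close> lists the registers of the variables, the
  result goes to \<open>h\<close>, and everything from \<open>h\<close> on is free. For an empty
  list of arguments a dummy instruction is emitted, since there is no empty command.\<close>

fun compile :: "nat list \<Rightarrow> nat \<Rightarrow> exp \<Rightarrow> com" and compiles :: "nat list \<Rightarrow> nat \<Rightarrow> exp list \<Rightarrow> com" where
  "compile rs h (Var i) = (if i < length rs then copy h (rs ! i) else Bas (Const h 0))"
| "compile rs h Nl = Bas (Const h 0)"
| "compile rs h (Cns a b) = compile rs h a ;; compile rs (h + 1) b ;; alloc h h (h + 1)"
| "compile rs h (Hd a) = compile rs h a ;; Bas (Load h h)"
| "compile rs h (Tl a) = compile rs h a ;; inc h ;; Bas (Load h h)"
| "compile rs h (Ite c a b) = compile rs h c ;; IfZ h (compile rs h b) (compile rs h a)"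
| "compile rs h (Fold l a f) = compile rs h l ;; compile rs (h + 1) a ;;
     While h (Bas (Load (h + 2) h) ;; compile ((h + 2) # (h + 1) # rs) (h + 3) f ;;
       copy (h + 1) (h + 3) ;; inc h ;; Bas (Load h h)) ;;
     copy h (h + 1)"
| "compile rs h (Call f es) = compiles rs h es ;; compile [h..<h + length es] (h + length es) f ;;
     copy h (h + length es)"
| "compiles rs h [] = Bas (Const 4 0)"
| "compiles rs h (e # es) = compile rs h e ;; compiles rs (h + 1) es"

section \<open>Trees in the heap\<close>

definition heap_inv :: "nat \<Rightarrow> (nat \<Rightarrow> nat) \<Rightarrow> bool" where
  "heap_inv H M \<longleftrightarrow> M 0 = 0 \<and> M 1 = 0 \<and> M 2 = 1 \<and> 5 < H \<and> H \<le> M 3"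

lemma heap_inv_0: "heap_inv H M \<Longrightarrow> M 0 = 0"
  by (simp add: heap_inv_def)

text \<open>The heap is only extended and never overwritten. Therefore represented trees stay
  represented, and subtrees can be shared freely.\<close>

definition frame :: "nat \<Rightarrow> nat \<Rightarrow> (nat \<Rightarrow> nat) \<Rightarrow> (nat \<Rightarrow> nat) \<Rightarrow> bool" where
  "frame H h M M' \<longleftrightarrow> heap_inv H M' \<and> M 3 \<le> M' 3 \<and> (\<forall>a. 5 \<le> a \<and> a < h \<longrightarrow> M' a = M a) \<and>
     (\<forall>a. H \<le> a \<and> a < M 3 \<longrightarrow> M' a = M a)"

primrec rep :: "nat \<Rightarrow> (nat \<Rightarrow> nat) \<Rightarrow> nat \<Rightarrow> tree \<Rightarrow> bool" where
  "rep H M p Lf \<longleftrightarrow> p = 0"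
| "rep H M p (Nd a b) \<longleftrightarrow> H \<le> p \<and> p + 1 < M 3 \<and> rep H M (M p) a \<and> rep H M (M (p + 1)) b"

definition env_rep :: "nat \<Rightarrow> nat \<Rightarrow> (nat \<Rightarrow> nat) \<Rightarrow> nat list \<Rightarrow> tree list \<Rightarrow> bool" where
  "env_rep H h M = list_all2 (\<lambda>r v. 5 \<le> r \<and> r < h \<and> rep H M (M r) v)"

lemma rep_frame: "rep H M p t \<Longrightarrow> frame H h M M' \<Longrightarrow> rep H M' p t"
  by (induction t arbitrary: p) (auto simp: frame_def)

lemma frame_reg: "frame H h M M' \<Longrightarrow> 5 \<le> r \<Longrightarrow> r < h \<Longrightarrow> M' r = M r"
  by (simp add: frame_def)

lemma frame_refl: "heap_inv H M \<Longrightarrow> frame H h M M"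
  by (simp add: frame_def)

lemma frame_trans: "frame H h M M' \<Longrightarrow> frame H h' M' M'' \<Longrightarrow> h \<le> h' \<Longrightarrow> frame H h M M''"
  by (auto simp: frame_def)

lemma frame_weaken: "frame H h' M M' \<Longrightarrow> h \<le> h' \<Longrightarrow> frame H h M M'"
  by (simp add: frame_def)

lemma frame_heap_inv: "frame H h M M' \<Longrightarrow> heap_inv H M'"
  by (simp add: frame_def)

lemma frame_upd: "heap_inv H M \<Longrightarrow> r = 4 \<or> h \<le> r \<Longrightarrow> 4 \<le> r \<Longrightarrow> r < H \<Longrightarrow> frame H h M (M(r := v))"
  by (auto simp: frame_def heap_inv_def)

lemma env_rep_frame:
  assumes "env_rep H h M rs vs" "frame H h' M M'" "h \<le> h'" "h \<le> h''"
  shows "env_rep H h'' M' rs vs"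
  using assms(1) unfolding env_rep_def
  by (rule list_all2_mono) (use assms rep_frame frame_reg in fastforce)

lemma exec_copy: "M 0 = 0 \<Longrightarrow> exec (copy i j) (M, xs) 1 (M(i := M j), xs)"
  using exec_Bas[of "Add i j 0" "(M, xs)"] by (simp add: copy_def)

lemma exec_inc: "M 2 = 1 \<Longrightarrow> exec (inc i) (M, xs) 1 (M(i := M i + 1), xs)"
  using exec_Bas[of "Add i i 2" "(M, xs)"] by (simp add: inc_def)

lemma exec_Const: "exec (Bas (Const i v)) (M, xs) 1 (M(i := v), xs)"
  using exec_Bas[of "Const i v" "(M, xs)"] by simp

lemma exec_Load: "exec (Bas (Load i j)) (M, xs) 1 (M(i := M (M j)), xs)"
  using exec_Bas[of "Load i j" "(M, xs)"] by simp

lemma exec_Store: "exec (Bas (Store i j)) (M, xs) 1 (M(M i := M j), xs)"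
  using exec_Bas[of "Store i j" "(M, xs)"] by simp

lemma exec_Seq': "exec a s t s' \<Longrightarrow> exec b s' u s'' \<Longrightarrow> v = t + u \<Longrightarrow> exec (a ;; b) s v s''"
  using exec_Seq by blast

lemma exec_time: "exec c s t s' \<Longrightarrow> t = t' \<Longrightarrow> exec c s t' s'"
  by simp

lemma exec_alloc:
  assumes "heap_inv H M" "5 \<le> a" "a < H" "5 \<le> b" "b < H" "5 \<le> h" "h < H"
    "rep H M (M a) s" "rep H M (M b) t" "h' \<le> h"
  shows "\<exists>M'. exec (alloc h a b) (M, xs) 6 (M', xs) \<and> frame H h' M M' \<and> rep H M' (M' h) (Nd s t)
     \<and> (\<forall>r. 5 \<le> r \<and> r < H \<and> r \<noteq> h \<longrightarrow> M' r = M r)"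
proof -
  let ?f = "M 3"
  let ?M1 = "M(?f := M a)"
  let ?M2 = "?M1(4 := ?M1 3)"
  let ?M3 = "?M2(3 := ?M2 3 + 1)"
  let ?M4 = "?M3(?M3 3 := ?M3 b)"
  let ?M5 = "?M4(3 := ?M4 3 + 1)"
  let ?M6 = "?M5(h := ?M5 4)"
  have i: "M 0 = 0" "M 1 = 0" "M 2 = 1" "5 < H" "H \<le> M 3" using assms(1) by (auto simp: heap_inv_def)
  have "exec (alloc h a b) (M, xs) 6 (?M6, xs)"
    unfolding alloc_def
    apply (rule exec_Seq'[OF exec_Store])
     apply (rule exec_Seq'[OF exec_copy])
       apply (use i in simp)
      apply (rule exec_Seq'[OF exec_inc])
       apply (use i in simp)
      apply (rule exec_Seq'[OF exec_Store])
       apply (rule exec_Seq'[OF exec_inc])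
        apply (use i in simp)
       apply (rule exec_copy)
       apply (use i in simp)
      apply (rule HOL.refl)+
    by simp
  moreover have f: "frame H h' M ?M6"
    using assms i by (auto simp: frame_def heap_inv_def)
  moreover have "rep H ?M6 (?M6 h) (Nd s t)"
    using rep_frame[OF assms(8) f] rep_frame[OF assms(9) f] assms i by simp
  moreover have "\<forall>r. 5 \<le> r \<and> r < H \<and> r \<noteq> h \<longrightarrow> ?M6 r = M r"
    using i by simp
  ultimately show ?thesis by blast
qed

text \<open>With this, the bound \<open>H\<close> on the operands of compiled code also places the
  target register below the heap.\<close>

lemma target_in_operand_set: "h \<in> operand_set (compile rs h e)"
  by (cases e) (auto simp: copy_def alloc_def inc_def)

section \<open>Correctness of the compiler\<close>

abbreviation "fold_val f vs \<equiv> fold (\<lambda>x a. eval f (x # a # vs))"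

abbreviation "fold_steps f vs \<equiv> fold_cost (\<lambda>x a. eval f (x # a # vs)) (\<lambda>x a. cost f (x # a # vs))"

text \<open>Correctness of the body is a hypothesis, later discharged by the induction hypothesis of
  \<open>compile_correct\<close>. The induction follows the list that register \<open>h\<close>
  still points to.\<close>

lemma exec_fold_loop:
  assumes f: "\<And>M env. heap_inv H M \<Longrightarrow> env_rep H (h + 3) M ((h + 2) # (h + 1) # rs) env \<Longrightarrow>
      \<exists>M'. exec c (M, xs) (cost f env) (M', xs) \<and> frame H (h + 3) M M' \<and> rep H M' (M' (h + 3)) (eval f env)"
    and "heap_inv H M" "env_rep H h M rs vs" "5 \<le> h" "h + 3 < H"
    "rep H M (M h) l" "rep H M (M (h + 1)) a"
  shows "\<exists>M'. exec (While h (Bas (Load (h + 2) h) ;; c ;; copy (h + 1) (h + 3) ;; inc h ;; Bas (Load h h)))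
      (M, xs) (fold_steps f vs (spine l) a + 2) (M', xs)
      \<and> frame H h M M' \<and> rep H M' (M' (h + 1)) (fold_val f vs (spine l) a)"
  using assms(2-)
proof (induction l arbitrary: M a rule: spine.induct)
  case 1
  then show ?case using exec_While0[of "(M, xs)" h]
    by (auto simp: numeral_2_eq_2 intro!: exI[of _ M] frame_refl)
next
  case (2 x l M a)
  let ?W = "While h (Bas (Load (h + 2) h) ;; c ;; copy (h + 1) (h + 3) ;; inc h ;; Bas (Load h h))"
  let ?M1 = "M(h + 2 := M (M h))"
  have 1: "exec (Bas (Load (h + 2) h)) (M, xs) 1 (?M1, xs)" by (rule exec_Load)
  have f1: "frame H (h + 2) M ?M1" using 2 by (intro frame_upd) auto
  have i1: "heap_inv H ?M1" using f1 by (rule frame_heap_inv)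
  have "env_rep H (h + 3) ?M1 rs vs" using 2 f1 env_rep_frame by auto
  moreover have "rep H ?M1 (?M1 (h + 2)) x" using 2 rep_frame[OF _ f1] by simp
  moreover have "rep H ?M1 (?M1 (h + 1)) a" using 2 rep_frame[OF _ f1] by simp
  ultimately have "env_rep H (h + 3) ?M1 ((h + 2) # (h + 1) # rs) (x # a # vs)"
    using 2 by (simp add: env_rep_def)
  from f[OF i1 this] obtain M2 where 2: "exec c (?M1, xs) (cost f (x # a # vs)) (M2, xs)"
    and f2: "frame H (h + 3) ?M1 M2" and r2: "rep H M2 (M2 (h + 3)) (eval f (x # a # vs))" by blast
  note p = "2.prems"
  have i2: "heap_inv H M2" using f2 by (rule frame_heap_inv)
  let ?M3 = "M2(h + 1 := M2 (h + 3))"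
  have f3: "frame H h M2 ?M3" using i2 p by (intro frame_upd) auto
  have i3: "heap_inv H ?M3" using f3 by (rule frame_heap_inv)
  have 3: "exec (copy (h + 1) (h + 3)) (M2, xs) 1 (?M3, xs)"
    using i2 by (intro exec_copy) (simp add: heap_inv_def)
  let ?M4 = "?M3(h := ?M3 h + 1)"
  have f4: "frame H h ?M3 ?M4" using i3 p by (intro frame_upd) auto
  have i4: "heap_inv H ?M4" using f4 by (rule frame_heap_inv)
  have 4: "exec (inc h) (?M3, xs) 1 (?M4, xs)"
    using i3 by (intro exec_inc) (simp add: heap_inv_def)
  let ?M5 = "?M4(h := ?M4 (?M4 h))"
  have f5: "frame H h ?M4 ?M5" using i4 p by (intro frame_upd) auto
  have i5: "heap_inv H ?M5" using f5 by (rule frame_heap_inv)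
  have 5: "exec (Bas (Load h h)) (?M4, xs) 1 (?M5, xs)" by (rule exec_Load)
  have f15: "frame H h M ?M5"
    using f1 f2 f3 f4 f5 by (meson frame_trans frame_weaken le_add1 order_refl)
  have h: "?M4 h = M h + 1" "?M4 (M h + 1) = M2 (M h + 1)" "?M5 (h + 1) = M2 (h + 3)"
    using p frame_reg[OF f2, of h] i2 by (auto simp: heap_inv_def)
  \<comment> \<open>The pointer to the tail lies in a heap cell that was allocated before the body
    ran.\<close>
  have "M2 (M h + 1) = M (M h + 1)"
    using p f2 by (auto simp: frame_def)
  then have h': "?M5 h = M (M h + 1)" using h by simp
  have r5: "rep H ?M5 (?M5 h) l" unfolding h' using rep_frame[OF _ f15] p(5) by simp
  have f25: "frame H h M2 ?M5"
    using f3 f4 f5 by (meson frame_trans order_refl)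
  have r5': "rep H ?M5 (?M5 (h + 1)) (eval f (x # a # vs))"
    unfolding h(3) using rep_frame[OF r2 f25] .
  have e5: "env_rep H h ?M5 rs vs" using env_rep_frame[OF p(2) f15] by simp
  obtain M6 where 6: "exec ?W (?M5, xs) (fold_steps f vs (spine l) (eval f (x # a # vs)) + 2) (M6, xs)"
    and f6: "frame H h ?M5 M6"
    and r6: "rep H M6 (M6 (h + 1)) (fold_val f vs (spine l) (eval f (x # a # vs)))"
    using "2.IH"[OF i5 e5 p(3,4) r5 r5'] by blast
  have "exec ?W (M, xs) (fold_steps f vs (spine (Nd x l)) a + 2) (M6, xs)"
  proof -
    have b: "exec (Bas (Load (h + 2) h) ;; c ;; copy (h + 1) (h + 3) ;; inc h ;; Bas (Load h h)) (M, xs)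
        (1 + (cost f (x # a # vs) + (1 + (1 + 1)))) (?M5, xs)"
      using 1 2 3 4 5 by (intro exec_Seq)
    have "fst (M, xs) h \<noteq> 0" using p by (auto simp: heap_inv_def)
    from exec_While1[OF this b 6] show ?thesis by (rule exec_time) simp
  qed
  then show ?case using frame_trans[OF f15 f6] r6 by auto
qed

lemma compile_correct:
  "\<lbrakk>heap_inv H M; 5 \<le> h; operand_set (compile rs h e) \<subseteq> {..<H}; env_rep H h M rs vs\<rbrakk> \<Longrightarrow>
    \<exists>M'. exec (compile rs h e) (M, xs) (cost e vs) (M', xs) \<and> frame H h M M' \<and> rep H M' (M' h) (eval e vs)"
  "\<lbrakk>heap_inv H M; 5 \<le> h; operand_set (compiles rs h es) \<subseteq> {..<H}; env_rep H h M rs vs\<rbrakk> \<Longrightarrow>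
    \<exists>M'. exec (compiles rs h es) (M, xs) (sum_list (map (\<lambda>e. cost e vs) es) + 1) (M', xs) \<and>
      frame H h M M' \<and> env_rep H (h + length es) M' [h..<h + length es] (map (\<lambda>e. eval e vs) es)"
proof (induction rs h e and rs h es arbitrary: M vs and M vs rule: compile_compiles.induct)
  case (1 rs h i)
  then show ?case
  proof (cases "i < length rs")
    case True
    have l: "length rs = length vs" using 1 by (simp add: env_rep_def list_all2_lengthD)
    let ?M = "M(h := M (rs ! i))"
    have "exec (compile rs h (Var i)) (M, xs) 1 (?M, xs)"
      using 1 True exec_copy[of M] by (simp add: heap_inv_def)
    moreover have f: "frame H h M ?M"
      using 1 True by (intro frame_upd) (auto simp: copy_def)
    moreover have "rep H M (M (rs ! i)) (vs ! i)"
      using 1(4) True by (simp add: env_rep_def list_all2_conv_all_nth)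
    then have "rep H ?M (?M h) (vs ! i)" using rep_frame[OF _ f] by simp
    moreover have "eval (Var i) vs = vs ! i" "cost (Var i) vs = 1" using l True by simp_all
    ultimately show ?thesis by metis
  next
    case False
    have l: "length rs = length vs" using 1 by (simp add: env_rep_def list_all2_lengthD)
    have "frame H h M (M(h := 0))"
      using 1 False by (intro frame_upd) auto
    then show ?thesis using False l exec_Const[of h 0 M xs] by fastforce
  qed
next
  case (2 rs h)
  have "frame H h M (M(h := 0))"
    using 2 by (intro frame_upd) auto
  then show ?case using exec_Const[of h 0 M xs] by fastforce
next
  case (3 rs h a b)
  note p = "3.prems"
  have o: "operand_set (compile rs h a) \<subseteq> {..<H}" "operand_set (compile rs (h + 1) b) \<subseteq> {..<H}" using p(3) by auto
  obtain M1 where 1: "exec (compile rs h a) (M, xs) (cost a vs) (M1, xs)" "frame H h M M1"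
    "rep H M1 (M1 h) (eval a vs)"
    using "3.IH"(1)[OF p(1,2) o(1) p(4)] by blast
  obtain M2 where 2: "exec (compile rs (h + 1) b) (M1, xs) (cost b vs) (M2, xs)" "frame H (h + 1) M1 M2"
    "rep H M2 (M2 (h + 1)) (eval b vs)"
    using "3.IH"(2)[OF frame_heap_inv[OF 1(2)] _ o(2) env_rep_frame[OF p(4) 1(2)]] p(2) by fastforce
  have r: "rep H M2 (M2 h) (eval a vs)"
    using rep_frame[OF 1(3) 2(2)] frame_reg[OF 2(2)] 3 by simp
  have hH: "h < H" "h + 1 < H"
    using o target_in_operand_set[of h rs a] target_in_operand_set[of "h + 1" rs b] by blast+
  obtain M3 where 3: "exec (alloc h h (h + 1)) (M2, xs) 6 (M3, xs)" "frame H h M2 M3"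
    "rep H M3 (M3 h) (Nd (eval a vs) (eval b vs))"
    using exec_alloc[OF frame_heap_inv[OF 2(2)] p(2) hH(1) trans_le_add1[OF p(2)] hH(2) p(2) hH(1)
      r 2(3) order_refl] by blast
  have "frame H h M M3"
    using 1(2) frame_weaken[OF 2(2)] 3(2) by (meson frame_trans le_add1 order_refl)
  moreover have "exec (compile rs h (Cns a b)) (M, xs) (cost (Cns a b) vs) (M3, xs)"
    using exec_Seq[OF 1(1) exec_Seq[OF 2(1) 3(1)]] unfolding compile.simps by (rule exec_time) simp
  ultimately show ?case using 3(3) unfolding eval.simps by blast
next
  case (4 rs h a)
  note p = "4.prems"
  have o: "operand_set (compile rs h a) \<subseteq> {..<H}" using p(3) by auto
  obtain M1 where 1: "exec (compile rs h a) (M, xs) (cost a vs) (M1, xs)" "frame H h M M1"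
    "rep H M1 (M1 h) (eval a vs)"
    using "4.IH"[OF p(1,2) o p(4)] by blast
  let ?M = "M1(h := M1 (M1 h))"
  have f: "frame H h M1 ?M" using 4 frame_heap_inv[OF 1(2)] by (intro frame_upd) auto
  have "rep H M1 (M1 (M1 h)) (left (eval a vs))"
    using 1(3) frame_heap_inv[OF 1(2)] by (cases "eval a vs") (auto simp: heap_inv_def)
  from rep_frame[OF this f] have "rep H ?M (?M h) (left (eval a vs))" by simp
  moreover have "exec (compile rs h (Hd a)) (M, xs) (cost (Hd a) vs) (?M, xs)"
    using 1 exec_Load by (auto intro!: exec_Seq')
  ultimately show ?case using frame_trans[OF 1(2) f order_refl] unfolding eval.simps by blast
next
  case (5 rs h a)
  note p = "5.prems"
  have o: "operand_set (compile rs h a) \<subseteq> {..<H}" using p(3) by auto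
  obtain M1 where 1: "exec (compile rs h a) (M, xs) (cost a vs) (M1, xs)" "frame H h M M1"
    "rep H M1 (M1 h) (eval a vs)"
    using "5.IH"[OF p(1,2) o p(4)] by blast
  note i1 = frame_heap_inv[OF 1(2)]
  let ?M2 = "M1(h := M1 h + 1)"
  let ?M = "?M2(h := ?M2 (?M2 h))"
  have hH: "h < H" using 5 by simp
  have f1: "frame H h M1 ?M2" using 5 i1 hH by (intro frame_upd) auto
  have f2: "frame H h ?M2 ?M" using 5 frame_heap_inv[OF f1] hH by (intro frame_upd) auto
  have f: "frame H h M1 ?M" using frame_trans[OF f1 f2] by simp
  have "rep H M1 (M1 (M1 h + 1)) (right (eval a vs))"
    using 1(3) i1 by (cases "eval a vs") (auto simp: heap_inv_def)
  moreover have "?M h = M1 (M1 h + 1)"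
    using 1(3) i1 hH 5(3) by (cases "eval a vs") (auto simp: heap_inv_def)
  ultimately have "rep H ?M (?M h) (right (eval a vs))"
    using rep_frame[OF _ f] by metis
  moreover have "exec (compile rs h (Tl a)) (M, xs) (cost (Tl a) vs) (?M, xs)"
  proof -
    have "M1 2 = 1" using i1 by (simp add: heap_inv_def)
    note exec_Seq[OF 1(1) exec_Seq[OF exec_inc[of M1, OF this, of h] exec_Load[of h h]]]
    then show ?thesis unfolding compile.simps by (rule exec_time) simp
  qed
  ultimately show ?case using frame_trans[OF 1(2) f order_refl] unfolding eval.simps by blast
next
  case (6 rs h c a b)
  note p = "6.prems"
  have o: "operand_set (compile rs h c) \<subseteq> {..<H}" "operand_set (compile rs h a) \<subseteq> {..<H}"
    "operand_set (compile rs h b) \<subseteq> {..<H}" using p(3) by auto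
  obtain M1 where 1: "exec (compile rs h c) (M, xs) (cost c vs) (M1, xs)" "frame H h M M1"
    "rep H M1 (M1 h) (eval c vs)"
    using "6.IH"(1)[OF p(1,2) o(1) p(4)] by blast
  note i1 = frame_heap_inv[OF 1(2)]
  have z: "M1 h = 0 \<longleftrightarrow> eval c vs = Lf" using 1(3) i1 by (cases "eval c vs") (auto simp: heap_inv_def)
  have e1: "env_rep H h M1 rs vs" using env_rep_frame[OF p(4) 1(2)] by simp
  obtain M2 where 2: "exec (IfZ h (compile rs h b) (compile rs h a)) (M1, xs)
      ((if eval c vs = Lf then cost b vs else cost a vs) + 2) (M2, xs)" "frame H h M1 M2"
    "rep H M2 (M2 h) (if eval c vs = Lf then eval b vs else eval a vs)"
  proof (cases "eval c vs = Lf")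
    case True
    obtain M2 where "exec (compile rs h b) (M1, xs) (cost b vs) (M2, xs)" "frame H h M1 M2"
      "rep H M2 (M2 h) (eval b vs)" using "6.IH"(2)[OF i1 p(2) o(3) e1] by blast
    then show ?thesis using that[of M2] True z exec_If0[of "(M1, xs)" h] by simp
  next
    case False
    obtain M2 where "exec (compile rs h a) (M1, xs) (cost a vs) (M2, xs)" "frame H h M1 M2"
      "rep H M2 (M2 h) (eval a vs)" using "6.IH"(3)[OF i1 p(2) o(2) e1] by blast
    then show ?thesis using that[of M2] False z exec_If1[of "(M1, xs)" h] by simp
  qed
  have "exec (compile rs h (Ite c a b)) (M, xs) (cost (Ite c a b) vs) (M2, xs)"
    using exec_Seq[OF 1(1) 2(1)] by (simp add: ac_simps)
  then show ?case using frame_trans[OF 1(2) 2(2) order_refl] 2(3) unfolding eval.simps by blast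
next
  case (7 rs h l a f)
  note p = "7.prems"
  have o: "operand_set (compile rs h l) \<subseteq> {..<H}" "operand_set (compile rs (h + 1) a) \<subseteq> {..<H}"
    "operand_set (compile ((h + 2) # (h + 1) # rs) (h + 3) f) \<subseteq> {..<H}" using p(3) by auto
  obtain M1 where 1: "exec (compile rs h l) (M, xs) (cost l vs) (M1, xs)" "frame H h M M1"
    "rep H M1 (M1 h) (eval l vs)"
    using "7.IH"(1)[OF p(1,2) o(1) p(4)] by blast
  obtain M2 where 2: "exec (compile rs (h + 1) a) (M1, xs) (cost a vs) (M2, xs)" "frame H (h + 1) M1 M2"
    "rep H M2 (M2 (h + 1)) (eval a vs)"
    using "7.IH"(2)[OF frame_heap_inv[OF 1(2)] _ o(2) env_rep_frame[OF p(4) 1(2)]] p(2) by fastforce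
  note i2 = frame_heap_inv[OF 2(2)]
  have r: "rep H M2 (M2 h) (eval l vs)"
    using rep_frame[OF 1(3) 2(2)] frame_reg[OF 2(2)] 7 by simp
  have f12: "frame H h M M2" using 1 2 by (meson frame_trans frame_weaken le_add1 order_refl)
  have e2: "env_rep H h M2 rs vs" using env_rep_frame[OF p(4) f12] by simp
  have H: "h + 3 < H" using p(3) by (auto simp: copy_def)
  have IH: "\<exists>M'. exec (compile ((h + 2) # (h + 1) # rs) (h + 3) f) (M, xs) (cost f env) (M', xs) \<and>
      frame H (h + 3) M M' \<and> rep H M' (M' (h + 3)) (eval f env)"
    if "heap_inv H M" "env_rep H (h + 3) M ((h + 2) # (h + 1) # rs) env" for M env
    using "7.IH"(3)[OF that(1) _ o(3) that(2)] p(2) by simp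
  let ?W = "While h (Bas (Load (h + 2) h) ;; compile ((h + 2) # (h + 1) # rs) (h + 3) f ;;
       copy (h + 1) (h + 3) ;; inc h ;; Bas (Load h h))"
  let ?g = "\<lambda>x a. eval f (x # a # vs)" and ?c = "\<lambda>x a. cost f (x # a # vs)"
  obtain M3 where 3: "exec ?W (M2, xs) (fold_cost ?g ?c (spine (eval l vs)) (eval a vs) + 2) (M3, xs)"
    "frame H h M2 M3" "rep H M3 (M3 (h + 1)) (fold ?g (spine (eval l vs)) (eval a vs))"
    using exec_fold_loop[OF IH i2 e2 p(2) H r 2(3)] by blast
  note i3 = frame_heap_inv[OF 3(2)]
  have f4: "frame H h M3 (M3(h := M3 (h + 1)))" using p(2) H i3 by (intro frame_upd) auto
  have "exec (compile rs h (Fold l a f)) (M, xs)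
      (cost l vs + (cost a vs + (fold_cost ?g ?c (spine (eval l vs)) (eval a vs) + 2 + 1))) (M3(h := M3 (h + 1)), xs)"
    using exec_Seq[OF 1(1) exec_Seq[OF 2(1) exec_Seq[OF 3(1) exec_copy[of M3 h "h + 1" xs, OF heap_inv_0[OF i3]]]]]
    unfolding compile.simps .
  then have "exec (compile rs h (Fold l a f)) (M, xs) (cost (Fold l a f) vs) (M3(h := M3 (h + 1)), xs)"
    by (rule exec_time) simp
  moreover have "frame H h M (M3(h := M3 (h + 1)))" using f12 3(2) f4 by (meson frame_trans order_refl)
  moreover have "rep H (M3(h := M3 (h + 1))) ((M3(h := M3 (h + 1))) h) (eval (Fold l a f) vs)"
    using rep_frame[OF 3(3) f4] by simp
  ultimately show ?case by blast
next
  case (8 rs h f es)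
  note p = "8.prems"
  have o: "operand_set (compiles rs h es) \<subseteq> {..<H}"
    "operand_set (compile [h..<h + length es] (h + length es) f) \<subseteq> {..<H}" using p(3) by auto
  obtain M1 where 1: "exec (compiles rs h es) (M, xs) (sum_list (map (\<lambda>e. cost e vs) es) + 1) (M1, xs)"
      "frame H h M M1" "env_rep H (h + length es) M1 [h..<h + length es] (map (\<lambda>e. eval e vs) es)"
    using "8.IH"(1)[OF p(1,2) o(1) p(4)] by blast
  note i1 = frame_heap_inv[OF 1(2)]
  obtain M2 where 2: "exec (compile [h..<h + length es] (h + length es) f) (M1, xs)
      (cost f (map (\<lambda>e. eval e vs) es)) (M2, xs)" "frame H (h + length es) M1 M2"
      "rep H M2 (M2 (h + length es)) (eval f (map (\<lambda>e. eval e vs) es))"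
    using "8.IH"(2)[OF i1 _ o(2) 1(3)] p(2) by fastforce
  note i2 = frame_heap_inv[OF 2(2)]
  let ?M = "M2(h := M2 (h + length es))"
  have f3: "frame H h M2 ?M" using p(2,3) i2 by (intro frame_upd) (auto simp: copy_def)
  have "exec (compile rs h (Call f es)) (M, xs) (sum_list (map (\<lambda>e. cost e vs) es) + 1 +
      (cost f (map (\<lambda>e. eval e vs) es) + 1)) (?M, xs)"
    using exec_Seq[OF 1(1) exec_Seq[OF 2(1) exec_copy[of M2 h "h + length es" xs, OF heap_inv_0[OF i2]]]]
    unfolding compile.simps .
  then have "exec (compile rs h (Call f es)) (M, xs) (cost (Call f es) vs) (?M, xs)"
    by (rule exec_time) (simp add: comp_def)
  moreover have "frame H h M ?M"
    using 1(2) 2(2) f3 by (meson frame_trans frame_weaken le_add1 order_refl)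
  moreover have "rep H ?M (?M h) (eval (Call f es) vs)"
    using rep_frame[OF 2(3) f3] by (simp add: comp_def)
  ultimately show ?case by blast
next
  case (9 rs h)
  have "frame H h M (M(4 := 0))"
    using 9 by (intro frame_upd) auto
  then show ?case using exec_Const[of 4 0 M xs] by (auto simp: env_rep_def)
next
  case (10 rs h e es)
  note p = "10.prems"
  have o: "operand_set (compile rs h e) \<subseteq> {..<H}" "operand_set (compiles rs (h + 1) es) \<subseteq> {..<H}" using p(3) by auto
  obtain M1 where 1: "exec (compile rs h e) (M, xs) (cost e vs) (M1, xs)" "frame H h M M1"
    "rep H M1 (M1 h) (eval e vs)"
    using "10.IH"(1)[OF p(1,2) o(1) p(4)] by blast
  obtain M2 where 2: "exec (compiles rs (h + 1) es) (M1, xs) (sum_list (map (\<lambda>e. cost e vs) es) + 1) (M2, xs)"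
      "frame H (h + 1) M1 M2"
      "env_rep H (h + 1 + length es) M2 [h + 1..<h + 1 + length es] (map (\<lambda>e. eval e vs) es)"
    using "10.IH"(2)[OF frame_heap_inv[OF 1(2)] _ o(2) env_rep_frame[OF p(4) 1(2)]] p(2) by fastforce
  have r: "rep H M2 (M2 h) (eval e vs)"
    using rep_frame[OF 1(3) 2(2)] frame_reg[OF 2(2)] 10 by simp
  have "exec (compiles rs h (e # es)) (M, xs) (sum_list (map (\<lambda>e. cost e vs) (e # es)) + 1) (M2, xs)"
    using exec_Seq[OF 1(1) 2(1)] by (simp add: ac_simps)
  moreover have "frame H h M M2" using 1 2 by (meson frame_trans frame_weaken le_add1 order_refl)
  moreover have "env_rep H (h + length (e # es)) M2 [h..<h + length (e # es)] (map (\<lambda>e. eval e vs) (e # es))"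
    using 2(3) r p(2) by (simp add: upt_conv_Cons env_rep_def del: upt_Suc)
  ultimately show ?case by blast
qed

section \<open>Reading the input\<close>

text \<open>Folding over a list is the only loop, so a number is a list of leaves: it can serve as a
  loop counter, and arithmetic becomes list processing. Indices, colours and radii are small enough
  for unary notation.\<close>

definition un :: "nat \<Rightarrow> tree" where
  "un n = ((\<lambda>t. Nd Lf t) ^^ n) Lf"

lemma un_simps [simp]: "un 0 = Lf" "un (Suc n) = Nd Lf (un n)"
  by (simp_all add: un_def)

fun enc_list :: "tree list \<Rightarrow> tree" where
  "enc_list [] = Lf"
| "enc_list (t # ts) = Nd t (enc_list ts)"

definition enc_lit :: "literal \<Rightarrow> tree" where
  "enc_lit l = Nd (un (fst l)) (un (snd l))"

definition enc_con :: "constraint \<Rightarrow> tree" where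
  "enc_con C = enc_list (map enc_lit C)"

definition enc_formula :: "formula \<Rightarrow> tree" where
  "enc_formula F = enc_list (map enc_con F)"

definition dec :: "nat \<Rightarrow> com" where
  "dec i = Bas (Sub i i 2)"

abbreviation "count_loop r \<equiv> While (r + 1) (dec (r + 1) ;; alloc r (r + 2) r)"

definition read_num :: "nat \<Rightarrow> com" where
  "read_num r = Bas (Read (r + 1)) ;; Bas (Const r 0) ;; Bas (Const (r + 2) 0) ;;
     count_loop r"

text \<open>Reading the second number leaves register 10 alone and uses registers 11 to 13; this is
  where the condition \<open>13 < H\<close> comes from.\<close>

definition read_con :: com where
  "read_con = While 9 (dec 9 ;; read_num 10 ;; read_num 11 ;; alloc 10 10 11 ;; alloc 8 10 8)"

definition read_formula :: com where
  "read_formula = While 7 (dec 7 ;; Bas (Const 8 0) ;; Bas (Read 9) ;; read_con ;; alloc 6 8 6)"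

definition decider :: "nat \<Rightarrow> exp \<Rightarrow> com" where
  "decider H e = Bas (Const 2 1) ;; Bas (Const 3 H) ;; read_num 5 ;; Bas (Const 6 0) ;;
     Bas (Read 7) ;; read_formula ;; compile [5, 6] 7 e ;; IfZ 7 (Bas (Const 0 0)) (Bas (Const 0 1))"

lemma exec_dec: "M 2 = 1 \<Longrightarrow> exec (dec i) (M, xs) 1 (M(i := M i - 1), xs)"
  using exec_Bas[of "Sub i i 2" "(M, xs)"] by (simp add: dec_def)

lemma exec_Read: "exec (Bas (Read i)) (M, x # xs) 1 (M(i := x), xs)"
  using exec_Bas[of "Read i" "(M, x # xs)"] by simp

lemma heap_inv_2: "heap_inv H M \<Longrightarrow> M 2 = 1"
  by (simp add: heap_inv_def)

lemma exec_While1': "M r \<noteq> 0 \<Longrightarrow> exec a (M, xs) t s' \<Longrightarrow> exec (While r a) s' u s'' \<Longrightarrow>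
    v = t + u + 2 \<Longrightarrow> exec (While r a) (M, xs) v s''"
  using exec_While1[of "(M, xs)"] by simp

lemma un_loop:
  assumes "5 \<le> r" "r + 2 < H"
  shows "\<lbrakk>heap_inv H M; rep H M (M r) (un w); M (r + 1) = v; M (r + 2) = 0\<rbrakk> \<Longrightarrow>
    \<exists>M'. exec (count_loop r) (M, xs) (9 * v + 2) (M', xs) \<and>
      frame H r M M' \<and> rep H M' (M' r) (un (w + v))"
proof (induction v arbitrary: M w)
  case 0
  then show ?case using exec_While0[of "(M, xs)" "r + 1"]
    by (auto simp: numeral_2_eq_2 intro!: frame_refl exI[of _ M])
next
  case (Suc v)
  let ?M1 = "M(r + 1 := M (r + 1) - 1)"
  have f1: "frame H r M ?M1" using Suc.prems assms by (intro frame_upd) auto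
  note i1 = frame_heap_inv[OF f1]
  have r1: "rep H ?M1 (?M1 r) (un w)" using rep_frame[OF Suc.prems(2) f1] by simp
  have "rep H ?M1 (?M1 (r + 2)) Lf" using Suc.prems by simp
  from exec_alloc[OF i1 _ _ assms(1) _ assms(1) _ this r1 order_refl, of xs] assms
  obtain M2 where 2: "exec (alloc r (r + 2) r) (?M1, xs) 6 (M2, xs)" "frame H r ?M1 M2"
    "rep H M2 (M2 r) (Nd Lf (un w))" "\<forall>s. 5 \<le> s \<and> s < H \<and> s \<noteq> r \<longrightarrow> M2 s = ?M1 s"
    by auto
  note i2 = frame_heap_inv[OF 2(2)]
  have "M2 (r + 1) = v" "M2 (r + 2) = 0" "rep H M2 (M2 r) (un (Suc w))"
    using 2 assms Suc.prems by simp_all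
  from Suc.IH[OF i2 this(3,1,2)] obtain M3 where 3:
    "exec (count_loop r) (M2, xs) (9 * v + 2) (M3, xs)"
    "frame H r M2 M3" "rep H M3 (M3 r) (un (Suc w + v))" by blast
  have "exec (count_loop r) (M, xs) (9 * Suc v + 2) (M3, xs)"
    using Suc.prems exec_Seq[OF exec_dec[of M, OF heap_inv_2[OF Suc.prems(1)], of "r + 1"] 2(1)]
    by (intro exec_While1'[OF _ _ 3(1)]) auto
  moreover have "frame H r M M3" using f1 2 3 by (meson frame_trans order_refl)
  ultimately show ?case using 3(3) by auto
qed

lemma exec_read_num:
  assumes "5 \<le> r" "r + 2 < H" "heap_inv H M"
  shows "\<exists>M'. exec (read_num r) (M, v # xs) (9 * v + 5) (M', xs) \<and>
      frame H r M M' \<and> rep H M' (M' r) (un v)"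
proof -
  let ?M1 = "M(r + 1 := v)"
  let ?M2 = "?M1(r := 0)"
  let ?M3 = "?M2(r + 2 := 0)"
  have f1: "frame H r M ?M1" using assms by (intro frame_upd) auto
  have f2: "frame H r ?M1 ?M2" using frame_heap_inv[OF f1] assms by (intro frame_upd) auto
  have f3: "frame H r ?M2 ?M3" using frame_heap_inv[OF f2] assms by (intro frame_upd) auto
  from un_loop[OF assms(1,2) frame_heap_inv[OF f3], of 0 v xs] obtain M4 where 4:
    "exec (count_loop r) (?M3, xs) (9 * v + 2) (M4, xs)"
    "frame H r ?M3 M4" "rep H M4 (M4 r) (un v)" by auto
  have "exec (read_num r) (M, v # xs) (9 * v + 5) (M4, xs)"
    unfolding read_num_def
    by (rule exec_time[OF exec_Seq[OF exec_Read exec_Seq[OF exec_Const exec_Seq[OF exec_Const 4(1)]]]]) simp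
  moreover have "frame H r M M4" using f1 f2 f3 4 by (meson frame_trans order_refl)
  ultimately show ?thesis using 4 by blast
qed

text \<open>Per literal: decrementing 1, two numbers with 5 each besides their loops, two
  allocations with 6 each, and 2 for the jumps.\<close>

definition con_cost :: "constraint \<Rightarrow> nat" where
  "con_cost C = (\<Sum>(i, c)\<leftarrow>C. 9 * i + 9 * c + 25)"

text \<open>Each literal is put in front of those already read, so constraints, and likewise the
  formula, arrive reversed. Satisfiability does not depend on the order.\<close>

lemma exec_read_con:
  assumes "13 < H"
  shows "\<lbrakk>heap_inv H M; rep H M (M 8) (enc_con D); M 9 = length C\<rbrakk> \<Longrightarrow>
    \<exists>M'. exec read_con (M, concat (map (\<lambda>(i, c). [i, c]) C) @ xs) (con_cost C + 2) (M', xs) \<and>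
      frame H 8 M M' \<and> rep H M' (M' 8) (enc_con (rev C @ D))"
proof (induction C arbitrary: M D)
  case Nil
  then show ?case using exec_While0[of "(M, xs)" 9]
    by (auto simp: con_cost_def read_con_def numeral_2_eq_2 intro!: frame_refl exI[of _ M])
next
  case (Cons l C)
  obtain i c where l: "l = (i, c)" by (cases l)
  let ?ys = "concat (map (\<lambda>(i, c). [i, c]) C) @ xs"
  let ?M1 = "M(9 := M 9 - 1)"
  have f1: "frame H 8 M ?M1" using Cons.prems assms by (intro frame_upd) auto
  note i1 = frame_heap_inv[OF f1]
  obtain M2 where 2: "exec (read_num 10) (?M1, i # c # ?ys) (9 * i + 5) (M2, c # ?ys)"
    "frame H 10 ?M1 M2" "rep H M2 (M2 10) (un i)"
    using exec_read_num[OF _ _ i1, of 10 i "c # ?ys"] assms by auto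
  note i2 = frame_heap_inv[OF 2(2)]
  obtain M3 where 3: "exec (read_num 11) (M2, c # ?ys) (9 * c + 5) (M3, ?ys)"
    "frame H 11 M2 M3" "rep H M3 (M3 11) (un c)"
    using exec_read_num[OF _ _ i2, of 11 c ?ys] assms by auto
  note i3 = frame_heap_inv[OF 3(2)]
  have r3: "rep H M3 (M3 10) (un i)" using rep_frame[OF 2(3) 3(2)] frame_reg[OF 3(2)] by simp
  obtain M4 where 4: "exec (alloc 10 10 11) (M3, ?ys) 6 (M4, ?ys)" "frame H 10 M3 M4"
    "rep H M4 (M4 10) (Nd (un i) (un c))"
    using exec_alloc[OF i3 _ _ _ _ _ _ r3 3(3), of 10 10 ?ys] assms by auto
  note i4 = frame_heap_inv[OF 4(2)]
  have f14: "frame H 10 ?M1 M4" using 2(2) frame_weaken[OF 3(2), of 10] 4(2)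
    by (auto intro: frame_trans)
  have f8: "frame H 8 M M4" using f1 frame_weaken[OF f14, of 8] by (auto intro: frame_trans)
  have "M4 8 = M 8" using frame_reg[OF f14, of 8] by simp
  then have r8: "rep H M4 (M4 8) (enc_con D)" using rep_frame[OF Cons.prems(2) f8] by simp
  obtain M5 where 5: "exec (alloc 8 10 8) (M4, ?ys) 6 (M5, ?ys)" "frame H 8 M4 M5"
    "rep H M5 (M5 8) (Nd (Nd (un i) (un c)) (enc_con D))"
    "\<forall>r. 5 \<le> r \<and> r < H \<and> r \<noteq> 8 \<longrightarrow> M5 r = M4 r"
    using exec_alloc[OF i4 _ _ _ _ _ _ 4(3) r8, of 8 8 ?ys] assms by auto
  have f15: "frame H 8 M M5" using f8 5(2) by (auto intro: frame_trans)
  have "M5 9 = length C" using 5(4) frame_reg[OF f14, of 9] Cons.prems assms by simp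
  from Cons.IH[OF frame_heap_inv[OF 5(2)] _ this, of "(i, c) # D"] 5(3)
  obtain M6 where 6: "exec read_con (M5, ?ys) (con_cost C + 2) (M6, xs)"
      "frame H 8 M5 M6" "rep H M6 (M6 8) (enc_con (rev C @ l # D))"
    by (auto simp: enc_con_def enc_lit_def l)
  have "exec read_con (M, i # c # ?ys) (con_cost ((i, c) # C) + 2) (M6, xs)"
    unfolding read_con_def
    using Cons.prems exec_Seq[OF exec_dec[of M, OF heap_inv_2[OF Cons.prems(1)], of 9]
      exec_Seq[OF 2(1) exec_Seq[OF 3(1) exec_Seq[OF 4(1) 5(1)]]]]
    by (intro exec_While1'[OF _ _ 6(1)[unfolded read_con_def]]) (auto simp: con_cost_def)
  moreover have "frame H 8 M M6" using f15 6(2) by (auto intro: frame_trans)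
  moreover have "concat (map (\<lambda>(i, c). [i, c]) (l # C)) @ xs = i # c # ?ys" by (simp add: l)
  moreover have "rev (l # C) @ D = rev C @ l # D" by simp
  ultimately show ?case using 6(3) l by metis
qed

definition formula_cost :: "formula \<Rightarrow> nat" where
  "formula_cost F = (\<Sum>C\<leftarrow>F. con_cost C + 13)"

lemma exec_read_formula:
  assumes "13 < H"
  shows "\<lbrakk>heap_inv H M; rep H M (M 6) (enc_formula G); M 7 = length F\<rbrakk> \<Longrightarrow>
    \<exists>M'. exec read_formula (M, concat (map encode_constraint F) @ xs) (formula_cost F + 2) (M', xs) \<and>
      frame H 6 M M' \<and> rep H M' (M' 6) (enc_formula (rev (map rev F) @ G))"
proof (induction F arbitrary: M G)
  case Nil
  then show ?case using exec_While0[of "(M, xs)" 7]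
    by (auto simp: formula_cost_def read_formula_def numeral_2_eq_2 intro!: frame_refl exI[of _ M])
next
  case (Cons C F)
  let ?ys = "concat (map encode_constraint F) @ xs"
  let ?zs = "concat (map (\<lambda>(i, c). [i, c]) C) @ ?ys"
  let ?M1 = "M(7 := M 7 - 1)"
  have f1: "frame H 7 M ?M1" using Cons.prems assms by (intro frame_upd) auto
  let ?M2 = "?M1(8 := 0)"
  have f2: "frame H 8 ?M1 ?M2" using frame_heap_inv[OF f1] assms by (intro frame_upd) auto
  let ?M3 = "?M2(9 := length C)"
  have f3: "frame H 8 ?M2 ?M3" using frame_heap_inv[OF f2] assms by (intro frame_upd) auto
  obtain M4 where 4: "exec read_con (?M3, ?zs) (con_cost C + 2) (M4, ?ys)"
      "frame H 8 ?M3 M4" "rep H M4 (M4 8) (enc_con (rev C))"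
    using exec_read_con[OF assms frame_heap_inv[OF f3], of "[]" C ?ys] by (auto simp: enc_con_def)
  note i4 = frame_heap_inv[OF 4(2)]
  have f14: "frame H 8 ?M1 M4" using f2 f3 4(2) by (meson frame_trans order_refl)
  have f7: "frame H 7 M M4" using f1 frame_weaken[OF f14, of 7] by (auto intro: frame_trans)
  have r6: "rep H M4 (M4 6) (enc_formula G)"
    using rep_frame[OF Cons.prems(2) f7] frame_reg[OF f7, of 6] by simp
  obtain M5 where 5: "exec (alloc 6 8 6) (M4, ?ys) 6 (M5, ?ys)" "frame H 6 M4 M5"
    "rep H M5 (M5 6) (Nd (enc_con (rev C)) (enc_formula G))"
    "\<forall>r. 5 \<le> r \<and> r < H \<and> r \<noteq> 6 \<longrightarrow> M5 r = M4 r"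
    using exec_alloc[OF i4 _ _ _ _ _ _ 4(3) r6, of 6 6 ?ys] assms by auto
  have f15: "frame H 6 M M5" using frame_weaken[OF f7, of 6] 5(2) by (auto intro: frame_trans)
  have "M5 7 = length F" using 5(4) frame_reg[OF f14, of 7] Cons.prems assms by simp
  from Cons.IH[OF frame_heap_inv[OF 5(2)] _ this, of "rev C # G"] 5(3)
  obtain M6 where 6: "exec read_formula (M5, ?ys) (formula_cost F + 2) (M6, xs)"
      "frame H 6 M5 M6" "rep H M6 (M6 6) (enc_formula (rev (map rev F) @ rev C # G))"
    by (auto simp: enc_formula_def)
  have "exec read_formula (M, length C # ?zs) (formula_cost (C # F) + 2) (M6, xs)"
    unfolding read_formula_def
    using Cons.prems exec_Seq[OF exec_dec[of M, OF heap_inv_2[OF Cons.prems(1)], of 7]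
      exec_Seq[OF exec_Const exec_Seq[OF exec_Read exec_Seq[OF 4(1) 5(1)]]]]
    by (intro exec_While1'[OF _ _ 6(1)[unfolded read_formula_def]]) (auto simp: formula_cost_def)
  moreover have "frame H 6 M M6" using f15 6(2) by (auto intro: frame_trans)
  moreover have "concat (map encode_constraint (C # F)) @ xs = length C # ?zs"
    by (simp add: encode_constraint_def)
  moreover have "rev (map rev (C # F)) @ G = rev (map rev F) @ rev C # G" by simp
  ultimately show ?case using 6(3) by metis
qed

text \<open>The summand 14 collects the initialisation, the loop exits and the final test.\<close>

definition total_steps :: "exp \<Rightarrow> nat \<Rightarrow> formula \<Rightarrow> nat" where
  "total_steps e n F = 9 * n + formula_cost F + cost e [un n, enc_formula (rev (map rev F))] + 14"

lemma exec_decider: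
  assumes "13 < H" "operand_set (compile [5, 6] 7 e) \<subseteq> {..<H}"
  shows "\<exists>M. exec (decider H e) (\<lambda>_. 0, encode_formula n F) (total_steps e n F) (M, []) \<and>
    M 0 = (if eval e [un n, enc_formula (rev (map rev F))] = Lf then 0 else 1)"
proof -
  let ?zs = "concat (map encode_constraint F)"
  let ?M1 = "(\<lambda>_. 0)(2 := 1)"
  let ?M2 = "?M1(3 := H)"
  have i2: "heap_inv H ?M2" using assms by (auto simp: heap_inv_def)
  obtain M3 where 3: "exec (read_num 5) (?M2, n # length F # ?zs) (9 * n + 5) (M3, length F # ?zs)"
    "frame H 5 ?M2 M3" "rep H M3 (M3 5) (un n)"
    using exec_read_num[OF _ _ i2, of 5 n "length F # ?zs"] assms by auto
  let ?M4 = "M3(6 := 0)"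
  have f4: "frame H 6 M3 ?M4" using frame_heap_inv[OF 3(2)] assms by (intro frame_upd) auto
  let ?M5 = "?M4(7 := length F)"
  have f5: "frame H 6 ?M4 ?M5" using frame_heap_inv[OF f4] assms by (intro frame_upd) auto
  obtain M6 where 6: "exec read_formula (?M5, ?zs) (formula_cost F + 2) (M6, [])"
      "frame H 6 ?M5 M6" "rep H M6 (M6 6) (enc_formula (rev (map rev F)))"
    using exec_read_formula[OF assms(1) frame_heap_inv[OF f5], of "[]" F "[]"]
    by (auto simp: enc_formula_def)
  note i6 = frame_heap_inv[OF 6(2)]
  have f6: "frame H 6 M3 M6" using f4 f5 6(2) by (meson frame_trans order_refl)
  have "rep H M6 (M6 5) (un n)" using rep_frame[OF 3(3) f6] frame_reg[OF f6, of 5] by simp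
  then have "env_rep H 7 M6 [5, 6] [un n, enc_formula (rev (map rev F))]" (is "env_rep _ _ _ _ ?env")
    using 6(3) by (simp add: env_rep_def)
  from compile_correct(1)[OF i6 _ assms(2) this, of "[]"] obtain M7 where 7:
    "exec (compile [5, 6] 7 e) (M6, []) (cost e ?env) (M7, [])" "frame H 7 M6 M7"
    "rep H M7 (M7 7) (eval e ?env)" by auto
  have z: "M7 7 = 0 \<longleftrightarrow> eval e ?env = Lf"
    using 7(3) frame_heap_inv[OF 7(2)] by (cases "eval e ?env") (auto simp: heap_inv_def)
  let ?M8 = "M7(0 := if eval e ?env = Lf then 0 else 1)"
  have 8: "exec (IfZ 7 (Bas (Const 0 0)) (Bas (Const 0 1))) (M7, []) 3 (?M8, [])"
  proof (cases "eval e ?env = Lf")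
    case True
    with exec_If0[of "(M7, [])" 7, OF _ exec_Const[of 0 0 M7 "[]"]] z show ?thesis by (simp add: numeral_3_eq_3)
  next
    case False
    with exec_If1[of "(M7, [])" 7, OF _ exec_Const[of 0 1 M7 "[]"]] z show ?thesis by (simp add: numeral_3_eq_3)
  qed
  have "exec (decider H e) (\<lambda>_. 0, encode_formula n F) (total_steps e n F) (?M8, [])"
    unfolding decider_def encode_formula_def
    by (rule exec_time[OF exec_Seq[OF exec_Const exec_Seq[OF exec_Const exec_Seq[OF 3(1)
      exec_Seq[OF exec_Const exec_Seq[OF exec_Read exec_Seq[OF 6(1) exec_Seq[OF 7(1) 8]]]]]]]])
      (simp add: total_steps_def)
  then show ?thesis by (intro exI[of _ ?M8]) simp
qed

text \<open>\<open>K\<close> bounds the constants in the program and \<open>B\<close> the numbers in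
  the input. No step raises the largest number by more than one, so \<open>K + B\<close> plus the
  number of steps bounds every number that occurs.\<close>

theorem program_of_exp:
  obtains P K where "\<And>n F B. \<lbrakk>n \<le> B; length F \<le> B; \<forall>C\<in>set F. length C \<le> B \<and> (\<forall>(i, c)\<in>set C. i \<le> B \<and> c \<le> B)\<rbrakk> \<Longrightarrow>
    \<exists>t. computes_in_time P (encode_formula n F)
      (if eval e [un n, enc_formula (rev (map rev F))] = Lf then 0 else 1) t \<and>
      t \<le> total_steps e n F * (5 * num_size (K + B + total_steps e n F))"
proof -
  \<comment> \<open>The heap starts above the input registers and above all operands of the compiled
    term. The choice is not circular, because that code does not mention \<open>H\<close>.\<close>
  define H where "H = Suc (Max (insert 13 (operand_set (compile [5, 6] 7 e))))"
  have H: "13 < H" "operand_set (compile [5, 6] 7 e) \<subseteq> {..<H}"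
    using finite_operand_set[of "compile [5, 6] 7 e"] by (auto simp: H_def less_Suc_eq_le)
  define c where "c = decider H e"
  define K where "K = Max (operand_set c)"
  show ?thesis
  proof (rule that[of "code 0 c" K])
    fix n F B
    assume B: "n \<le> B" "length F \<le> B" "\<forall>C\<in>set F. length C \<le> B \<and> (\<forall>(i, c)\<in>set C. i \<le> B \<and> c \<le> B)"
    obtain M where M: "exec c (\<lambda>_. 0, encode_formula n F) (total_steps e n F) (M, [])"
      "M 0 = (if eval e [un n, enc_formula (rev (map rev F))] = Lf then 0 else 1)"
      using exec_decider[OF H] unfolding c_def by blast
    have at: "code_at (code 0 c) 0 c" by (auto simp: code_at_def)
    have ops: "\<forall>v\<in>operand_set c. v \<le> K + B"
      unfolding K_def using finite_operand_set[of c] by (meson Max_ge trans_le_add1)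
    have ins: "\<forall>x\<in>set (encode_formula n F). x \<le> K + B"
      using B by (fastforce simp: encode_formula_def encode_constraint_def intro: trans_le_add2)
    from exec_runs[OF M(1) at ops _ _ order_refl] ins
    obtain u where u: "runs (code 0 c) (0, \<lambda>_. 0, encode_formula n F) u (csize c, M, [])"
      "u \<le> total_steps e n F * (5 * num_size (K + B + total_steps e n F))" by auto
    have "computes_in_time (code 0 c) (encode_formula n F)
      (if eval e [un n, enc_formula (rev (map rev F))] = Lf then 0 else 1) u"
      unfolding computes_in_time_def using u(1) M(2) by (metis length_code order_refl)
    then show "\<exists>t. computes_in_time (code 0 c) (encode_formula n F)
      (if eval e [un n, enc_formula (rev (map rev F))] = Lf then 0 else 1) t \<and>
      t \<le> total_steps e n F * (5 * num_size (K + B + total_steps e n F))" using u(2) by blast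
  qed
qed

section \<open>Programs for the skewed distance\<close>

text \<open>
  The suffix \<open>_e\<close> marks a term of the tree language, \<open>_B s\<close> a bound on its cost for arguments of
  size at most \<open>s\<close>.  False is represented by \<open>Lf\<close>.
\<close>

lemma spine_enc_list [simp]: "spine (enc_list ts) = ts"
  by (induction ts) auto

lemma enc_list_spine [simp]: "enc_list (spine t) = t"
  by (induction t rule: spine.induct) auto

lemma spine_un [simp]: "spine (un n) = replicate n Lf"
  by (induction n) auto

lemma enc_list_eq_Lf [simp]: "enc_list ts = Lf \<longleftrightarrow> ts = []"
  by (cases ts) auto

lemma un_eq_Lf [simp]: "un n = Lf \<longleftrightarrow> n = 0"
  by (cases n) auto

lemma right_un [simp]: "right (un n) = un (n - 1)"
  by (cases n) auto

lemma un_eq_iff [simp]: "un m = un n \<longleftrightarrow> m = n"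
proof (induction m arbitrary: n)
  case (Suc m)
  then show ?case by (cases n) auto
qed (metis un_eq_Lf un_simps(1))

lemma enc_list_replicate [simp]: "enc_list (replicate n Lf) = un n"
  by (induction n) auto

text \<open>Data refinement: \<open>ex\<close> and \<open>ea\<close> encode entries and accumulators
  of an abstract fold with step \<open>h\<close>. Value, invariant and cost are proved together
  because the cost of a step is bounded only under the invariant.\<close>

lemma fold_rep:
  assumes "Inv a" "\<And>x a. x \<in> set xs \<Longrightarrow> Inv a \<Longrightarrow>
      g (ex x) (ea a) = ea (h x a) \<and> Inv (h x a) \<and> c (ex x) (ea a) \<le> B"
  shows "fold g (map ex xs) (ea a) = ea (fold h xs a) \<and> Inv (fold h xs a) \<and>
    fold_cost g c (map ex xs) (ea a) \<le> length xs * (B + 6)"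
  using assms
proof (induction xs arbitrary: a)
  case (Cons x xs)
  have 1: "g (ex x) (ea a) = ea (h x a)" "Inv (h x a)" "c (ex x) (ea a) \<le> B"
    using Cons.prems by auto
  have "fold g (map ex xs) (ea (h x a)) = ea (fold h xs (h x a)) \<and> Inv (fold h xs (h x a)) \<and>
    fold_cost g c (map ex xs) (ea (h x a)) \<le> length xs * (B + 6)"
    by (rule Cons.IH) (use Cons.prems 1 in auto)
  with 1 show ?case by auto
qed auto

lemma fold_bound: "c \<le> n * B \<Longrightarrow> n \<le> s \<Longrightarrow> B \<le> B' \<Longrightarrow> c \<le> s * (B' :: nat)"
  by (meson mult_le_mono order_trans)

lemma fold_cost_le:
  assumes "\<And>x a. x \<in> set xs \<Longrightarrow> c x a \<le> B"
  shows "fold_cost g c xs a \<le> length xs * (B + 6)"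
  using assms
proof (induction xs arbitrary: a)
  case (Cons x xs)
  then show ?case using Cons.IH[of "g x a"] by (fastforce intro: add_mono)
qed auto

text \<open>The parameters \<open>d\<close>, \<open>k\<close> and the number of blocks are built
  into the program as constant trees; \<open>tree_size\<close> is the constant cost of rebuilding
  one.\<close>

primrec quote :: "tree \<Rightarrow> exp" where
  "quote Lf = Nl"
| "quote (Nd a b) = Cns (quote a) (quote b)"

lemma eval_quote [simp]: "eval (quote t) vs = t"
  by (induction t) auto

primrec tree_size :: "tree \<Rightarrow> nat" where
  "tree_size Lf = 1"
| "tree_size (Nd a b) = tree_size a + tree_size b + 6"

lemma cost_quote [simp]: "cost (quote t) vs = tree_size t"
  by (induction t) auto

lemma tree_size_un [simp]: "tree_size (un n) = 7 * n + 1"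
  by (induction n) auto

definition "true_e = Cns Nl Nl"

lemma true_e [simp]: "eval true_e vs = un 1" "cost true_e vs = 8"
  by (simp_all add: true_e_def)

section \<open>Lists and unary numbers\<close>

definition "revapp_e = Fold (Var 0) (Var 1) (Cns (Var 0) (Var 1))"

lemma revapp_e [simp]:
  "eval revapp_e [s, t] = enc_list (rev (spine s) @ spine t)"
  "cost revapp_e [s, t] = 14 * length (spine s) + 5"
proof -
  have "fold Nd xs t = enc_list (rev xs @ spine t)" for xs
    by (induction xs arbitrary: t) auto
  moreover have "fold_cost g (\<lambda>x a. 8) xs t = 14 * length xs" for g and xs :: "tree list"
    by (induction xs arbitrary: t) auto
  ultimately show "eval revapp_e [s, t] = enc_list (rev (spine s) @ spine t)"
    "cost revapp_e [s, t] = 14 * length (spine s) + 5"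
    by (simp_all add: revapp_e_def)
qed

text \<open>Two reversals copy the first list and share the second, whose length therefore does not
  enter the cost.\<close>

definition "append_e = Call revapp_e [Call revapp_e [Var 0, Nl], Var 1]"

lemma append_e [simp]:
  "eval append_e [s, t] = enc_list (spine s @ spine t)"
  "cost append_e [s, t] = 28 * length (spine s) + 17"
  by (simp_all add: append_e_def)

text \<open>On unary numbers this is truncated subtraction, from which comparison and cyclic
  distance are derived.\<close>

definition "drop_e = Fold (Var 0) (Var 1) (Tl (Var 1))"

lemma drop_e [simp]:
  "eval drop_e [s, t] = enc_list (drop (length (spine s)) (spine t))"
  "cost drop_e [s, t] = 9 * length (spine s) + 5"
proof -
  have "fold (\<lambda>x. right) xs t = enc_list (drop (length xs) (spine t))" for xs :: "tree list"
  proof (induction xs arbitrary: t)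
    case (Cons x xs)
    then show ?case by (cases t) auto
  qed auto
  moreover have "fold_cost g (\<lambda>x a. 3) xs t = 9 * length xs" for g and xs :: "tree list"
    by (induction xs arbitrary: t) auto
  ultimately show "eval drop_e [s, t] = enc_list (drop (length (spine s)) (spine t))"
    "cost drop_e [s, t] = 9 * length (spine s) + 5"
    by (simp_all add: drop_e_def eval_nat_numeral)
qed

definition "le_e = Ite (Call drop_e [Var 1, Var 0]) Nl true_e"

lemma le_e [simp]:
  "eval le_e [s, t] = (if length (spine s) \<le> length (spine t) then un 1 else Lf)"
  by (simp add: le_e_def)

lemma cost_le_e: "cost le_e [s, t] \<le> 9 * length (spine t) + 20"
  by (simp add: le_e_def)

definition "eq_e = Ite (Call le_e [Var 0, Var 1]) (Call le_e [Var 1, Var 0]) Nl"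

lemma eq_e [simp]:
  "eval eq_e [s, t] = (if length (spine s) = length (spine t) then un 1 else Lf)"
  by (simp add: eq_e_def)

lemma cost_eq_e: "cost eq_e [s, t] \<le> 9 * length (spine s) + 9 * length (spine t) + 60"
  using cost_le_e[of s t] cost_le_e[of t s] by (simp add: eq_e_def)

section \<open>Words and their cyclic distance\<close>

definition enc_word :: "nat list \<Rightarrow> tree" where
  "enc_word w = enc_list (map un w)"

definition enc_words :: "nat list list \<Rightarrow> tree" where
  "enc_words W = enc_list (map enc_word W)"

lemma spine_enc_word [simp]: "spine (enc_word w) = map un w"
  by (simp add: enc_word_def)

lemma spine_enc_words [simp]: "spine (enc_words W) = map enc_word W"
  by (simp add: enc_words_def)

lemma enc_word_Nil: "enc_word [] = Lf"
  by (simp add: enc_word_def)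

lemma enc_word_Cons [simp]: "Nd (un c) (enc_word w) = enc_word (c # w)"
  by (simp add: enc_word_def)

lemma enc_words_Nil: "enc_words [] = Lf"
  by (simp add: enc_words_def)

lemma enc_words_Cons [simp]: "Nd (enc_word w) (enc_words W) = enc_words (w # W)"
  by (simp add: enc_words_def)

lemma left_enc_word [simp]: "w \<noteq> [] \<Longrightarrow> left (enc_word w) = un (hd w)"
  by (cases w) (auto simp: enc_word_def)

lemma right_enc_word [simp]: "right (enc_word w) = enc_word (tl w)"
  by (cases w) (auto simp: enc_word_def)

lemma left_enc_words [simp]: "W \<noteq> [] \<Longrightarrow> left (enc_words W) = enc_word (hd W)"
  by (cases W) (auto simp: enc_words_def)

lemma right_enc_words [simp]: "right (enc_words W) = enc_words (tl W)"
  by (cases W) (auto simp: enc_words_def)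

lemma enc_words_eq_Lf [simp]: "enc_words W = Lf \<longleftrightarrow> W = []"
  by (simp add: enc_words_def)

definition cdist :: "nat \<Rightarrow> nat \<Rightarrow> nat \<Rightarrow> nat" where
  "cdist d a b = (if a \<le> b then b - a else b + d - a)"

definition "cdist_e d = Ite (Call le_e [Var 0, Var 1]) (Call drop_e [Var 0, Var 1])
   (Call drop_e [Var 0, Call append_e [Var 1, quote (un d)]])"

lemma cdist_e [simp]: "eval (cdist_e d) [un a, un b] = un (cdist d a b)"
  by (simp add: cdist_e_def cdist_def replicate_add[symmetric])

lemma cost_cdist_e:
  "a \<le> s \<Longrightarrow> b \<le> s \<Longrightarrow> d \<le> s \<Longrightarrow> cost (cdist_e d) [un a, un b] \<le> 60 * s + 80"
  using cost_le_e[of "un a" "un b"] by (simp add: cdist_e_def)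

lemma cdist_le: "a \<le> d \<Longrightarrow> b \<le> d \<Longrightarrow> cdist d a b \<le> d"
  by (auto simp: cdist_def)

fun wdist :: "nat \<Rightarrow> nat list \<Rightarrow> nat list \<Rightarrow> nat" where
  "wdist d (a # x) (b # y) = cdist d a b + wdist d x y"
| "wdist d _ _ = 0"

text \<open>A fold runs over one list only, so the accumulator carries the rest of the second word
  along with the distance found so far.\<close>

definition "wdist_body d = Cns (Tl (Hd (Var 1)))
  (Call append_e [Call (cdist_e d) [Var 0, Hd (Hd (Var 1))], Tl (Var 1)])"

definition "wdist_e d = Tl (Fold (Var 0) (Cns (Var 1) Nl) (wdist_body d))"

lemma wdist_e_aux:
  assumes "set x \<subseteq> {..d}" "set y \<subseteq> {..d}" "length y = length x" "d \<le> s"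
  shows "fold_val (wdist_body d) vs (map un x) (Nd (enc_word y) (un t)) =
      Nd Lf (un (wdist d x y + t)) \<and>
    fold_steps (wdist_body d) vs
      (map un x) (Nd (enc_word y) (un t)) \<le> length x * (90 * s + 150)"
  using assms
proof (induction x arbitrary: y t)
  case Nil
  then show ?case by (simp add: enc_word_Nil)
next
  case (Cons a x)
  then obtain b y' where y: "y = b # y'" by (cases y) auto
  have 1: "eval (wdist_body d) (un a # Nd (enc_word y) (un t) # vs) =
      Nd (enc_word y') (un (cdist d a b + t))"
    by (simp add: wdist_body_def y replicate_add[symmetric])
  have 2: "cost (wdist_body d) (un a # Nd (enc_word y) (un t) # vs) \<le> 90 * s + 144"
    using cost_cdist_e[of a s b d] cdist_le[of a d b] Cons.prems
    by (simp add: wdist_body_def y)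
  have "fold_val (wdist_body d) vs (map un x) (Nd (enc_word y') (un (cdist d a b + t))) =
      Nd Lf (un (wdist d x y' + (cdist d a b + t)))
    \<and> fold_steps (wdist_body d) vs (map un x)
      (Nd (enc_word y') (un (cdist d a b + t))) \<le> length x * (90 * s + 150)"
    by (rule Cons.IH) (use Cons.prems y in auto)
  then show ?case using 2 by (simp add: 1[unfolded y] y add.assoc add.left_commute)
qed

abbreviation "is_word d x \<equiv> set x \<subseteq> {1..d}"

lemma is_word_le: "is_word d x \<Longrightarrow> set x \<subseteq> {..d}"
  by auto

lemma wdist_e [simp]:
  assumes "is_word d x" "is_word d y" "length y = length x"
  shows "eval (wdist_e d) [enc_word x, enc_word y] = un (wdist d x y)"
  using wdist_e_aux[OF is_word_le is_word_le, OF assms order_refl, of _ 0]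
  by (simp add: wdist_e_def)

definition wdist_B :: "nat \<Rightarrow> nat" where
  "wdist_B s = s * (90 * s + 150) + 20"

lemma cost_wdist_e:
  assumes "is_word d x" "is_word d y" "length y = length x" "d \<le> s" "length x \<le> s"
  shows "cost (wdist_e d) [enc_word x, enc_word y] \<le> wdist_B s"
  using order_trans[OF conjunct2[OF wdist_e_aux[OF is_word_le is_word_le, OF assms(1-4),
    of "[enc_word x, enc_word y]" 0]] mult_le_mono1[OF assms(5)]]
  by (simp add: wdist_e_def wdist_B_def)

lemma wdist_le:
  assumes "is_word d x" "is_word d y"
  shows "wdist d x y \<le> d * length x"
  using assms
proof (induction d x y rule: wdist.induct)
  case (1 d a x b y)
  then show ?case using cdist_le[of a d b] by simp
qed auto

section \<open>Programs for covering codes\<close>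

text \<open>The variant of \<open>fold_rep\<close> for loops over a unary counter. The invariant may
  depend on the number of iterations done, as needed for sizes that grow like
  \<open>k ^ i\<close>.\<close>

lemma fold_rep_iter:
  assumes "Inv 0 a" "\<And>i a. i < n \<Longrightarrow> Inv i a \<Longrightarrow>
      g Lf (ea a) = ea (h a) \<and> Inv (Suc i) (h a) \<and> c Lf (ea a) \<le> B"
  shows "fold g (replicate n Lf) (ea a) = ea ((h ^^ n) a) \<and> Inv n ((h ^^ n) a) \<and>
    fold_cost g c (replicate n Lf) (ea a) \<le> n * (B + 6)"
  using assms
proof (induction n arbitrary: a Inv)
  case (Suc n)
  have 1: "g Lf (ea a) = ea (h a)" "Inv 1 (h a)" "c Lf (ea a) \<le> B" using Suc.prems by auto
  have "fold g (replicate n Lf) (ea (h a)) = ea ((h ^^ n) (h a)) \<and> Inv (Suc n) ((h ^^ n) (h a)) \<and>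
    fold_cost g c (replicate n Lf) (ea (h a)) \<le> n * (B + 6)"
    by (rule Suc.IH[of "\<lambda>i. Inv (Suc i)"]) (use Suc.prems 1 in auto)
  then show ?case using 1 by (auto simp: funpow_swap1)
qed auto

lemma fold_const: "fold (\<lambda>_. h) xs = h ^^ length xs"
  by (induction xs) (auto simp: funpow_swap1)

definition words_over :: "nat \<Rightarrow> nat \<Rightarrow> nat list set" where
  "words_over d m = {w. length w = m \<and> is_word d w}"

definition "filt_body d = Ite (Call le_e [Call (wdist_e d) [Var 2, Var 0], Var 3]) (Var 1)
  (Cns (Var 0) (Var 1))"

definition "filt_e d = Fold (Var 2) Nl (filt_body d)"

text \<open>What a new centre \<open>x\<close> leaves uncovered.\<close>

definition filt :: "nat \<Rightarrow> nat list \<Rightarrow> nat \<Rightarrow> nat list list \<Rightarrow> nat list list" where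
  "filt d x r U = fold (\<lambda>u a. if wdist d x u \<le> r then a else u # a) U []"

lemma filt_eq: "filt d x r U = rev (filter (\<lambda>u. \<not> wdist d x u \<le> r) U)"
proof -
  have "fold (\<lambda>u a. if wdist d x u \<le> r then a else u # a) U a =
      rev (filter (\<lambda>u. \<not> wdist d x u \<le> r) U) @ a" for a
    by (induction U arbitrary: a) auto
  then show ?thesis by (simp add: filt_def)
qed

lemma length_filt_le: "length (filt d x r U) \<le> length U"
  by (simp add: filt_eq)

lemma set_filt: "set (filt d x r U) = {u \<in> set U. \<not> wdist d x u \<le> r}"
  by (auto simp: filt_eq)

definition filt_B :: "nat \<Rightarrow> nat" where
  "filt_B s = s * (wdist_B s + 9 * s + 50) + 20"

lemma filt_e:
  assumes "x \<in> words_over d m" "set U \<subseteq> words_over d m" "d \<le> s" "m \<le> s" "r \<le> s" "length U \<le> s"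
  shows "eval (filt_e d) [enc_word x, un r, enc_words U] = enc_words (filt d x r U)"
    "cost (filt_e d) [enc_word x, un r, enc_words U] \<le> filt_B s"
proof -
  let ?vs = "[enc_word x, un r, enc_words U]"
  have *: "fold_val (filt_body d) ?vs (map enc_word U) (enc_words []) =
      enc_words (filt d x r U) \<and> True \<and>
    fold_steps (filt_body d) ?vs
      (map enc_word U) (enc_words []) \<le> length U * (wdist_B s + 9 * s + 44 + 6)"
    unfolding filt_def
  proof (rule fold_rep)
    fix u a assume "u \<in> set U"
    then have w: "is_word d x" "is_word d u" "length u = length x" "length x = m"
      using assms by (auto simp: words_over_def)
    show "eval (filt_body d) (enc_word u # enc_words a # ?vs) =
        enc_words (if wdist d x u \<le> r then a else u # a) \<and> True \<and>
      cost (filt_body d) (enc_word u # enc_words a # ?vs) \<le> wdist_B s + 9 * s + 44"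
      using cost_wdist_e[OF w(1-3) assms(3)] cost_le_e[of "un (wdist d x u)" "un r"] assms w
      by (simp add: filt_body_def)
  qed simp
  show "eval (filt_e d) ?vs = enc_words (filt d x r U)"
    using * by (simp add: filt_e_def enc_words_Nil)
  have "fold_steps (filt_body d) ?vs
      (map enc_word U) Lf \<le> s * (wdist_B s + 9 * s + 50)"
    using fold_bound[OF conjunct2[OF conjunct2[OF *]] assms(6) order_refl]
    by (simp add: enc_words_Nil algebra_simps)
  then show "cost (filt_e d) ?vs \<le> filt_B s"
    by (simp add: filt_e_def filt_B_def)
qed

text \<open>\<open>Call\<close> plays the role of a let-binding here and below: the filtered list is
  computed once, then compared and possibly stored.\<close>

definition "better_e = Ite (Call le_e [Var 1, Tl (Var 2)]) (Cns (Var 0) (Var 1)) (Var 2)"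

definition "pick_body d = Call better_e [Var 0, Call (filt_e d) [Var 0, Var 3, Var 4], Var 1]"

definition "pick_e d = Fold (Var 0) (Cns Nl (Var 2)) (pick_body d)"

definition pick_step :: "nat \<Rightarrow> nat \<Rightarrow> nat list list \<Rightarrow> nat list \<Rightarrow> nat list \<times> nat list list \<Rightarrow> nat list \<times> nat list list" where
  "pick_step d r U x p = (if length (filt d x r U) \<le> length (snd p) then (x, filt d x r U) else p)"

text \<open>The initial pair is a dummy. Ties are decided for the new candidate and filtering never
  enlarges \<open>U\<close>, so the first candidate displaces the dummy.\<close>

definition pick :: "nat \<Rightarrow> nat list list \<Rightarrow> nat \<Rightarrow> nat list list \<Rightarrow> nat list \<times> nat list list" where
  "pick d W r U = fold (pick_step d r U) W ([], U)"

definition enc_pick :: "nat list \<times> nat list list \<Rightarrow> tree" where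
  "enc_pick p = Nd (enc_word (fst p)) (enc_words (snd p))"

definition pick_B :: "nat \<Rightarrow> nat" where
  "pick_B s = s * (filt_B s + 9 * s + 60) + 20"

lemma pick_e:
  assumes "set W \<subseteq> words_over d m" "set U \<subseteq> words_over d m" "d \<le> s" "m \<le> s" "r \<le> s"
    "length W \<le> s" "length U \<le> s"
  shows "eval (pick_e d) [enc_words W, un r, enc_words U] = enc_pick (pick d W r U)"
    "cost (pick_e d) [enc_words W, un r, enc_words U] \<le> pick_B s"
    "length (snd (pick d W r U)) \<le> length U"
    "set (snd (pick d W r U)) \<subseteq> set U"
proof -
  let ?vs = "[enc_words W, un r, enc_words U]"
  have *: "fold_val (pick_body d) ?vs (map enc_word W) (enc_pick ([], U)) =
      enc_pick (pick d W r U) \<and>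
      (length (snd (pick d W r U)) \<le> length U \<and> set (snd (pick d W r U)) \<subseteq> set U) \<and>
    fold_steps (pick_body d) ?vs
      (map enc_word W) (enc_pick ([], U)) \<le> length W * (filt_B s + 9 * s + 54 + 6)"
    unfolding pick_def
  proof (rule fold_rep)
    fix x and p :: "nat list \<times> nat list list"
    assume x: "x \<in> set W" and p: "length (snd p) \<le> length U \<and> set (snd p) \<subseteq> set U"
    have x': "x \<in> words_over d m" using x assms by auto
    note f = filt_e[OF x' assms(2,3,4,5,7)]
    have "eval (pick_body d) (enc_word x # enc_pick p # ?vs) = enc_pick (pick_step d r U x p)"
      using p f(1) by (simp add: pick_body_def better_e_def enc_pick_def pick_step_def)
    moreover have "cost (pick_body d) (enc_word x # enc_pick p # ?vs) \<le> filt_B s + 9 * s + 54"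
      using f p assms(7) cost_le_e[of "enc_words (filt d x r U)" "enc_words (snd p)"]
      by (simp add: pick_body_def better_e_def enc_pick_def)
    moreover have "length (snd (pick_step d r U x p)) \<le> length U \<and> set (snd (pick_step d r U x p)) \<subseteq> set U"
      using p length_filt_le[of d x r U] by (auto simp: pick_step_def set_filt)
    ultimately show "eval (pick_body d) (enc_word x # enc_pick p # ?vs) =
        enc_pick (pick_step d r U x p) \<and>
      (length (snd (pick_step d r U x p)) \<le> length U \<and> set (snd (pick_step d r U x p)) \<subseteq> set U) \<and>
      cost (pick_body d) (enc_word x # enc_pick p # ?vs) \<le> filt_B s + 9 * s + 54" by blast
  qed simp
  have i: "enc_pick ([], U) = Nd Lf (enc_words U)"
    by (simp add: enc_pick_def enc_word_Nil)
  show "eval (pick_e d) ?vs = enc_pick (pick d W r U)"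
    using * by (simp add: pick_e_def i)
  have "fold_steps (pick_body d) ?vs
      (map enc_word W) (Nd Lf (enc_words U)) \<le> s * (filt_B s + 9 * s + 60)"
    using fold_bound[OF conjunct2[OF conjunct2[OF *]] assms(6) order_refl]
    by (simp add: i algebra_simps)
  then show "cost (pick_e d) ?vs \<le> pick_B s"
    by (simp add: pick_e_def pick_B_def)
  show "length (snd (pick d W r U)) \<le> length U" "set (snd (pick d W r U)) \<subseteq> set U"
    using * by blast+
qed

definition "push_e = Cns (Cns (Hd (Var 1)) (Hd (Var 0))) (Tl (Var 1))"

definition "gstep_e d = Ite (Tl (Var 0))
  (Call push_e [Var 0, Call (pick_e d) [Var 1, Var 2, Tl (Var 0)]]) (Var 0)"

definition "greedy_body d = Call (gstep_e d) [Var 1, Var 2, Var 3]"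

definition "greedy_e d = Hd (Fold (Var 0) (Cns Nl (Var 0)) (greedy_body d))"

text \<open>The state consists of the code chosen so far and the words it leaves uncovered.\<close>

definition gstep :: "nat \<Rightarrow> nat list list \<Rightarrow> nat \<Rightarrow> nat list list \<times> nat list list \<Rightarrow> nat list list \<times> nat list list" where
  "gstep d W r p = (if snd p = [] then p
     else (fst (pick d W r (snd p)) # fst p, snd (pick d W r (snd p))))"

text \<open>The length of \<open>W\<close> only serves as a number of rounds. It suffices when
  \<open>W\<close> contains all words: a round that finds an uncovered word covers at least one
  more.\<close>

definition greedy :: "nat \<Rightarrow> nat list list \<Rightarrow> nat \<Rightarrow> nat list list" where
  "greedy d W r = fst ((gstep d W r ^^ length W) ([], W))"

definition enc_gstate :: "nat list list \<times> nat list list \<Rightarrow> tree" where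
  "enc_gstate p = Nd (enc_words (fst p)) (enc_words (snd p))"

definition greedy_B :: "nat \<Rightarrow> nat" where
  "greedy_B s = s * (pick_B s + 60) + 20"

lemma greedy_e:
  assumes "set W \<subseteq> words_over d m" "d \<le> s" "m \<le> s" "r \<le> s" "length W \<le> s"
  shows "eval (greedy_e d) [enc_words W, un r] = enc_words (greedy d W r)"
    "cost (greedy_e d) [enc_words W, un r] \<le> greedy_B s"
proof -
  let ?vs = "[enc_words W, un r]"
  have *: "fold_val (greedy_body d) ?vs (map enc_word W) (enc_gstate ([], W)) =
      enc_gstate (fold (\<lambda>_. gstep d W r) W ([], W)) \<and>
      (length (snd (fold (\<lambda>_. gstep d W r) W ([], W))) \<le> length W \<and>
        set (snd (fold (\<lambda>_. gstep d W r) W ([], W))) \<subseteq> words_over d m) \<and>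
    fold_steps (greedy_body d) ?vs
      (map enc_word W) (enc_gstate ([], W)) \<le> length W * (pick_B s + 54 + 6)"
  proof (rule fold_rep)
    fix x and p :: "nat list list \<times> nat list list" assume p: "length (snd p) \<le> length W \<and> set (snd p) \<subseteq> words_over d m"
    then have "length (snd p) \<le> s" using assms by simp
    note f = pick_e[OF assms(1) _ assms(2-5) this]
    have "eval (greedy_body d) (enc_word x # enc_gstate p # ?vs) = enc_gstate (gstep d W r p)"
      using p f(1) by (simp add: greedy_body_def gstep_e_def push_e_def enc_gstate_def gstep_def
        enc_pick_def)
    moreover have "cost (greedy_body d) (enc_word x # enc_gstate p # ?vs) \<le> pick_B s + 54"
      using f p by (simp add: greedy_body_def gstep_e_def push_e_def enc_gstate_def enc_pick_def)
    moreover have "length (snd (gstep d W r p)) \<le> length W \<and> set (snd (gstep d W r p)) \<subseteq> words_over d m"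
      using p f(3,4) by (auto simp: gstep_def)
    ultimately show "eval (greedy_body d) (enc_word x # enc_gstate p # ?vs) =
        enc_gstate (gstep d W r p) \<and>
      (length (snd (gstep d W r p)) \<le> length W \<and> set (snd (gstep d W r p)) \<subseteq> words_over d m) \<and>
      cost (greedy_body d) (enc_word x # enc_gstate p # ?vs) \<le> pick_B s + 54" by blast
  qed (use assms in simp)
  have i: "enc_gstate ([], W) = Nd Lf (enc_words W)"
    by (simp add: enc_gstate_def enc_words_Nil)
  show "eval (greedy_e d) ?vs = enc_words (greedy d W r)"
    using * by (simp add: greedy_e_def greedy_def i fold_const) (simp add: enc_gstate_def)
  have "fold_steps (greedy_body d) ?vs
      (map enc_word W) (Nd Lf (enc_words W)) \<le> s * (pick_B s + 60)"
    using fold_bound[OF conjunct2[OF conjunct2[OF *]] assms(5) order_refl]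
    by (simp add: i algebra_simps)
  then show "cost (greedy_e d) ?vs \<le> greedy_B s"
    by (simp add: greedy_e_def greedy_B_def)
qed

section \<open>Choice of the cheapest radius\<close>

definition "mult_body = Call append_e [Var 2, Var 1]"

definition "mult_e k = Fold (quote (un k)) Nl mult_body"

text \<open>The first claim admits arbitrary entries, since \<open>clist_e\<close> measures a weight
  by the length of a list that starts out as the code itself.\<close>

lemma mult_e [simp]:
  "length (spine (eval (mult_e k) [t])) = k * length (spine t)"
  "eval (mult_e k) [un n] = un (k * n)"
proof -
  have m: "eval mult_body [u, a, t] = enc_list (spine t @ spine a)" for u a t
    by (simp add: mult_body_def)
  have "fold (\<lambda>u a. enc_list (spine t @ spine a)) xs a =
      enc_list (concat (replicate (length xs) (spine t)) @ spine a)" for t a and xs :: "tree list"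
  proof (induction xs arbitrary: a)
    case (Cons x xs)
    have "concat (replicate n ys) @ ys @ zs = ys @ concat (replicate n ys) @ zs" for n and ys zs :: "tree list"
      by (induction n) auto
    note this[of "length xs" "spine t" "spine a"]
    then show ?case using Cons[of "enc_list (spine t @ spine a)"]
      by (simp only: fold_simps length_Cons replicate_Suc concat.simps spine_enc_list append_assoc)
  qed simp
  note * = this
  show "length (spine (eval (mult_e k) [t])) = k * length (spine t)"
    using *[of t "replicate k Lf" Lf] by (simp add: mult_e_def m length_concat sum_list_replicate)
  have "concat (replicate k (replicate n Lf)) = replicate (k * n) Lf"
    by (induction k) (auto simp: replicate_add)
  then show "eval (mult_e k) [un n] = un (k * n)"
    using *[of "un n" "replicate k Lf" Lf] by (simp add: mult_e_def m)
qed

lemma cost_mult_e: "length (spine t) \<le> s \<Longrightarrow> cost (mult_e k) [t] \<le> k * (28 * s + 40) + 20"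
proof -
  assume s: "length (spine t) \<le> s"
  have "fold_cost (\<lambda>u a. eval mult_body [u, a, t]) (\<lambda>u a. cost mult_body [u, a, t])
      (replicate k Lf) Lf \<le> length (replicate k Lf) * (28 * s + 21 + 6)"
    by (rule fold_cost_le) (use s in \<open>simp add: mult_body_def\<close>)
  then show ?thesis by (simp add: mult_e_def algebra_simps)
qed

text \<open>The weight of a code is computed in unary as the length of a list. This is affordable:
  for words of length \<open>m\<close> it stays below \<open>(d * k ^ d) ^ m\<close>, a size that
  the preparation reaches anyway.\<close>

definition "clist_body k = Call (mult_e k) [Var 1]"

definition "clist_e k = Fold (Var 0) (Var 1) (clist_body k)"

definition clist_B :: "nat \<Rightarrow> nat" where
  "clist_B s = s * (s * (28 * s + 40) + 40) + 20"

lemma clist_e: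
  assumes "k ^ r * length (spine t) \<le> s" "1 \<le> k" "k \<le> s" "r \<le> s"
  shows "length (spine (eval (clist_e k) [un r, t])) = k ^ r * length (spine t)"
    "cost (clist_e k) [un r, t] \<le> clist_B s"
proof -
  let ?vs = "[un r, t]"
  let ?B = "s * (28 * s + 40) + 34"
  have *: "fold_val (clist_body k) ?vs (replicate r Lf) t =
      ((\<lambda>a. eval (mult_e k) [a]) ^^ r) t \<and>
      length (spine (((\<lambda>a. eval (mult_e k) [a]) ^^ r) t)) = k ^ r * length (spine t) \<and>
    fold_steps (clist_body k) ?vs
      (replicate r Lf) t \<le> r * (?B + 6)"
  proof (rule fold_rep_iter[where ea = "\<lambda>a. a" and Inv = "\<lambda>i a. length (spine a) = k ^ i * length (spine t)"])
    fix i a assume i: "i < r" "length (spine a) = k ^ i * length (spine t)"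
    have le: "k ^ i * length (spine t) \<le> k ^ r * length (spine t)"
      using i assms(2) by (intro mult_right_mono power_increasing) auto
    have "cost (mult_e k) [a] \<le> k * (28 * s + 40) + 20"
      using i order_trans[OF le assms(1)] by (intro cost_mult_e) simp
    also have "\<dots> \<le> s * (28 * s + 40) + 20" using assms(3) by simp
    finally have "cost (clist_body k) (Lf # a # ?vs) \<le> ?B" by (simp add: clist_body_def)
    then show "eval (clist_body k) (Lf # a # ?vs) = eval (mult_e k) [a] \<and>
      length (spine (eval (mult_e k) [a])) = k ^ Suc i * length (spine t) \<and>
      cost (clist_body k) (Lf # a # ?vs) \<le> ?B" using i by (simp add: clist_body_def)
  qed simp
  show "length (spine (eval (clist_e k) [un r, t])) = k ^ r * length (spine t)"
    using * by (simp add: clist_e_def)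
  have "fold_steps (clist_body k) ?vs
      (replicate r Lf) t \<le> s * (?B + 6)"
    using fold_bound[OF conjunct2[OF conjunct2[OF *]] assms(4) order_refl] .
  then show "cost (clist_e k) [un r, t] \<le> clist_B s"
    by (simp add: clist_e_def clist_B_def algebra_simps)
qed

text \<open>A candidate holds radius and code in its head and its unary weight in its tail, so that
  \<open>cmp_e\<close> compares tails and \<open>Hd\<close> finally strips the weight.\<close>

definition "cand2_e k = Cns (Cns (Var 0) (Var 1)) (Call (clist_e k) [Var 0, Var 1])"

definition "cand_e d k = Call (cand2_e k) [Var 1, Call (greedy_e d) [Var 0, Var 1]]"

definition "cmp_e = Ite (Call le_e [Tl (Var 0), Tl (Var 1)]) (Var 0) (Var 1)"

definition "best_body d k = Call cmp_e [Call (cand_e d k) [Var 2, Var 0], Var 1]"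

definition "best_e d k = Hd (Fold (Var 1) (Call (cand_e d k) [Var 0, Nl]) (best_body d k))"

text \<open>The search effort caused by one block: each code word is the root of
  \<open>k ^ r\<close> branches.\<close>

definition weight :: "nat \<Rightarrow> nat \<Rightarrow> nat list list \<Rightarrow> nat \<Rightarrow> nat" where
  "weight d k W r = k ^ r * length (greedy d W r)"

definition best :: "nat \<Rightarrow> nat \<Rightarrow> nat list list \<Rightarrow> nat list \<Rightarrow> nat" where
  "best d k W rs = fold (\<lambda>r r0. if weight d k W r \<le> weight d k W r0 then r else r0) rs 0"

lemma best_in: "best d k W rs \<in> insert 0 (set rs)"
proof -
  have "fold (\<lambda>r r0. if weight d k W r \<le> weight d k W r0 then r else r0) rs a \<in> insert a (set rs)" for a
  proof (induction rs arbitrary: a)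
    case (Cons r rs)
    from Cons[of "if weight d k W r \<le> weight d k W a then r else a"] show ?case
      by (auto split: if_splits)
  qed simp
  then show ?thesis by (simp add: best_def)
qed

lemma weight_best_le: "r \<in> set rs \<Longrightarrow> weight d k W (best d k W rs) \<le> weight d k W r"
proof -
  let ?h = "\<lambda>r r0. if weight d k W r \<le> weight d k W r0 then r else r0"
  have "weight d k W (fold ?h rs a) \<le> weight d k W a \<and>
    (\<forall>r\<in>set rs. weight d k W (fold ?h rs a) \<le> weight d k W r)" for a
  proof (induction rs arbitrary: a)
    case (Cons r rs)
    from Cons[of "?h r a"] show ?case by (auto split: if_splits)
  qed simp
  then show "r \<in> set rs \<Longrightarrow> ?thesis" unfolding best_def by blast
qed

definition best_B :: "nat \<Rightarrow> nat" where
  "best_B s = (s + 1) * (greedy_B s + clist_B s + 9 * s + 100) + 20"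

lemma best_e:
  assumes "set W \<subseteq> words_over d m" "d \<le> s" "m \<le> s" "length W \<le> s" "\<forall>r\<in>insert 0 (set rs). r \<le> s \<and> weight d k W r \<le> s"
    "1 \<le> k" "k \<le> s" "length rs \<le> s"
  defines "r \<equiv> best d k W rs"
  shows "eval (best_e d k) [enc_words W, enc_list (map un rs)] = Nd (un r) (enc_words (greedy d W r))"
    "cost (best_e d k) [enc_words W, enc_list (map un rs)] \<le> best_B s"
proof -
  let ?vs = "[enc_words W, enc_list (map un rs)]"
  \<comment> \<open>The fold is refined to one over radii: a radius is encoded by its entire
    candidate, which the loop carries along as accumulator.\<close>
  define ea where "ea r = eval (cand_e d k) [enc_words W, un r]" for r
  have c: "left (ea r) = Nd (un r) (enc_words (greedy d W r))"
    "length (spine (right (ea r))) = weight d k W r"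
    "cost (cand_e d k) [enc_words W, un r] \<le> greedy_B s + clist_B s + 40"
    if "r \<in> insert 0 (set rs)" for r
  proof -
    have "r \<le> s" using that assms by blast
    note g = greedy_e[OF assms(1-3) this assms(4)]
    have "k ^ r * length (spine (enc_words (greedy d W r))) \<le> s"
      using assms(5) that unfolding weight_def by auto
    note l = clist_e[OF this assms(6,7) \<open>r \<le> s\<close>]
    show "left (ea r) = Nd (un r) (enc_words (greedy d W r))"
      "length (spine (right (ea r))) = weight d k W r"
      "cost (cand_e d k) [enc_words W, un r] \<le> greedy_B s + clist_B s + 40"
      using g l by (simp_all add: ea_def cand_e_def cand2_e_def weight_def)
  qed
  let ?B = "greedy_B s + clist_B s + 9 * s + 90"
  let ?h = "\<lambda>r r0. if weight d k W r \<le> weight d k W r0 then r else r0"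
  have *: "fold_val (best_body d k) ?vs (map un rs) (ea 0) = ea (fold ?h rs 0) \<and>
      fold ?h rs 0 \<in> insert 0 (set rs) \<and>
    fold_steps (best_body d k) ?vs
      (map un rs) (ea 0) \<le> length rs * (?B + 6)"
  proof (rule fold_rep)
    fix r a assume r: "r \<in> set rs" and a: "a \<in> insert 0 (set rs)"
    have r': "r \<in> insert 0 (set rs)" using r by simp
    have w: "weight d k W a \<le> s" using a assms(5) by blast
    have "eval (best_body d k) (un r # ea a # ?vs) = ea (?h r a)"
      using c(2)[OF r'] c(2)[OF a] by (simp add: best_body_def cmp_e_def ea_def[symmetric])
    moreover have "cost (best_body d k) (un r # ea a # ?vs) \<le> ?B"
      using c(3)[OF r'] c(2)[OF r'] c(2)[OF a] cost_le_e[of "right (ea r)" "right (ea a)"] w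
      by (simp add: best_body_def cmp_e_def ea_def[symmetric])
    ultimately show "eval (best_body d k) (un r # ea a # ?vs) = ea (?h r a) \<and>
       ?h r a \<in> insert 0 (set rs) \<and> cost (best_body d k) (un r # ea a # ?vs) \<le> ?B" using r a by simp
  qed simp
  have z: "eval (cand_e d k) [enc_words W, Lf] = ea 0" by (simp add: ea_def)
  have rin: "r \<in> insert 0 (set rs)" unfolding r_def by (rule best_in)
  show "eval (best_e d k) ?vs = Nd (un r) (enc_words (greedy d W r))"
    using * c(1)[OF rin] by (simp add: best_e_def z best_def r_def)
  have "fold_steps (best_body d k) ?vs
      (map un rs) (ea 0) \<le> s * (?B + 6)"
    using fold_bound[OF conjunct2[OF conjunct2[OF *]] assms(8) order_refl] .
  also have "s * (?B + 6) \<le> s * (greedy_B s + clist_B s + 9 * s + 100)" by simp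
  finally show "cost (best_e d k) ?vs \<le> best_B s"
    using c(3)[of 0] by (simp add: best_e_def best_B_def z)
qed

text \<open>Each number is built on its predecessor at the head of the list, so that all of them
  share one chain of nodes. Applied to \<open>d * m\<close>, which no distance exceeds, this yields
  all candidate radii.\<close>

definition "tails_e = Fold (Var 0) (Cns Nl Nl) (Cns (Cns Nl (Hd (Var 1))) (Var 1))"

definition "radii_e d = Call tails_e [Call (mult_e d) [Var 0]]"

definition radii_B :: "nat \<Rightarrow> nat" where
  "radii_B s = s * (28 * s + 40) + 22 * s + 60"

lemma radii_e:
  "eval (radii_e d) [un m] = enc_list (map un (rev [0..<Suc (d * m)]))"
  "d \<le> s \<Longrightarrow> m \<le> s \<Longrightarrow> d * m \<le> s \<Longrightarrow> cost (radii_e d) [un m] \<le> radii_B s"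
proof -
  let ?f = "Cns (Cns Nl (Hd (Var 1))) (Var 1)"
  have f: "eval ?f [u, a, t] = Nd (Nd Lf (left a)) a" "cost ?f [u, a, t] = 16" for u a t
    by simp_all
  have t: "eval tails_e [un n] = enc_list (map un (rev [0..<Suc n]))"
    "cost tails_e [un n] \<le> n * 22 + 12" for n
  proof -
    have *: "fold_val ?f [un n] (replicate n Lf) (enc_list (map un [0])) =
      enc_list (map un (((\<lambda>l. Suc (hd l) # l) ^^ n) [0])) \<and>
      ((\<lambda>l. Suc (hd l) # l) ^^ n) [0] = rev [0..<Suc n] \<and>
      fold_steps ?f [un n]
        (replicate n Lf) (enc_list (map un [0])) \<le> n * (16 + 6)"
      by (rule fold_rep_iter[where ea = "\<lambda>l. enc_list (map un l)" and Inv = "\<lambda>i l. l = rev [0..<Suc i]"])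
        (simp_all add: f)
    then show "eval tails_e [un n] = enc_list (map un (rev [0..<Suc n]))"
      "cost tails_e [un n] \<le> n * 22 + 12"
      by (simp_all add: tails_e_def del: upt_Suc)
  qed
  show "eval (radii_e d) [un m] = enc_list (map un (rev [0..<Suc (d * m)]))"
    by (simp add: radii_e_def t del: upt_Suc)
  assume s: "d \<le> s" "m \<le> s" "d * m \<le> s"
  have "cost (mult_e d) [un m] \<le> d * (28 * s + 40) + 20" using s by (intro cost_mult_e) simp
  also have "\<dots> \<le> s * (28 * s + 40) + 20" using s by simp
  finally show "cost (radii_e d) [un m] \<le> radii_B s"
    using t(2)[of "d * m"] s by (simp add: radii_e_def radii_B_def)
qed

section \<open>Enumeration of all words\<close>

definition colors :: "nat \<Rightarrow> nat list" where
  "colors d = [1..<Suc d]"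

lemma length_colors [simp]: "length (colors d) = d"
  by (simp add: colors_def)

definition "ext_body d = Fold (quote (enc_word (colors d))) (Var 1)
  (Cns (Cns (Var 0) (Var 2)) (Var 1))"

definition "ext_e d = Fold (Var 0) Nl (ext_body d)"

definition ext1 :: "nat \<Rightarrow> nat list \<Rightarrow> nat list list \<Rightarrow> nat list list" where
  "ext1 d w a = fold (\<lambda>c a. (c # w) # a) (colors d) a"

definition ext :: "nat \<Rightarrow> nat list list \<Rightarrow> nat list list" where
  "ext d W = fold (ext1 d) W []"

lemma ext1_eq: "ext1 d w a = rev (map (\<lambda>c. c # w) (colors d)) @ a"
proof -
  have "fold (\<lambda>c a. (c # w) # a) cs a = rev (map (\<lambda>c. c # w) cs) @ a" for cs
    by (induction cs arbitrary: a) auto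
  then show ?thesis by (simp add: ext1_def)
qed

lemma ext_eq: "ext d W = concat (map (\<lambda>w. rev (map (\<lambda>c. c # w) (colors d))) (rev W))"
proof -
  have "fold (ext1 d) W a = concat (map (\<lambda>w. rev (map (\<lambda>c. c # w) (colors d))) (rev W)) @ a" for a
    by (induction W arbitrary: a) (auto simp: ext1_eq)
  then show ?thesis by (simp add: ext_def)
qed

lemma length_ext: "length (ext d W) = d * length W"
  by (simp add: ext_eq length_concat comp_def sum_list_triv rev_map[symmetric])

definition "col_size d = tree_size (enc_word (colors d))"

definition ext_B :: "nat \<Rightarrow> nat \<Rightarrow> nat" where
  "ext_B d s = s * (col_size d + 21 * d + 10) + 10"

lemma ext_e:
  "eval (ext_e d) [enc_words W] = enc_words (ext d W)"
  "length W \<le> s \<Longrightarrow> cost (ext_e d) [enc_words W] \<le> ext_B d s"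
proof -
  let ?vs = "[enc_words W]"
  let ?f = "Cns (Cns (Var 0) (Var 2)) (Var 1)"
  have f: "eval ?f (u # a # w # vs) = Nd (Nd u w) a" "cost ?f (u # a # w # vs) = 15" for u a w vs
    by simp_all
  have b: "eval (ext_body d) (enc_word w # enc_words a # vs) = enc_words (ext1 d w a)"
    "cost (ext_body d) (enc_word w # enc_words a # vs) \<le> col_size d + 21 * d + 4" for w a vs
  proof -
    let ?us = "enc_word w # enc_words a # vs"
    have "fold_val ?f ?us (map un (colors d)) (enc_words a) = enc_words (ext1 d w a) \<and>
      True \<and> fold_steps ?f ?us (map un (colors d)) (enc_words a)
      \<le> length (colors d) * (15 + 6)"
      unfolding ext1_def by (rule fold_rep) (simp_all add: f)
    then show "eval (ext_body d) ?us = enc_words (ext1 d w a)"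
      "cost (ext_body d) ?us \<le> col_size d + 21 * d + 4"
      by (simp_all add: ext_body_def col_size_def)
  qed
  have *: "fold_val (ext_body d) ?vs (map enc_word W) (enc_words []) = enc_words (ext d W) \<and>
      True \<and> fold_steps (ext_body d) ?vs
      (map enc_word W) (enc_words []) \<le> length W * (col_size d + 21 * d + 4 + 6)"
    unfolding ext_def by (rule fold_rep) (simp_all add: b)
  then show "eval (ext_e d) ?vs = enc_words (ext d W)"
    by (simp add: ext_e_def enc_words_Nil)
  assume s: "length W \<le> s"
  have "fold_steps (ext_body d) ?vs
      (map enc_word W) Lf \<le> s * (col_size d + 21 * d + 10)"
    using fold_bound[OF conjunct2[OF conjunct2[OF *]] s order_refl]
    by (simp add: enc_words_Nil algebra_simps)
  then show "cost (ext_e d) ?vs \<le> ext_B d s"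
    by (simp add: ext_e_def ext_B_def)
qed

definition words :: "nat \<Rightarrow> nat \<Rightarrow> nat list list" where
  "words d m = (ext d ^^ m) [[]]"

definition "words_e d = Fold (Var 0) (Cns Nl Nl) (Call (ext_e d) [Var 1])"

definition words_B :: "nat \<Rightarrow> nat \<Rightarrow> nat" where
  "words_B d s = s * (ext_B d s + 20) + 20"

lemma length_words: "length (words d m) = d ^ m"
  by (induction m) (auto simp: words_def length_ext)

lemma words_e:
  assumes "1 \<le> d" "d ^ m \<le> s" "m \<le> s"
  shows "eval (words_e d) [un m] = enc_words (words d m)" "cost (words_e d) [un m] \<le> words_B d s"
proof -
  let ?vs = "[un m]"
  let ?f = "Call (ext_e d) [Var 1]"
  have i: "enc_words [[]] = Nd Lf Lf" by (simp add: enc_words_def enc_word_Nil)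
  have *: "fold_val ?f ?vs (replicate m Lf) (enc_words [[]]) =
      enc_words ((ext d ^^ m) [[]]) \<and> length ((ext d ^^ m) [[]]) = d ^ m \<and>
      fold_steps ?f ?vs
        (replicate m Lf) (enc_words [[]]) \<le> m * (ext_B d s + 14 + 6)"
  proof (rule fold_rep_iter[where Inv = "\<lambda>i W. length W = d ^ i"])
    fix i and W :: "nat list list" assume "i < m" and l: "length W = d ^ i"
    then have "d ^ i \<le> d ^ m" using assms by (intro power_increasing) auto
    then have "length W \<le> s" using assms l by simp
    from ext_e(2)[OF this, of d] show "eval ?f (Lf # enc_words W # ?vs) = enc_words (ext d W) \<and>
      length (ext d W) = d ^ Suc i \<and> cost ?f (Lf # enc_words W # ?vs) \<le> ext_B d s + 14"
      using l by (simp add: ext_e length_ext)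
  qed simp
  then show "eval (words_e d) ?vs = enc_words (words d m)"
    by (simp add: words_e_def i words_def)
  have "fold_steps ?f ?vs
        (replicate m Lf) (Nd Lf Lf) \<le> s * (ext_B d s + 20)"
    using fold_bound[OF conjunct2[OF conjunct2[OF *]] assms(3) order_refl]
    by (simp add: i algebra_simps)
  then show "cost (words_e d) ?vs \<le> words_B d s"
    by (simp add: words_e_def words_B_def)
qed

section \<open>Programs for local search\<close>

lemma enc_word_append [simp]: "enc_list (map un v @ map un w) = enc_word (v @ w)"
  by (simp add: enc_word_def)

definition "cross1_body = Cns (Call append_e [Var 0, Var 2]) (Var 1)"

definition "cross_body = Fold (Var 2) (Var 1) cross1_body"

definition "cross_e = Fold (Var 1) Nl cross_body"

definition "starts_body = Call cross_e [Var 2, Var 1]"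

definition "starts_e b = Fold (quote (un b)) (Cns Nl Nl) starts_body"

definition cross1 :: "nat list list \<Rightarrow> nat list \<Rightarrow> nat list list \<Rightarrow> nat list list" where
  "cross1 K p a = fold (\<lambda>c a. (c @ p) # a) K a"

definition cross :: "nat list list \<Rightarrow> nat list list \<Rightarrow> nat list list" where
  "cross K P = fold (cross1 K) P []"

text \<open>The product code: if \<open>K\<close> covers the words of one block with radius
  \<open>r\<close>, these concatenations cover \<open>b\<close> blocks with radius
  \<open>b * r\<close>.\<close>

definition starts :: "nat list list \<Rightarrow> nat \<Rightarrow> nat list list" where
  "starts K b = (cross K ^^ b) [[]]"

lemma cross1_eq: "cross1 K p a = rev (map (\<lambda>c. c @ p) K) @ a"
  unfolding cross1_def by (induction K arbitrary: a) auto

lemma cross_eq: "cross K P = concat (map (\<lambda>p. rev (map (\<lambda>c. c @ p) K)) (rev P))"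
proof -
  have "fold (cross1 K) P a = concat (map (\<lambda>p. rev (map (\<lambda>c. c @ p) K)) (rev P)) @ a" for a
    by (induction P arbitrary: a) (auto simp: cross1_eq)
  then show ?thesis by (simp add: cross_def)
qed

lemma length_cross: "length (cross K P) = length K * length P"
  by (simp add: cross_eq length_concat comp_def sum_list_triv rev_map[symmetric])

lemma set_cross: "set (cross K P) = {c @ p | c p. c \<in> set K \<and> p \<in> set P}"
  by (auto simp: cross_eq)

lemma length_starts: "length (starts K b) = length K ^ b"
  by (induction b) (auto simp: starts_def length_cross)

lemma cross_e:
  assumes "\<forall>c\<in>set K. length c \<le> s"
  shows "eval cross_e [enc_words K, enc_words P] = enc_words (cross K P)"
    "cost cross_e [enc_words K, enc_words P] \<le> length P * (length K * (28 * s + 34) + 11) + 5"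
proof -
  let ?vs = "[enc_words K, enc_words P]"
  let ?g = "\<lambda>e vs u a. eval e (u # a # vs)" and ?c = "\<lambda>e vs u a. cost e (u # a # vs)"
  have b: "eval cross_body (enc_word p # enc_words a # ?vs) = enc_words (cross1 K p a)"
    "cost cross_body (enc_word p # enc_words a # ?vs) \<le> length K * (28 * s + 34) + 5" for p a
  proof -
    let ?us = "enc_word p # enc_words a # ?vs"
    have *: "fold (?g cross1_body ?us) (map enc_word K) (enc_words a) = enc_words (cross1 K p a) \<and>
      True \<and> fold_cost (?g cross1_body ?us) (?c cross1_body ?us) (map enc_word K) (enc_words a)
      \<le> length K * (28 * s + 28 + 6)"
      unfolding cross1_def by (rule fold_rep) (use assms in \<open>simp_all add: cross1_body_def\<close>)
    then show "eval cross_body ?us = enc_words (cross1 K p a)"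
      "cost cross_body ?us \<le> length K * (28 * s + 34) + 5"
      by (simp_all add: cross_body_def ac_simps)
  qed
  have *: "fold (?g cross_body ?vs) (map enc_word P) (enc_words []) = enc_words (cross K P) \<and>
      True \<and> fold_cost (?g cross_body ?vs) (?c cross_body ?vs) (map enc_word P) (enc_words [])
      \<le> length P * (length K * (28 * s + 34) + 5 + 6)"
    unfolding cross_def by (rule fold_rep) (simp_all add: b)
  then show "eval cross_e ?vs = enc_words (cross K P)"
    "cost cross_e ?vs \<le> length P * (length K * (28 * s + 34) + 11) + 5"
    by (simp_all add: cross_e_def enc_words_Nil ac_simps)
qed

text \<open>From here on there are two sizes: \<open>s\<close> will be polynomial in
  \<open>n\<close>, while \<open>X\<close> bounds the number of words and is exponential. Bounds
  must be linear in \<open>X\<close>, because a higher power would change the base of the running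
  time.\<close>

definition starts_B :: "nat \<Rightarrow> nat \<Rightarrow> nat \<Rightarrow> nat" where
  "starts_B b s X = b * (X * (28 * s + 45) + 20) + 7 * b + 20"

lemma starts_e:
  assumes "\<forall>c\<in>set K. length c \<le> s" "length K ^ b \<le> X" "1 \<le> length K"
  shows "eval (starts_e b) [enc_words K] = enc_words (starts K b)"
    "cost (starts_e b) [enc_words K] \<le> starts_B b s X"
proof -
  let ?vs = "[enc_words K]"
  let ?g = "\<lambda>u a. eval starts_body (u # a # ?vs)" and ?c = "\<lambda>u a. cost starts_body (u # a # ?vs)"
  have i: "enc_words [[]] = Nd Lf Lf" by (simp add: enc_words_def enc_word_Nil)
  have *: "fold ?g (replicate b Lf) (enc_words [[]]) = enc_words ((cross K ^^ b) [[]]) \<and>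
      length ((cross K ^^ b) [[]]) = length K ^ b \<and>
      fold_cost ?g ?c (replicate b Lf) (enc_words [[]]) \<le> b * (X * (28 * s + 45) + 10 + 6)"
  proof (rule fold_rep_iter[where Inv = "\<lambda>i P. length P = length K ^ i"])
    fix i and P :: "nat list list" assume "i < b" and l: "length P = length K ^ i"
    then have "length K ^ Suc i \<le> length K ^ b" using assms by (intro power_increasing) auto
    then have PK: "length P * length K \<le> X" using assms l by (simp add: mult.commute)
    then have P: "length P \<le> X" using assms(3) by (metis dual_order.trans mult.right_neutral mult_le_mono2)
    have "length P * (length K * (28 * s + 34) + 11) = length P * length K * (28 * s + 34) + length P * 11"
      by (simp add: algebra_simps)
    also have "\<dots> \<le> X * (28 * s + 34) + X * 11" using P PK by (intro add_mono mult_right_mono) auto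
    also have "\<dots> = X * (28 * s + 45)" by (simp add: algebra_simps)
    finally have "cost cross_e [enc_words K, enc_words P] \<le> X * (28 * s + 45) + 5"
      using cross_e(2)[OF assms(1), of P] by simp
    then show "?g Lf (enc_words P) = enc_words (cross K P) \<and>
      length (cross K P) = length K ^ Suc i \<and> ?c Lf (enc_words P) \<le> X * (28 * s + 45) + 10"
      using l cross_e(1)[OF assms(1), of P] by (simp add: starts_body_def length_cross)
  qed simp
  then show "eval (starts_e b) ?vs = enc_words (starts K b)"
    by (simp add: starts_e_def i starts_def)
  have "fold_cost ?g ?c (replicate b Lf) (Nd Lf Lf) \<le> b * (X * (28 * s + 45) + 20)"
    using fold_bound[OF conjunct2[OF conjunct2[OF *]] order_refl, of "X * (28 * s + 45) + 20"] by (simp add: i)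
  then show "cost (starts_e b) ?vs \<le> starts_B b s X"
    by (simp add: starts_e_def starts_B_def)
qed

text \<open>Variable \<open>i\<close> of a formula is entry \<open>i - 1\<close> of a word.\<close>

definition "lookup_e = Hd (Call drop_e [Tl (Var 1), Var 0])"

lemma lookup_e:
  assumes "1 \<le> i" "i \<le> length a"
  shows "eval lookup_e [enc_word a, un i] = un (a ! (i - 1))"
    "cost lookup_e [enc_word a, un i] \<le> 9 * i + 20"
proof -
  have "drop (i - 1) a = a ! (i - 1) # drop i a" using assms Cons_nth_drop_Suc[of "i - 1" a] by simp
  then show "eval lookup_e [enc_word a, un i] = un (a ! (i - 1))"
    by (simp add: lookup_e_def drop_map)
  show "cost lookup_e [enc_word a, un i] \<le> 9 * i + 20"
    by (simp add: lookup_e_def)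
qed

section \<open>Evaluation of constraints\<close>

definition lits_ok :: "nat \<Rightarrow> nat \<Rightarrow> constraint \<Rightarrow> bool" where
  "lits_ok s L C \<longleftrightarrow> (\<forall>l\<in>set C. 1 \<le> fst l \<and> fst l \<le> L \<and> snd l \<le> s)"

definition violates :: "nat list \<Rightarrow> constraint \<Rightarrow> bool" where
  "violates a C \<longleftrightarrow> (\<forall>l\<in>set C. a ! (fst l - 1) = snd l)"

definition "viol_body = Ite (Call eq_e [Call lookup_e [Var 3, Hd (Var 0)], Tl (Var 0)]) (Var 1) Nl"

definition "viol_e = Fold (Var 0) true_e viol_body"

definition viol_B :: "nat \<Rightarrow> nat" where
  "viol_B s = s * (27 * s + 110) + 20"

lemma viol_e:
  assumes "lits_ok s (length a) C" "length C \<le> s" "set a \<subseteq> {..s}" "length a \<le> s"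
  shows "eval viol_e [enc_con C, enc_word a] = (if violates a C then un 1 else Lf)"
    "cost viol_e [enc_con C, enc_word a] \<le> viol_B s"
proof -
  let ?vs = "[enc_con C, enc_word a]"
  let ?g = "\<lambda>u a. eval viol_body (u # a # ?vs)" and ?c = "\<lambda>u a. cost viol_body (u # a # ?vs)"
  let ?ea = "\<lambda>b. if b then un 1 else Lf" and ?h = "\<lambda>l b. a ! (fst l - 1) = snd l \<and> b"
  have *: "fold ?g (map enc_lit C) (?ea True) = ?ea (fold ?h C True) \<and>
      True \<and> fold_cost ?g ?c (map enc_lit C) (?ea True) \<le> length C * (27 * s + 104 + 6)"
  proof (rule fold_rep)
    fix l b assume "l \<in> set C"
    then have l: "1 \<le> fst l" "fst l \<le> length a" "snd l \<le> s" using assms(1) by (auto simp: lits_ok_def)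
    have n: "a ! (fst l - 1) \<le> s" using l assms(3) nth_mem[of "fst l - 1" a] by fastforce
    have e: "cost eq_e [un x, un y] \<le> 18 * s + 60" if "x \<le> s" "y \<le> s" for x y
      using cost_eq_e[of "un x" "un y"] that by simp
    show "?g (enc_lit l) (?ea b) = ?ea (?h l b) \<and> True \<and> ?c (enc_lit l) (?ea b) \<le> 27 * s + 104"
      using lookup_e[OF l(1,2)] l n assms(4) e[OF n l(3)] e[OF l(3) l(3)]
      by (simp add: viol_body_def enc_lit_def)
  qed simp
  have "fold ?h C b = (b \<and> violates a C)" for b
    by (induction C arbitrary: b) (auto simp: violates_def)
  then show "eval viol_e ?vs = ?ea (violates a C)"
    using * by (simp add: viol_e_def enc_con_def)
  show "cost viol_e ?vs \<le> viol_B s"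
    using fold_bound[OF conjunct2[OF conjunct2[OF *]] assms(2), of "27 * s + 110"]
    by (simp add: viol_e_def viol_B_def enc_con_def)
qed

definition "form_ok s k L F \<longleftrightarrow> length F \<le> s \<and> k \<le> s \<and> L \<le> s \<and>
  (\<forall>C\<in>set F. length C \<le> k \<and> lits_ok s L C)"

definition "find_body = Ite (Var 1) (Var 1) (Ite (Call viol_e [Var 0, Var 3]) (Cns (Var 0) Nl) Nl)"

definition "find_e = Fold (Var 0) Nl find_body"

text \<open>The extra node keeps the empty constraint, itself encoded by \<open>Lf\<close> and
  violated by every word, apart from \<open>None\<close>.\<close>

definition enc_copt :: "constraint option \<Rightarrow> tree" where
  "enc_copt r = (case r of None \<Rightarrow> Lf | Some C \<Rightarrow> Nd (enc_con C) Lf)"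

definition find_B :: "nat \<Rightarrow> nat" where
  "find_B s = s * (viol_B s + 40) + 20"

lemma find_e:
  assumes "form_ok s k (length a) F" "set a \<subseteq> {..s}"
  shows "eval find_e [enc_formula F, enc_word a] = enc_copt (List.find (violates a) F)"
    "cost find_e [enc_formula F, enc_word a] \<le> find_B s"
proof -
  let ?vs = "[enc_formula F, enc_word a]"
  let ?g = "\<lambda>u a. eval find_body (u # a # ?vs)" and ?c = "\<lambda>u a. cost find_body (u # a # ?vs)"
  let ?h = "\<lambda>C r. case r of None \<Rightarrow> if violates a C then Some C else None | Some C' \<Rightarrow> Some C'"
  have *: "fold ?g (map enc_con F) (enc_copt None) = enc_copt (fold ?h F None) \<and>
      True \<and> fold_cost ?g ?c (map enc_con F) (enc_copt None) \<le> length F * (viol_B s + 34 + 6)"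
  proof (rule fold_rep)
    fix C r assume "C \<in> set F"
    then have "lits_ok s (length a) C" "length C \<le> s" "length a \<le> s"
      using assms(1) by (auto simp: form_ok_def)
    note v = viol_e[OF this(1,2) assms(2) this(3)]
    show "?g (enc_con C) (enc_copt r) = enc_copt (?h C r) \<and> True \<and>
      ?c (enc_con C) (enc_copt r) \<le> viol_B s + 34"
      using v by (cases r) (simp_all add: find_body_def enc_copt_def)
  qed simp
  have h: "fold ?h F r = (case r of None \<Rightarrow> List.find (violates a) F | Some C \<Rightarrow> Some C)" for r
    by (induction F arbitrary: r) (auto split: option.splits)
  have "fold ?h F None = List.find (violates a) F"
    by (simp only: h option.case)
  then show "eval find_e ?vs = enc_copt (List.find (violates a) F)"
    using * by (simp add: find_e_def enc_formula_def enc_copt_def)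
  have "length F \<le> s" using assms by (simp add: form_ok_def)
  from fold_bound[OF conjunct2[OF conjunct2[OF *]] this, of "viol_B s + 40"]
  show "cost find_e ?vs \<le> find_B s"
    by (simp add: find_e_def find_B_def enc_formula_def enc_copt_def)
qed

section \<open>Branching on a violated constraint\<close>

definition next_color :: "nat \<Rightarrow> nat \<Rightarrow> nat" where
  "next_color d c = (if c = d then 1 else Suc c)"

definition "next_color_e d = Ite (Call eq_e [Var 0, quote (un d)]) true_e (Cns Nl (Var 0))"

lemma next_color_e:
  "eval (next_color_e d) [un c] = un (next_color d c)"
  "c \<le> s \<Longrightarrow> d \<le> s \<Longrightarrow> cost (next_color_e d) [un c] \<le> 25 * s + 100"
  using cost_eq_e[of "un c" "un d"] by (simp_all add: next_color_e_def next_color_def)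

definition bump :: "nat \<Rightarrow> nat list \<Rightarrow> nat \<Rightarrow> nat list" where
  "bump d a i = a[i - 1 := next_color d (a ! (i - 1))]"

text \<open>Trees are immutable, so an entry is replaced by means of a zipper: the accumulator holds
  the reversed prefix and the remaining suffix.\<close>

definition "zip_body = Cns (Cns (Hd (Tl (Var 1))) (Hd (Var 1))) (Tl (Tl (Var 1)))"

definition "zip_e = Fold (Tl (Var 1)) (Cns Nl (Var 0)) zip_body"

definition "unzip_e d = Call revapp_e [Hd (Var 0),
  Cns (Call (next_color_e d) [Hd (Tl (Var 0))]) (Tl (Tl (Var 0)))]"

definition "bump_e d = Call (unzip_e d) [Call zip_e [Var 0, Var 1]]"

lemma bump_e:
  assumes "1 \<le> i" "i \<le> length a" "length a \<le> s" "set a \<subseteq> {..s}" "d \<le> s"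
  shows "eval (bump_e d) [enc_word a, un i] = enc_word (bump d a i)"
    "cost (bump_e d) [enc_word a, un i] \<le> 80 * s + 200"
proof -
  let ?vs = "[enc_word a, un i]"
  let ?g = "\<lambda>u a. eval zip_body (u # a # ?vs)" and ?c = "\<lambda>u a. cost zip_body (u # a # ?vs)"
  let ?ea = "\<lambda>p. Nd (enc_word (fst p)) (enc_word (snd p))"
  let ?h = "\<lambda>p. (hd (snd p) # fst p, tl (snd p))"
  let ?r = "(rev (take (i - 1) a), drop (i - 1) a)"
  have *: "fold ?g (replicate (i - 1) Lf) (?ea ([], a)) = ?ea ((?h ^^ (i - 1)) ([], a)) \<and>
      (?h ^^ (i - 1)) ([], a) = ?r \<and>
      fold_cost ?g ?c (replicate (i - 1) Lf) (?ea ([], a)) \<le> (i - 1) * (30 + 6)"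
  proof (rule fold_rep_iter[where Inv = "\<lambda>j p. p = (rev (take j a), drop j a)"])
    fix j p assume j: "j < i - 1" and p: "p = (rev (take j a), drop j a)"
    then have d: "drop j a \<noteq> []" using assms by simp
    have "hd (drop j a) = a ! j" "take (Suc j) a = take j a @ [a ! j]"
      using j assms by (simp_all add: hd_drop_conv_nth take_Suc_conv_app_nth)
    then show "?g Lf (?ea p) = ?ea (?h p) \<and> ?h p = (rev (take (Suc j) a), drop (Suc j) a) \<and>
      ?c Lf (?ea p) \<le> 30"
      using d by (simp add: zip_body_def p drop_Suc tl_drop)
  qed simp
  have z: "eval zip_e ?vs = ?ea ?r"
    using * by (simp add: zip_e_def enc_word_Nil)
  have im: "i - 1 \<le> s" using assms by simp
  have zc: "cost zip_e ?vs \<le> 36 * s + 20"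
    using fold_bound[OF conjunct2[OF conjunct2[OF *]] im order_refl]
    by (simp add: zip_e_def enc_word_Nil)
  have d: "drop (i - Suc 0) a = a ! (i - Suc 0) # drop i a"
    using assms Cons_nth_drop_Suc[of "i - 1" a] by simp
  have b: "bump d a i = take (i - 1) a @ next_color d (a ! (i - 1)) # drop i a"
    using assms by (simp add: bump_def upd_conv_take_nth_drop)
  show "eval (bump_e d) ?vs = enc_word (bump d a i)"
    by (simp add: bump_e_def unzip_e_def z d next_color_e b rev_map)
      (simp add: enc_word_def)
  have n: "a ! (i - 1) \<le> s" using assms nth_mem[of "i - 1" a] by fastforce
  show "cost (bump_e d) ?vs \<le> 80 * s + 200"
    using next_color_e(2)[OF n assms(5)] zc assms
    by (simp add: bump_e_def unzip_e_def z d)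
qed

definition "succs_body d = Cns (Call (bump_e d) [Var 3, Hd (Var 0)]) (Var 1)"

definition "succs2_e d = Ite (Var 0) (Fold (Hd (Var 0)) (Var 2) (succs_body d)) (Cns (Var 1) (Var 2))"

definition "succs_e d = Call (succs2_e d) [Call find_e [Var 0, Var 1], Var 1, Var 2]"

text \<open>A word without violated constraint is its own successor, so a solution survives all
  later rounds. An empty violated constraint has no successors, and the branch dies.\<close>

definition succs :: "nat \<Rightarrow> formula \<Rightarrow> nat list \<Rightarrow> nat list list \<Rightarrow> nat list list" where
  "succs d F a A = (case List.find (violates a) F of None \<Rightarrow> a # A
     | Some C \<Rightarrow> fold (\<lambda>l A. bump d a (fst l) # A) C A)"

definition succs_B :: "nat \<Rightarrow> nat" where
  "succs_B s = find_B s + s * (80 * s + 230) + 60"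

lemma succs_e:
  assumes "form_ok s k (length a) F" "set a \<subseteq> {..s}" "d \<le> s"
  shows "eval (succs_e d) [enc_formula F, enc_word a, enc_words A] = enc_words (succs d F a A)"
    "cost (succs_e d) [enc_formula F, enc_word a, enc_words A] \<le> succs_B s"
proof -
  note f = find_e[OF assms(1,2)]
  have "eval (succs_e d) [enc_formula F, enc_word a, enc_words A] = enc_words (succs d F a A) \<and>
    cost (succs_e d) [enc_formula F, enc_word a, enc_words A] \<le> succs_B s"
  proof (cases "List.find (violates a) F")
    case None
    then show ?thesis using f
      by (simp add: succs_e_def succs2_e_def succs_def enc_copt_def succs_B_def)
  next
    case (Some C)
    then have "C \<in> set F" by (auto simp: find_Some_iff)
    then have C: "lits_ok s (length a) C" "length C \<le> s" "length a \<le> s"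
      using assms(1) by (auto simp: form_ok_def)
    let ?vs = "[Nd (enc_con C) Lf, enc_word a, enc_words A]"
    let ?g = "\<lambda>u a. eval (succs_body d) (u # a # ?vs)" and ?c = "\<lambda>u a. cost (succs_body d) (u # a # ?vs)"
    have *: "fold ?g (map enc_lit C) (enc_words A) =
        enc_words (fold (\<lambda>l A. bump d a (fst l) # A) C A) \<and> True \<and>
      fold_cost ?g ?c (map enc_lit C) (enc_words A) \<le> length C * (80 * s + 220 + 6)"
    proof (rule fold_rep)
      fix l A assume "l \<in> set C"
      then have l: "1 \<le> fst l" "fst l \<le> length a" using C(1) by (auto simp: lits_ok_def)
      from bump_e[OF l C(3) assms(2,3)]
      show "?g (enc_lit l) (enc_words A) = enc_words (bump d a (fst l) # A) \<and> True \<and>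
        ?c (enc_lit l) (enc_words A) \<le> 80 * s + 220"
        by (simp add: succs_body_def enc_lit_def)
    qed simp
    from f * fold_bound[OF conjunct2[OF conjunct2[OF *]] C(2), of "80 * s + 230"] show ?thesis
      by (simp add: succs_e_def succs2_e_def succs_def enc_copt_def succs_B_def Some enc_con_def)
  qed
  then show "eval (succs_e d) [enc_formula F, enc_word a, enc_words A] = enc_words (succs d F a A)"
    "cost (succs_e d) [enc_formula F, enc_word a, enc_words A] \<le> succs_B s" by blast+
qed

lemma next_color_mem: "c \<in> {1..d} \<Longrightarrow> next_color d c \<in> {1..d}"
  by (auto simp: next_color_def)

lemma bump_words_over:
  assumes "a \<in> words_over d L" "1 \<le> i" "i \<le> L"
  shows "bump d a i \<in> words_over d L"
proof -
  have a: "length a = L" "set a \<subseteq> {1..d}" using assms(1) by (auto simp: words_over_def)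
  have "i - 1 < length a" using a assms by simp
  then have "next_color d (a ! (i - 1)) \<in> {1..d}"
    by (intro next_color_mem) (use a(2) nth_mem in blast)
  then have "set (bump d a i) \<subseteq> {1..d}"
    unfolding bump_def using set_update_subset_insert[of a "i - 1"] a(2) by blast
  then show ?thesis using a by (simp add: words_over_def bump_def)
qed

lemma fold_Cons: "fold (\<lambda>x A. f x # A) xs A = rev (map f xs) @ A"
  by (induction xs arbitrary: A) auto

lemma succs_eq:
  "succs d F a A = (case List.find (violates a) F of None \<Rightarrow> [a]
     | Some C \<Rightarrow> rev (map (bump d a \<circ> fst) C)) @ A"
  by (auto simp: succs_def fold_Cons comp_def split: option.split)

lemma succs_props:
  assumes "form_ok s k L F" "a \<in> words_over d L" "1 \<le> k"
  shows "length (succs d F a A) \<le> k + length A"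
    "set (succs d F a A) \<subseteq> words_over d L \<union> set A"
proof -
  have "length C \<le> k \<and> lits_ok s L C" if "List.find (violates a) F = Some C" for C
    using that assms(1) by (auto simp: form_ok_def find_Some_iff)
  then show "length (succs d F a A) \<le> k + length A" "set (succs d F a A) \<subseteq> words_over d L \<union> set A"
    using assms(2,3) bump_words_over[OF assms(2)]
    by (auto simp: succs_eq lits_ok_def split: option.splits)
qed

section \<open>Breadth-first exploration of the search tree\<close>

definition search_round :: "nat \<Rightarrow> formula \<Rightarrow> nat list list \<Rightarrow> nat list list" where
  "search_round d F L = fold (succs d F) L []"

definition "search_round_body d = Call (succs_e d) [Var 2, Var 0, Var 1]"

text \<open>Whole levels are processed because the tree language has no recursion; the list of
  current words takes the place of a stack.\<close>

definition "search_round_e d = Fold (Var 1) Nl (search_round_body d)"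

lemma words_over_le: "a \<in> words_over d L \<Longrightarrow> d \<le> s \<Longrightarrow> set a \<subseteq> {..s}"
proof -
  assume "a \<in> words_over d L" "d \<le> s"
  then have "set a \<subseteq> {1..d}" "{1..d} \<subseteq> {..s}" by (auto simp: words_over_def)
  then show ?thesis by (rule subset_trans)
qed

lemma search_round_e:
  assumes "form_ok s k L F" "set A \<subseteq> words_over d L" "d \<le> s"
  shows "eval (search_round_e d) [enc_formula F, enc_words A] = enc_words (search_round d F A)"
    "cost (search_round_e d) [enc_formula F, enc_words A] \<le> length A * (succs_B s + 20) + 10"
proof -
  let ?vs = "[enc_formula F, enc_words A]"
  let ?g = "\<lambda>u a. eval (search_round_body d) (u # a # ?vs)" and ?c = "\<lambda>u a. cost (search_round_body d) (u # a # ?vs)"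
  have *: "fold ?g (map enc_word A) (enc_words []) = enc_words (search_round d F A) \<and> True \<and>
      fold_cost ?g ?c (map enc_word A) (enc_words []) \<le> length A * (succs_B s + 10 + 6)"
    unfolding search_round_def
  proof (rule fold_rep)
    fix a B assume "a \<in> set A"
    then have a: "a \<in> words_over d L" using assms by auto
    then have "form_ok s k (length a) F" using assms(1) by (simp add: words_over_def)
    from succs_e[OF this words_over_le[OF a assms(3)] assms(3), of B]
    show "?g (enc_word a) (enc_words B) = enc_words (succs d F a B) \<and> True \<and>
      ?c (enc_word a) (enc_words B) \<le> succs_B s + 10"
      by (simp add: search_round_body_def)
  qed simp
  then show "eval (search_round_e d) ?vs = enc_words (search_round d F A)"
    by (simp add: search_round_e_def enc_words_Nil)
  from fold_bound[OF conjunct2[OF conjunct2[OF *]] order_refl, of "succs_B s + 20"]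
  show "cost (search_round_e d) ?vs \<le> length A * (succs_B s + 20) + 10"
    by (simp add: search_round_e_def enc_words_Nil)
qed

lemma search_round_props:
  assumes "form_ok s k L F" "set A \<subseteq> words_over d L" "1 \<le> k"
  shows "length (search_round d F A) \<le> k * length A" "set (search_round d F A) \<subseteq> words_over d L"
proof -
  have "length (fold (succs d F) A B) \<le> k * length A + length B \<and>
    (set B \<subseteq> words_over d L \<longrightarrow> set (fold (succs d F) A B) \<subseteq> words_over d L)" for B
    using assms(2)
  proof (induction A arbitrary: B)
    case (Cons a A)
    from Cons.IH[of "succs d F a B"] Cons.prems succs_props[OF assms(1) _ assms(3), of a d B]
    show ?case by fastforce
  qed simp
  from this[of "[]"] show "length (search_round d F A) \<le> k * length A" "set (search_round d F A) \<subseteq> words_over d L"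
    by (auto simp: search_round_def)
qed

definition "iter_body d = Call (search_round_e d) [Var 4, Var 1]"

text \<open>Nested loops of \<open>b\<close> and \<open>r\<close> iterations give
  \<open>b * r\<close> rounds. Each loop shifts the environment by two, so \<open>Var 3\<close> is
  the radius here and \<open>Var 4\<close> is the formula in \<open>iter_body\<close>.\<close>

definition "rounds_body d = Fold (Var 3) (Var 1) (iter_body d)"

definition "rounds_e d b = Fold (quote (un b)) (Var 2) (rounds_body d)"

definition rounds_B :: "nat \<Rightarrow> nat \<Rightarrow> nat \<Rightarrow> nat" where
  "rounds_B b s X = b * (s * (X * (succs_B s + 20) + 40) + 40) + 7 * b + 20"

text \<open>\<open>X\<close> bounds the list after the last round. As \<open>1 \<le> k\<close>, the
  bounds on the levels increase, so \<open>X\<close> bounds all earlier lists as well.\<close>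

lemma rounds_e:
  assumes "form_ok s k L F" "set A \<subseteq> words_over d L" "d \<le> s" "1 \<le> k" "r \<le> s"
    "length A * k ^ (b * r) \<le> X"
  defines "A' \<equiv> (search_round d F ^^ (b * r)) A"
  shows "eval (rounds_e d b) [enc_formula F, un r, enc_words A] = enc_words A'"
    "cost (rounds_e d b) [enc_formula F, un r, enc_words A] \<le> rounds_B b s X"
    "length A' \<le> X" "set A' \<subseteq> words_over d L"
proof -
  let ?vs = "[enc_formula F, un r, enc_words A]"
  let ?B = "X * (succs_B s + 20) + 30"
  have inner: "eval (rounds_body d) (Lf # enc_words A1 # ?vs) = enc_words ((search_round d F ^^ r) A1) \<and>
      (length ((search_round d F ^^ r) A1) \<le> k ^ r * length A1 \<and> set ((search_round d F ^^ r) A1) \<subseteq> words_over d L) \<and>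
      cost (rounds_body d) (Lf # enc_words A1 # ?vs) \<le> s * (?B + 6) + 10"
    if A1: "set A1 \<subseteq> words_over d L" "k ^ r * length A1 \<le> X" for A1
  proof -
    let ?us = "Lf # enc_words A1 # ?vs"
    let ?g = "\<lambda>u a. eval (iter_body d) (u # a # ?us)" and ?c = "\<lambda>u a. cost (iter_body d) (u # a # ?us)"
    have *: "fold ?g (replicate r Lf) (enc_words A1) = enc_words ((search_round d F ^^ r) A1) \<and>
      (length ((search_round d F ^^ r) A1) \<le> k ^ r * length A1 \<and> set ((search_round d F ^^ r) A1) \<subseteq> words_over d L) \<and>
      fold_cost ?g ?c (replicate r Lf) (enc_words A1) \<le> r * (?B + 6)"
    proof (rule fold_rep_iter[where Inv = "\<lambda>i B. length B \<le> k ^ i * length A1 \<and> set B \<subseteq> words_over d L"])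
      fix i and B :: "nat list list"
      assume i: "i < r" and B: "length B \<le> k ^ i * length A1 \<and> set B \<subseteq> words_over d L"
      have "k ^ i * length A1 \<le> k ^ r * length A1"
        using i assms(4) by (intro mult_right_mono power_increasing) auto
      then have "length B \<le> X" using B A1(2) by linarith
      then have "length B * (succs_B s + 20) \<le> X * (succs_B s + 20)" by (rule mult_le_mono1)
      then have "cost (search_round_e d) [enc_formula F, enc_words B] \<le> X * (succs_B s + 20) + 10"
        using search_round_e(2)[OF assms(1) conjunct2[OF B] assms(3)] by linarith
      then have "?c Lf (enc_words B) \<le> ?B" "?g Lf (enc_words B) = enc_words (search_round d F B)"
        using search_round_e(1)[OF assms(1) conjunct2[OF B] assms(3)] by (simp_all add: iter_body_def)
      moreover have "length (search_round d F B) \<le> k * length B" "set (search_round d F B) \<subseteq> words_over d L"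
        using search_round_props[OF assms(1) conjunct2[OF B] assms(4)] by auto
      moreover have "k * length B \<le> k ^ Suc i * length A1" using B by (simp add: mult.assoc)
      ultimately show "?g Lf (enc_words B) = enc_words (search_round d F B) \<and>
        (length (search_round d F B) \<le> k ^ Suc i * length A1 \<and> set (search_round d F B) \<subseteq> words_over d L) \<and>
        ?c Lf (enc_words B) \<le> ?B" by linarith
    qed (use A1 in simp)
    from * fold_bound[OF conjunct2[OF conjunct2[OF *]] assms(5) order_refl] show ?thesis
      by (simp add: rounds_body_def)
  qed
  let ?g = "\<lambda>u a. eval (rounds_body d) (u # a # ?vs)" and ?c = "\<lambda>u a. cost (rounds_body d) (u # a # ?vs)"
  have *: "fold ?g (replicate b Lf) (enc_words A) = enc_words (((search_round d F ^^ r) ^^ b) A) \<and>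
    (length (((search_round d F ^^ r) ^^ b) A) \<le> k ^ (b * r) * length A \<and>
      set (((search_round d F ^^ r) ^^ b) A) \<subseteq> words_over d L) \<and>
      fold_cost ?g ?c (replicate b Lf) (enc_words A) \<le> b * (s * (?B + 6) + 10 + 6)"
  proof (rule fold_rep_iter[where Inv = "\<lambda>i B. length B \<le> k ^ (i * r) * length A \<and> set B \<subseteq> words_over d L"])
    fix i and B :: "nat list list"
    assume i: "i < b" and B: "length B \<le> k ^ (i * r) * length A \<and> set B \<subseteq> words_over d L"
    have le: "k ^ r * length B \<le> k ^ (Suc i * r) * length A" using B by (simp add: power_add mult.assoc)
    have "Suc i * r \<le> b * r" using i by (intro mult_le_mono1) simp
    from power_increasing[OF this assms(4)] have "k ^ (Suc i * r) * length A \<le> k ^ (b * r) * length A"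
      by (rule mult_le_mono1)
    then have "k ^ r * length B \<le> X" using le assms(6) by (metis mult.commute order_trans)
    from inner[OF conjunct2[OF B] this] le
    show "?g Lf (enc_words B) = enc_words ((search_round d F ^^ r) B) \<and>
      (length ((search_round d F ^^ r) B) \<le> k ^ (Suc i * r) * length A \<and>
        set ((search_round d F ^^ r) B) \<subseteq> words_over d L) \<and>
      ?c Lf (enc_words B) \<le> s * (?B + 6) + 10" by linarith
  qed (use assms in simp)
  have A': "((search_round d F ^^ r) ^^ b) A = A'"
    by (simp add: A'_def funpow_mult mult.commute)
  show "eval (rounds_e d b) ?vs = enc_words A'" "set A' \<subseteq> words_over d L"
    using * A' by (simp_all add: rounds_e_def)
  show "length A' \<le> X" using * A' assms(6) by (simp add: mult.commute)
  have "s * (?B + 6) + 10 + 6 \<le> s * (X * (succs_B s + 20) + 40) + 40"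
    by (simp add: add_mult_distrib2)
  from fold_bound[OF conjunct2[OF conjunct2[OF *]] order_refl this]
  show "cost (rounds_e d b) ?vs \<le> rounds_B b s X"
    by (simp add: rounds_e_def rounds_B_def)
qed

definition "sat_body = Ite (Call find_e [Var 2, Var 0]) (Var 1) true_e"

definition "sat_e = Fold (Var 1) Nl sat_body"

lemma sat_e:
  assumes "form_ok s k L F" "set A \<subseteq> words_over d L" "d \<le> s"
  shows "eval sat_e [enc_formula F, enc_words A] \<noteq> Lf \<longleftrightarrow> (\<exists>a\<in>set A. \<forall>C\<in>set F. \<not> violates a C)"
    "cost sat_e [enc_formula F, enc_words A] \<le> length A * (find_B s + 30) + 10"
proof -
  let ?vs = "[enc_formula F, enc_words A]"
  let ?g = "\<lambda>u a. eval sat_body (u # a # ?vs)" and ?c = "\<lambda>u a. cost sat_body (u # a # ?vs)"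
  let ?ea = "\<lambda>b. if b then un 1 else Lf" and ?h = "\<lambda>a b. b \<or> List.find (violates a) F = None"
  have *: "fold ?g (map enc_word A) (?ea False) = ?ea (fold ?h A False) \<and> True \<and>
      fold_cost ?g ?c (map enc_word A) (?ea False) \<le> length A * (find_B s + 20 + 6)"
  proof (rule fold_rep)
    fix a b assume "a \<in> set A"
    then have a: "a \<in> words_over d L" using assms by auto
    then have "form_ok s k (length a) F" using assms(1) by (simp add: words_over_def)
    from find_e[OF this words_over_le[OF a assms(3)]]
    show "?g (enc_word a) (?ea b) = ?ea (?h a b) \<and> True \<and>
      ?c (enc_word a) (?ea b) \<le> find_B s + 20"
      by (auto simp: sat_body_def enc_copt_def split: option.split)
  qed simp
  have "fold ?h A b \<longleftrightarrow> b \<or> (\<exists>a\<in>set A. \<forall>C\<in>set F. \<not> violates a C)" for b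
    by (induction A arbitrary: b) (auto simp: find_None_iff)
  then show "eval sat_e ?vs \<noteq> Lf \<longleftrightarrow> (\<exists>a\<in>set A. \<forall>C\<in>set F. \<not> violates a C)"
    using * by (simp add: sat_e_def)
  from fold_bound[OF conjunct2[OF conjunct2[OF *]] order_refl, of "find_B s + 30"]
  show "cost sat_e ?vs \<le> length A * (find_B s + 30) + 10"
    by (simp add: sat_e_def)
qed

section \<open>Block length and the complete program\<close>

definition "blocks_body b = Ite (Tl (Hd (Var 1))) (Cns (Tl (Hd (Var 1))) (Tl (Var 1)))
  (Cns (quote (un b)) (Cns Nl (Tl (Var 1))))"

text \<open>Division by counting down: the first component runs from \<open>b\<close> to 1, and each
  restart raises the second. With the result \<open>n div b + 1\<close> as block length,
  \<open>b\<close> blocks have room for all \<open>n\<close> variables.\<close>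

definition "blocks_e b = Tl (Fold (Var 0) (Cns (quote (un b)) true_e) (blocks_body b))"

lemma blocks_e:
  assumes "1 \<le> b"
  shows "eval (blocks_e b) [un n] = un (n div b + 1)"
    "cost (blocks_e b) [un n] \<le> n * (7 * b + 50) + 7 * b + 30"
proof -
  let ?vs = "[un n]"
  let ?g = "\<lambda>u a. eval (blocks_body b) (u # a # ?vs)" and ?c = "\<lambda>u a. cost (blocks_body b) (u # a # ?vs)"
  let ?ea = "\<lambda>p. Nd (un (fst p)) (un (snd p))"
  let ?h = "\<lambda>p. if 1 < fst p then (fst p - 1, snd p) else (b, Suc (snd p))"
  have *: "fold ?g (replicate n Lf) (?ea (b, 1)) = ?ea ((?h ^^ n) (b, 1)) \<and>
      (1 \<le> fst ((?h ^^ n) (b, 1)) \<and> fst ((?h ^^ n) (b, 1)) \<le> b \<and>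
        n + fst ((?h ^^ n) (b, 1)) = b * snd ((?h ^^ n) (b, 1))) \<and>
      fold_cost ?g ?c (replicate n Lf) (?ea (b, 1)) \<le> n * (7 * b + 40 + 6)"
  proof (rule fold_rep_iter[where Inv = "\<lambda>i p. 1 \<le> fst p \<and> fst p \<le> b \<and> i + fst p = b * snd p"])
    fix i p assume "1 \<le> fst p \<and> fst p \<le> b \<and> i + fst p = b * snd p"
    then show "?g Lf (?ea p) = ?ea (?h p) \<and>
        (1 \<le> fst (?h p) \<and> fst (?h p) \<le> b \<and> Suc i + fst (?h p) = b * snd (?h p)) \<and>
        ?c Lf (?ea p) \<le> 7 * b + 40"
      using assms by (auto simp: blocks_body_def)
  qed (use assms in simp)
  obtain c q where cq: "(?h ^^ n) (b, 1) = (c, q)" by fastforce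
  then have i: "1 \<le> c" "c \<le> b" "n + c = b * q" using * by auto
  then obtain q' where q: "q = Suc q'" by (cases q) auto
  then have "n = b * q' + (b - c)" "b - c < b" using i by auto
  then have "n div b = q'" by simp
  then show "eval (blocks_e b) ?vs = un (n div b + 1)"
    using * cq q by (simp add: blocks_e_def)
  from fold_bound[OF conjunct2[OF conjunct2[OF *]] order_refl, of "7 * b + 50"]
  show "cost (blocks_e b) ?vs \<le> n * (7 * b + 50) + 7 * b + 30"
    by (simp add: blocks_e_def)
qed

text \<open>The nested calls bind intermediate results: \<open>main_e\<close> the block length,
  \<open>main2_e\<close> the words and the radii, \<open>main3_e\<close> the pair of best radius and
  code, on which the search works here.\<close>

definition "main4_e d b = Call sat_e [Var 0, Call (rounds_e d b) [Var 0, Hd (Var 1), Call (starts_e b) [Tl (Var 1)]]]"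

definition "main3_e d k b = Call (main4_e d b) [Var 0, Call (best_e d k) [Var 1, Var 2]]"

definition "main2_e d k b = Call (main3_e d k b) [Var 0, Call (words_e d) [Var 1], Call (radii_e d) [Var 1]]"

definition "main_e d k b = Call (main2_e d k b) [Var 1, Call (blocks_e b) [Var 0]]"

section \<open>Correctness of covering codes and local search\<close>

lemma cdist_self [simp]: "cdist d a a = 0"
  by (simp add: cdist_def)

lemma wdist_self [simp]: "wdist d x x = 0"
  by (induction x) auto

lemma cdist_eq_0: "a \<in> {1..d} \<Longrightarrow> b \<in> {1..d} \<Longrightarrow> cdist d a b = 0 \<longleftrightarrow> a = b"
  by (auto simp: cdist_def)

lemma cdist_next_color:
  "a \<in> {1..d} \<Longrightarrow> b \<in> {1..d} \<Longrightarrow> a \<noteq> b \<Longrightarrow> cdist d a b = Suc (cdist d (next_color d a) b)"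
  by (auto simp: cdist_def next_color_def)

lemma wdist_eq_0: "is_word d x \<Longrightarrow> is_word d y \<Longrightarrow> length x = length y \<Longrightarrow> wdist d x y = 0 \<Longrightarrow> x = y"
proof (induction d x y rule: wdist.induct)
  case (1 d a x b y)
  then show ?case using cdist_eq_0[of a d b] by auto
qed auto

lemma wdist_append: "length x = length y \<Longrightarrow> wdist d (x @ x') (y @ y') = wdist d x y + wdist d x' y'"
  by (induction d x y rule: wdist.induct) auto

lemma wdist_list_update:
  "is_word d x \<Longrightarrow> is_word d y \<Longrightarrow> length x = length y \<Longrightarrow> j < length x \<Longrightarrow> x ! j \<noteq> y ! j \<Longrightarrow>
    wdist d x y = Suc (wdist d (x[j := next_color d (x ! j)]) y)"
proof (induction d x y arbitrary: j rule: wdist.induct)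
  case (1 d a x b y)
  then show ?case using cdist_next_color[of a d b] by (cases j) auto
qed auto

lemma wdist_bump:
  assumes "a \<in> words_over d L" "y \<in> words_over d L" "1 \<le> i" "i \<le> L" "a ! (i - 1) \<noteq> y ! (i - 1)"
  shows "wdist d a y = Suc (wdist d (bump d a i) y)"
  using wdist_list_update[of a d y "i - 1"] assms by (auto simp: words_over_def bump_def)

section \<open>Counting words by distance\<close>

lemma set_colors: "set (colors d) = {1..d}"
  by (auto simp: colors_def)

lemma words_Suc: "words d (Suc m) = ext d (words d m)"
  by (simp add: words_def)

lemma set_words: "set (words d m) = words_over d m"
proof (induction m)
  case 0
  then show ?case by (auto simp: words_def words_over_def)
next
  case (Suc m)
  have "set (words d (Suc m)) = {c # w | c w. c \<in> {1..d} \<and> w \<in> words_over d m}"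
    by (auto simp: words_Suc ext_eq Suc set_colors)
  also have "\<dots> = words_over d (Suc m)"
    by (auto simp: words_over_def length_Suc_conv)
  finally show ?case .
qed

lemma sum_list_concat_map: "sum_list (concat (map f xs)) = (\<Sum>x\<leftarrow>xs. sum_list (f x))"
  by (induction xs) auto

lemma sum_words_Suc:
  fixes f :: "nat list \<Rightarrow> 'a :: comm_monoid_add"
  shows "(\<Sum>x\<leftarrow>words d (Suc m). f x) = (\<Sum>w\<leftarrow>words d m. \<Sum>c = 1..d. f (c # w))"
proof -
  have 1: "(\<Sum>c\<leftarrow>colors d. g c) = (\<Sum>c = 1..d. g c)" for g :: "nat \<Rightarrow> 'a"
    by (simp add: colors_def interv_sum_list_conv_sum_set_nat atLeastLessThanSuc_atLeastAtMost del: upt_Suc)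
  have 2: "sum_list (rev xs) = sum_list xs" for xs :: "'a list"
    by (induction xs) (auto simp: ac_simps)
  have "(\<Sum>x\<leftarrow>words d (Suc m). f x) = (\<Sum>w\<leftarrow>rev (words d m). sum_list (rev (map (\<lambda>c. f (c # w)) (colors d))))"
    unfolding words_Suc ext_eq map_concat map_map sum_list_concat_map by (simp add: comp_def rev_map)
  also have "\<dots> = (\<Sum>w\<leftarrow>words d m. \<Sum>c = 1..d. f (c # w))"
    by (simp add: 1 2 rev_map[symmetric])
  finally show ?thesis .
qed

lemma sum_list_sum_swap:
  fixes f :: "'b \<Rightarrow> 'c \<Rightarrow> 'a :: comm_monoid_add"
  shows "(\<Sum>x\<leftarrow>xs. \<Sum>j\<in>A. f x j) = (\<Sum>j\<in>A. \<Sum>x\<leftarrow>xs. f x j)"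
  by (induction xs) (auto simp: sum.distrib)

lemma sum_list_swap:
  fixes f :: "'b \<Rightarrow> 'c \<Rightarrow> 'a :: comm_monoid_add"
  shows "(\<Sum>x\<leftarrow>xs. \<Sum>y\<leftarrow>ys. f x y) = (\<Sum>y\<leftarrow>ys. \<Sum>x\<leftarrow>xs. f x y)"
  by (induction xs) (auto simp: sum_list_addf)

text \<open>The sum of \<open>f (j1 + ... + jm)\<close> over all \<open>j1, ..., jm < d\<close>.
  Powers of \<open>q\<close> as \<open>f\<close> give the generating function of the distances, the
  indicator of \<open>{..r}\<close> gives the size of a ball.\<close>

fun profile :: "nat \<Rightarrow> nat \<Rightarrow> (nat \<Rightarrow> 'a :: comm_monoid_add) \<Rightarrow> 'a" where
  "profile d 0 f = f 0"
| "profile d (Suc m) f = (\<Sum>j<d. profile d m (\<lambda>s. f (j + s)))"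

text \<open>A rotation: while \<open>c\<close> runs through all colours, its cyclic distance to
  \<open>b\<close> takes each value below \<open>d\<close> exactly once. This is why counts do not
  depend on the word at the centre.\<close>

lemma sum_cdist:
  assumes "b \<in> {1..d}"
  shows "(\<Sum>c = 1..d. f (cdist d c b)) = (\<Sum>j<d. f j)"
proof (rule sum.reindex_bij_betw)
  have "inj_on (\<lambda>c. cdist d c b) {1..d}"
    using assms by (auto simp: inj_on_def cdist_def split: if_splits)
  moreover have "(\<lambda>c. cdist d c b) ` {1..d} \<subseteq> {..<d}"
    using assms by (auto simp: cdist_def)
  ultimately show "bij_betw (\<lambda>c. cdist d c b) {1..d} {..<d}"
    by (metis bij_betw_def card_atLeastAtMost card_image card_lessThan card_subset_eq diff_Suc_1 finite_lessThan)
qed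

lemma sum_wdist: "y \<in> words_over d m \<Longrightarrow> (\<Sum>x\<leftarrow>words d m. f (wdist d x y)) = profile d m f"
proof (induction m arbitrary: y f)
  case 0
  then show ?case by (simp add: words_def)
next
  case (Suc m)
  then obtain b y' where y: "y = b # y'" "b \<in> {1..d}" "y' \<in> words_over d m"
    by (auto simp: words_over_def length_Suc_conv)
  have "(\<Sum>x\<leftarrow>words d (Suc m). f (wdist d x y)) =
      (\<Sum>w\<leftarrow>words d m. \<Sum>c = 1..d. f (cdist d c b + wdist d w y'))"
    by (simp add: sum_words_Suc y)
  also have "\<dots> = (\<Sum>w\<leftarrow>words d m. \<Sum>j<d. f (j + wdist d w y'))"
    using sum_cdist[OF y(2), of "\<lambda>j. f (j + _)"] by simp
  also have "\<dots> = (\<Sum>j<d. \<Sum>w\<leftarrow>words d m. f (j + wdist d w y'))"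
    by (rule sum_list_sum_swap)
  also have "\<dots> = profile d (Suc m) f"
    unfolding profile.simps by (intro sum.cong HOL.refl Suc.IH[OF y(3)])
  finally show ?case .
qed

text \<open>Powers turn sums into products, so the sum factors over the letters. The scalar
  \<open>c\<close> makes the induction work: it takes up the factor of the first letter.\<close>

lemma profile_power: "profile d m (\<lambda>s. c * q ^ s) = c * (\<Sum>j<d. q ^ j :: real) ^ m"
proof (induction m arbitrary: c)
  case (Suc m)
  have "profile d m (\<lambda>s. c * q ^ (j + s)) = c * q ^ j * (\<Sum>j<d. q ^ j) ^ m" for j
    using Suc[of "c * q ^ j"] by (simp add: power_add mult.assoc)
  then show ?case by (simp add: sum_distrib_left sum_distrib_right mult_ac)
qed simp

text \<open>The distance is not symmetric. What is counted are the words from which a given word can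
  be reached by at most \<open>r\<close> increments, that is, the centres that cover it.\<close>

definition ball_size :: "nat \<Rightarrow> nat \<Rightarrow> nat \<Rightarrow> nat" where
  "ball_size d m r = profile d m (\<lambda>s. of_bool (s \<le> r))"

lemma replicate_words_over: "1 \<le> d \<Longrightarrow> replicate m 1 \<in> words_over d m"
  by (auto simp: words_over_def)

lemma sum_list_of_bool: "(\<Sum>x\<leftarrow>xs. of_bool (P x)) = (of_nat (length (filter P xs)) :: 'a :: semiring_1)"
  by (induction xs) auto

lemma ball_size: "y \<in> words_over d m \<Longrightarrow> length (filter (\<lambda>x. wdist d x y \<le> r) (words d m)) = ball_size d m r"
  unfolding ball_size_def
  by (subst sum_wdist[symmetric], assumption) (simp only: sum_list_of_bool of_nat_id)

lemma ball_size_le: "1 \<le> d \<Longrightarrow> ball_size d m r \<le> d ^ m"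
  using ball_size[OF replicate_words_over, of d m r] length_filter_le[of _ "words d m"]
  by (metis length_words)

lemma ball_size_pos: "1 \<le> d \<Longrightarrow> 1 \<le> ball_size d m r"
proof -
  assume d: "1 \<le> d"
  let ?y = "replicate m (1 :: nat)"
  have "?y \<in> set (filter (\<lambda>x. wdist d x ?y \<le> r) (words d m))"
    using replicate_words_over[OF d, of m] by (simp add: set_words)
  then show ?thesis using ball_size[OF replicate_words_over[OF d], of m r]
    by (metis One_nat_def Suc_leI length_pos_if_in_set)
qed

text \<open>A word at distance \<open>r\<close> contributes \<open>q ^ r\<close> to the left side
  and is in the ball of radius \<open>r\<close>, so the left side is at most the sum of
  \<open>q ^ r\<close> times the ball size over all radii up to \<open>d * m\<close>. One of these
  \<open>d * m + 1\<close> summands is at least their average.\<close>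

lemma good_radius:
  fixes q :: real
  assumes "0 < q" "1 \<le> d"
  obtains r where "r \<le> d * m" "(\<Sum>j<d. q ^ j) ^ m \<le> real (d * m + 1) * (q ^ r * real (ball_size d m r))"
proof -
  define y where "y = replicate m (1 :: nat)"
  have y: "y \<in> words_over d m" unfolding y_def using assms(2) by (rule replicate_words_over)
  have "(\<Sum>j<d. q ^ j) ^ m = (\<Sum>x\<leftarrow>words d m. q ^ wdist d x y)"
    using profile_power[of d m 1 q] sum_wdist[OF y, of "\<lambda>s. q ^ s"] by simp
  also have "\<dots> \<le> (\<Sum>x\<leftarrow>words d m. \<Sum>r\<le>d * m. q ^ r * of_bool (wdist d x y \<le> r))"
  proof (rule sum_list_mono)
    fix x assume "x \<in> set (words d m)"
    then have "x \<in> words_over d m" by (simp add: set_words)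
    then have le: "wdist d x y \<le> d * m"
      using wdist_le[of x d y] y by (auto simp: words_over_def)
    have "q ^ wdist d x y = (\<Sum>r\<in>{wdist d x y}. q ^ r * of_bool (wdist d x y \<le> r))" by simp
    also have "\<dots> \<le> (\<Sum>r\<le>d * m. q ^ r * of_bool (wdist d x y \<le> r))"
      by (rule sum_mono2) (use le assms in auto)
    finally show "q ^ wdist d x y \<le> (\<Sum>r\<le>d * m. q ^ r * of_bool (wdist d x y \<le> r))" .
  qed
  also have "\<dots> = (\<Sum>r\<le>d * m. q ^ r * real (ball_size d m r))"
    by (simp only: sum_list_sum_swap sum_list_const_mult sum_list_of_bool ball_size[OF y])
  finally have le: "(\<Sum>j<d. q ^ j) ^ m \<le> (\<Sum>r\<le>d * m. q ^ r * real (ball_size d m r))" .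
  have "\<exists>r\<le>d * m. (\<Sum>j<d. q ^ j) ^ m \<le> real (d * m + 1) * (q ^ r * real (ball_size d m r))"
  proof (rule ccontr)
    assume "\<not> ?thesis"
    then have "(\<Sum>r\<le>d * m. real (d * m + 1) * (q ^ r * real (ball_size d m r))) < (\<Sum>r\<le>d * m. (\<Sum>j<d. q ^ j) ^ m)"
      by (intro sum_strict_mono) (auto simp: not_le dest: leD)
    then have "real (d * m + 1) * (\<Sum>r\<le>d * m. q ^ r * real (ball_size d m r)) < real (d * m + 1) * (\<Sum>j<d. q ^ j) ^ m"
      by (simp add: sum_distrib_left)
    then show False using le mult_less_cancel_left_pos[of "real (d * m + 1)"] by (simp del: of_nat_add of_nat_mult)
  qed
  then show ?thesis using that by blast
qed

section \<open>Analysis of the greedy covering code\<close>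

lemma pick_props:
  assumes "W \<noteq> []"
  shows "fst (pick d W r U) \<in> set W" "snd (pick d W r U) = filt d (fst (pick d W r U)) r U"
    "x \<in> set W \<Longrightarrow> length (snd (pick d W r U)) \<le> length (filt d x r U)"
proof -
  have *: "length (snd (fold (pick_step d r U) W p)) \<le> length (snd p) \<and>
      (\<forall>x\<in>set W. length (snd (fold (pick_step d r U) W p)) \<le> length (filt d x r U)) \<and>
      (fold (pick_step d r U) W p = p \<or>
       fst (fold (pick_step d r U) W p) \<in> set W \<and>
       snd (fold (pick_step d r U) W p) = filt d (fst (fold (pick_step d r U) W p)) r U)" for W p
  proof (induction W arbitrary: p)
    case (Cons x W)
    show ?case using Cons[of "pick_step d r U x p"]
      by (cases "length (filt d x r U) \<le> length (snd p)") (auto simp: pick_step_def)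
  qed simp
  obtain x W' where W: "W = x # W'" using assms by (cases W) auto
  \<comment> \<open>The first candidate replaces the dummy, so the fold effectively starts from a
    genuine pair.\<close>
  have s: "pick_step d r U x ([], U) = (x, filt d x r U)"
    by (simp add: pick_step_def length_filt_le)
  have p: "pick d W r U = fold (pick_step d r U) W' (x, filt d x r U)"
    by (simp add: pick_def W s)
  show "fst (pick d W r U) \<in> set W" "snd (pick d W r U) = filt d (fst (pick d W r U)) r U"
    using *[of W' "(x, filt d x r U)"] W unfolding p by auto
  show "length (snd (pick d W r U)) \<le> length (filt d x r U)" if "x \<in> set W" for x
    using *[of W "([], U)"] that unfolding pick_def by blast
qed

text \<open>Double counting: each uncovered word is missed by exactly
  \<open>d ^ m - ball_size d m r\<close> of the \<open>d ^ m\<close> centres, and the best centre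
  leaves no more than the average.\<close>

lemma pick_shrinks:
  assumes "set U \<subseteq> words_over d m" "1 \<le> d"
  shows "d ^ m * length (snd (pick d (words d m) r U)) \<le> (d ^ m - ball_size d m r) * length U"
proof -
  let ?W = "words d m"
  have W: "?W \<noteq> []" using length_words[of d m] assms(2) by auto
  have "(\<Sum>x\<leftarrow>?W. length (snd (pick d ?W r U))) \<le> (\<Sum>x\<leftarrow>?W. length (filt d x r U))"
    by (rule sum_list_mono) (rule pick_props(3)[OF W])
  then have "d ^ m * length (snd (pick d ?W r U)) \<le> (\<Sum>x\<leftarrow>?W. length (filt d x r U))"
    by (simp add: sum_list_triv length_words)
  also have "\<dots> = (\<Sum>x\<leftarrow>?W. \<Sum>u\<leftarrow>U. of_bool (\<not> wdist d x u \<le> r))"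
    by (simp add: filt_eq sum_list_of_bool)
  also have "\<dots> = (\<Sum>u\<leftarrow>U. \<Sum>x\<leftarrow>?W. of_bool (\<not> wdist d x u \<le> r))"
    by (rule sum_list_swap)
  also have "\<dots> = (\<Sum>u\<leftarrow>U. d ^ m - ball_size d m r)"
  proof (rule arg_cong[where f = sum_list], rule map_cong[OF HOL.refl])
    fix u assume "u \<in> set U"
    then have "u \<in> words_over d m" using assms by auto
    from ball_size[OF this, of r] sum_length_filter_compl[of "\<lambda>x. wdist d x u \<le> r" ?W]
    show "(\<Sum>x\<leftarrow>?W. of_bool (\<not> wdist d x u \<le> r)) = d ^ m - ball_size d m r"
      by (simp add: sum_list_of_bool length_words)
  qed
  finally show ?thesis by (simp add: sum_list_triv mult.commute)
qed

lemma le_mult_of_le_diff_mult: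
  fixes N V a b :: real
  assumes "N * a \<le> (N - V) * b" "1 \<le> N"
  shows "a \<le> (1 - V / N) * b"
proof -
  have "a \<le> (N - V) * b / N" using assms by (simp add: pos_le_divide_eq mult.commute)
  then show ?thesis using assms(2) by (simp add: field_simps)
qed

text \<open>With \<open>N\<close> words and balls of size \<open>V\<close>, at most
  \<open>N * (1 - V / N) ^ t\<close> words are uncovered after \<open>t\<close> rounds. A round adds
  a code word only while some word is uncovered, and then \<open>t\<close> is at most
  \<open>N / V * ln N\<close>. The integral bound \<open>d ^ m - t\<close> ensures that nothing is
  left after \<open>d ^ m\<close> rounds.\<close>

lemma greedy_state:
  fixes d m r t :: nat
  defines "p \<equiv> (gstep d (words d m) r ^^ t) ([], words d m)"
  assumes "1 \<le> d"
  shows "set (fst p) \<subseteq> words_over d m \<and> set (snd p) \<subseteq> words_over d m \<and>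
    (\<forall>u\<in>words_over d m. u \<in> set (snd p) \<or> (\<exists>c\<in>set (fst p). wdist d c u \<le> r)) \<and>
    length (snd p) \<le> d ^ m - t \<and> real (length (snd p)) \<le> real (d ^ m) * (1 - real (ball_size d m r) / real (d ^ m)) ^ t \<and>
    length (fst p) \<le> t \<and> real (length (fst p)) \<le> real (d ^ m) / real (ball_size d m r) * ln (real (d ^ m)) + 1"
proof -
  have W: "words d m \<noteq> []" using length_words[of d m] assms(2) by auto
  let ?N = "real (d ^ m)" and ?V = "real (ball_size d m r)"
  have N: "?N \<ge> 1" using assms(2) by simp
  have V: "?V \<ge> 1" using ball_size_pos[OF assms(2), of m r] by linarith
  have VN: "?V \<le> ?N" using ball_size_le[OF assms(2), of m r] by linarith
  have l0: "0 \<le> ln ?N" using N by simp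
  show ?thesis
    unfolding p_def
  proof (induction t)
    case 0
    then show ?case using l0 V N by (simp add: set_words length_words)
  next
    case (Suc t)
    let ?p = "(gstep d (words d m) r ^^ t) ([], words d m)"
    let ?q = "pick d (words d m) r (snd ?p)"
    show ?case
    proof (cases "snd ?p = []")
      case True
      then have "gstep d (words d m) r ?p = ?p" by (simp add: gstep_def)
      then show ?thesis using Suc True VN N V by (simp add: divide_le_eq)
    next
      case False
      have g: "gstep d (words d m) r ?p = (fst ?q # fst ?p, snd ?q)"
        using False by (simp add: gstep_def)
      have U: "set (snd ?p) \<subseteq> words_over d m" using Suc by blast
      have q: "fst ?q \<in> words_over d m" "snd ?q = filt d (fst ?q) r (snd ?p)"
        using pick_props(1,2)[OF W] by (auto simp: set_words)
      obtain x where x: "x \<in> set (snd ?p)" using False by (cases "snd ?p") auto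
      have "length (snd ?q) \<le> length (filt d x r (snd ?p))"
        using x U by (intro pick_props(3)[OF W]) (auto simp: set_words)
      also have "\<dots> < length (snd ?p)"
        using x length_filter_less[of x "snd ?p"] by (auto simp: filt_eq)
      finally have lt: "length (snd ?q) < length (snd ?p)" .
      have "real (d ^ m * length (snd ?q)) \<le> real ((d ^ m - ball_size d m r) * length (snd ?p))"
        using pick_shrinks[OF U assms(2), of r] by (rule of_nat_mono)
      then have "?N * real (length (snd ?q)) \<le> (?N - ?V) * real (length (snd ?p))"
        using VN by (simp add: of_nat_diff)
      then have "real (length (snd ?q)) \<le> (1 - ?V / ?N) * real (length (snd ?p))"
        using N by (intro le_mult_of_le_diff_mult) auto
      also have "\<dots> \<le> (1 - ?V / ?N) * (?N * (1 - ?V / ?N) ^ t)"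
        using Suc VN N by (intro mult_left_mono) (auto simp: divide_le_eq)
      finally have shrink: "real (length (snd ?q)) \<le> ?N * (1 - ?V / ?N) ^ Suc t" by (simp add: mult_ac)
      \<comment> \<open>An uncovered word is left, so \<open>1 \<le> N * exp (- t * V / N)\<close>;
        taking logarithms bounds \<open>t\<close>.\<close>
      have t: "real t \<le> ?N / ?V * ln ?N"
      proof -
        have "1 - ?V / ?N \<le> exp (- (?V / ?N))" using exp_ge_add_one_self[of "- (?V / ?N)"] by simp
        then have "(1 - ?V / ?N) ^ t \<le> exp (- (?V / ?N)) ^ t"
          using VN N by (intro power_mono) (auto simp: divide_le_eq)
        then have "?N * (1 - ?V / ?N) ^ t \<le> ?N * exp (- (real t * (?V / ?N)))"
          using N by (intro mult_left_mono) (auto simp: exp_of_nat_mult[symmetric])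
        moreover have "1 \<le> real (length (snd ?p))" using False by (cases "snd ?p") auto
        ultimately have "1 \<le> ?N * exp (- (real t * (?V / ?N)))" using Suc by linarith
        then have "exp (real t * (?V / ?N)) \<le> ?N" by (simp add: exp_minus field_simps)
        moreover have "0 < ?N" using N by linarith
        ultimately have "real t * (?V / ?N) \<le> ln ?N" using ln_ge_iff by blast
        moreover have "0 < ?V / ?N" using N V by (intro divide_pos_pos) linarith+
        ultimately have "real t \<le> ln ?N / (?V / ?N)" using pos_le_divide_eq by blast
        then show ?thesis by (simp add: mult.commute)
      qed
      have cov: "\<forall>u\<in>words_over d m. u \<in> set (snd ?q) \<or> (\<exists>c\<in>set (fst ?q # fst ?p). wdist d c u \<le> r)"
        using Suc unfolding q(2) set_filt by auto
      show ?thesis using Suc q(1) cov lt shrink t U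
        unfolding funpow.simps comp_apply g fst_conv snd_conv q(2) set_filt by auto
    qed
  qed
qed

lemma greedy_covers:
  assumes "1 \<le> d"
  shows "set (greedy d (words d m) r) \<subseteq> words_over d m"
    "u \<in> words_over d m \<Longrightarrow> \<exists>c\<in>set (greedy d (words d m) r). wdist d c u \<le> r"
    "length (greedy d (words d m) r) \<le> d ^ m"
    "real (length (greedy d (words d m) r)) \<le> real (d ^ m) / real (ball_size d m r) * ln (real (d ^ m)) + 1"
  using greedy_state[OF assms, where m = m and r = r and t = "length (words d m)"]
  by (auto simp: greedy_def length_words)

lemma greedy_nonempty: "1 \<le> d \<Longrightarrow> 1 \<le> length (greedy d (words d m) r)"
  using greedy_covers(2)[OF _ replicate_words_over, of d m r]
  by (cases "greedy d (words d m) r") auto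

section \<open>Product codes and local search\<close>

lemma starts_words_over: "set K \<subseteq> words_over d m \<Longrightarrow> set (starts K b) \<subseteq> words_over d (m * b)"
proof (induction b)
  case 0
  then show ?case by (auto simp: starts_def words_over_def)
next
  case (Suc b)
  have "set (starts K (Suc b)) = {c @ p | c p. c \<in> set K \<and> p \<in> set (starts K b)}"
    by (simp add: starts_def set_cross)
  then show ?case using Suc by (fastforce simp: words_over_def)
qed

text \<open>Distances add up under concatenation, so each block can be covered separately.\<close>

lemma starts_cover:
  assumes "\<And>u. u \<in> words_over d m \<Longrightarrow> \<exists>c\<in>set K. wdist d c u \<le> r" "set K \<subseteq> words_over d m"
  shows "y \<in> words_over d (m * b) \<Longrightarrow> \<exists>a\<in>set (starts K b). wdist d a y \<le> b * r"
proof (induction b arbitrary: y)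
  case 0
  then show ?case by (simp add: starts_def words_over_def)
next
  case (Suc b)
  let ?u = "take m y" and ?v = "drop m y"
  have u: "?u \<in> words_over d m" and v: "?v \<in> words_over d (m * b)"
    using Suc.prems set_take_subset[of m y] set_drop_subset[of m y] by (auto simp: words_over_def)
  obtain c where c: "c \<in> set K" "wdist d c ?u \<le> r" using assms(1)[OF u] by blast
  obtain a where a: "a \<in> set (starts K b)" "wdist d a ?v \<le> b * r" using Suc.IH[OF v] by blast
  have "length c = length ?u" using c assms(2) u by (auto simp: words_over_def)
  from wdist_append[OF this, of d a ?v] have "wdist d (c @ a) y \<le> Suc b * r"
    using c a by simp
  moreover have "c @ a \<in> set (starts K (Suc b))"
    using c a by (auto simp: starts_def set_cross)
  ultimately show ?case by blast
qed

lemma set_search_round: "set (search_round d F A) = (\<Union>a\<in>set A. set (succs d F a []))"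
proof -
  have "set (fold (succs d F) A B) = (\<Union>a\<in>set A. set (succs d F a [])) \<union> set B" for B
    by (induction A arbitrary: B) (auto simp: succs_eq split: option.splits)
  then show ?thesis by (simp add: search_round_def)
qed

text \<open>A violated constraint has a literal that holds in \<open>y\<close>; its variable differs
  between \<open>a\<close> and \<open>y\<close>, and the branch that increments it comes closer to
  \<open>y\<close>. The disjunction is needed because the search may meet another solution before
  \<open>y\<close>.\<close>

lemma search_round_progress:
  assumes "form_ok s k L F" "y \<in> words_over d L" "\<forall>C\<in>set F. \<not> violates y C"
    and "a \<in> set A" "a \<in> words_over d L" "(\<forall>C\<in>set F. \<not> violates a C) \<or> wdist d a y \<le> Suc t"
  shows "\<exists>a'\<in>set (search_round d F A). (\<forall>C\<in>set F. \<not> violates a' C) \<or> wdist d a' y \<le> t"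
proof (cases "List.find (violates a) F")
  case None
  then have "a \<in> set (search_round d F A)" using assms(4) by (force simp: set_search_round succs_eq)
  moreover have "\<forall>C\<in>set F. \<not> violates a C" using None by (auto simp: find_None_iff)
  ultimately show ?thesis by blast
next
  case (Some C)
  then have C: "C \<in> set F" "violates a C" by (auto simp: find_Some_iff)
  then obtain l where l: "l \<in> set C" "y ! (fst l - 1) \<noteq> snd l"
    using assms(3) by (auto simp: violates_def)
  have "1 \<le> fst l" "fst l \<le> L" using assms(1) C l by (auto simp: form_ok_def lits_ok_def)
  moreover have "a ! (fst l - 1) \<noteq> y ! (fst l - 1)" using C(2) l by (auto simp: violates_def)
  ultimately have "wdist d a y = Suc (wdist d (bump d a (fst l)) y)"
    using assms by (intro wdist_bump) auto
  then have "wdist d (bump d a (fst l)) y \<le> t" using assms(6) C by auto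
  moreover have "bump d a (fst l) \<in> set (search_round d F A)"
    using assms(4) l by (force simp: set_search_round succs_eq Some)
  ultimately show ?thesis by blast
qed

text \<open>When the distance has dropped to 0, the word is \<open>y\<close> itself.\<close>

lemma rounds_find:
  assumes "form_ok s k L F" "1 \<le> k" "y \<in> words_over d L" "\<forall>C\<in>set F. \<not> violates y C"
  shows "set A \<subseteq> words_over d L \<Longrightarrow> a \<in> set A \<Longrightarrow> (\<forall>C\<in>set F. \<not> violates a C) \<or> wdist d a y \<le> t \<Longrightarrow>
    \<exists>a'\<in>set ((search_round d F ^^ t) A). \<forall>C\<in>set F. \<not> violates a' C"
proof (induction t arbitrary: A a)
  case 0
  then have "a \<in> words_over d L" by auto
  then show ?case using 0 wdist_eq_0[of a d y] assms(3,4) by (auto simp: words_over_def)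
next
  case (Suc t)
  then have "a \<in> words_over d L" by auto
  from search_round_progress[OF assms(1,3,4) Suc.prems(2) this Suc.prems(3)]
  obtain a' where a': "a' \<in> set (search_round d F A)" "(\<forall>C\<in>set F. \<not> violates a' C) \<or> wdist d a' y \<le> t" by blast
  have "set (search_round d F A) \<subseteq> words_over d L" using search_round_props(2)[OF assms(1) Suc.prems(1) assms(2)] .
  from Suc.IH[OF this a'] show ?case by (simp add: funpow_swap1)
qed

text \<open>Words may be longer than \<open>n\<close> because the blocks overshoot. The surplus
  entries occur in no constraint, and an assignment is padded with colour 1.\<close>

lemma satisfiable_iff:
  assumes "\<forall>C\<in>set F. set C \<subseteq> {1..n} \<times> {1..d}" "n \<le> L" "1 \<le> d"
  shows "satisfiable d n F \<longleftrightarrow> (\<exists>a\<in>words_over d L. \<forall>C\<in>set F. \<not> violates a C)"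
proof
  assume "satisfiable d n F"
  then obtain g where g: "g \<in> {1..n} \<rightarrow>\<^sub>E {1..d}" "satisfies g F" by (auto simp: satisfiable_def)
  let ?a = "map (\<lambda>i. if i \<le> n then g i else 1) [1..<Suc L]"
  have "?a \<in> words_over d L"
    using g(1) assms(3) by (auto simp: words_over_def PiE_def Pi_def simp del: upt_Suc)
  moreover have "\<not> violates ?a C" if "C \<in> set F" for C
  proof -
    have "\<exists>(i, c)\<in>set C. g i \<noteq> c" using g(2) that by (simp add: satisfies_def)
    then obtain i c where ic: "(i, c) \<in> set C" "g i \<noteq> c" by auto
    have "(i, c) \<in> {1..n} \<times> {1..d}" using assms(1) that ic(1) by blast
    then have "1 \<le> i" "i \<le> n" by auto
    then have "?a ! (i - 1) = g i" using assms(2) by (simp del: upt_Suc)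
    then show ?thesis unfolding violates_def using ic by (metis fst_conv snd_conv)
  qed
  ultimately show "\<exists>a\<in>words_over d L. \<forall>C\<in>set F. \<not> violates a C" by blast
next
  assume "\<exists>a\<in>words_over d L. \<forall>C\<in>set F. \<not> violates a C"
  then obtain a where a: "a \<in> words_over d L" "\<forall>C\<in>set F. \<not> violates a C" by blast
  let ?g = "restrict (\<lambda>i. a ! (i - 1)) {1..n}"
  have "a ! (i - 1) \<in> {1..d}" if "i \<in> {1..n}" for i
  proof -
    have "i - 1 < length a" "set a \<subseteq> {1..d}" using that a(1) assms(2) by (auto simp: words_over_def)
    then show ?thesis using nth_mem by blast
  qed
  then have "?g \<in> {1..n} \<rightarrow>\<^sub>E {1..d}" by auto
  moreover have "satisfies ?g F"
    unfolding satisfies_def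
  proof
    fix C assume C: "C \<in> set F"
    then obtain l where l: "l \<in> set C" "a ! (fst l - 1) \<noteq> snd l" using a(2) by (auto simp: violates_def)
    then have "l \<in> {1..n} \<times> {1..d}" using assms(1) C by blast
    then have "fst l \<in> {1..n}" by (auto simp: mem_Times_iff)
    then show "\<exists>(i, c)\<in>set C. ?g i \<noteq> c" using l by (intro bexI[of _ l]) auto
  qed
  ultimately show "satisfiable d n F" unfolding satisfiable_def by blast
qed

section \<open>Running time\<close>

definition pb :: "(nat \<Rightarrow> nat) \<Rightarrow> bool" where
  "pb f \<longleftrightarrow> (\<exists>c. \<forall>s. f s \<le> (s + 2) ^ c)"

lemma pb_const: "pb (\<lambda>s. c)"
  unfolding pb_def
proof (intro exI allI)
  fix s :: nat
  have "c \<le> 2 ^ c" by (simp add: less_imp_le)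
  also have "\<dots> \<le> (s + 2) ^ c" by (rule power_mono) auto
  finally show "c \<le> (s + 2) ^ c" .
qed

lemma pb_id: "pb (\<lambda>s. s)"
  unfolding pb_def by (intro exI[of _ 1]) simp

text \<open>The base \<open>s + 2\<close> is at least 2, so the exponent absorbs constants and the
  factor 2 of a sum; a single exponent thus describes the whole class.\<close>

lemma pb_add: "pb f \<Longrightarrow> pb g \<Longrightarrow> pb (\<lambda>s. f s + g s)"
proof -
  assume "pb f" "pb g"
  then obtain a b where ab: "\<And>s. f s \<le> (s + 2) ^ a" "\<And>s. g s \<le> (s + 2) ^ b" unfolding pb_def by blast
  have "f s + g s \<le> (s + 2) ^ (a + b + 1)" for s
  proof -
    have "(s + 2) ^ a \<le> (s + 2) ^ (a + b)" "(s + 2) ^ b \<le> (s + 2) ^ (a + b)"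
      by (rule power_increasing; simp)+
    then have "f s + g s \<le> 2 * (s + 2) ^ (a + b)" using ab[of s] by linarith
    also have "\<dots> \<le> (s + 2) * (s + 2) ^ (a + b)" by (intro mult_right_mono) auto
    finally show ?thesis by simp
  qed
  then show ?thesis unfolding pb_def by blast
qed

lemma pb_mult: "pb f \<Longrightarrow> pb g \<Longrightarrow> pb (\<lambda>s. f s * g s)"
  unfolding pb_def by (metis mult_le_mono power_add)

lemma pb_power: "pb f \<Longrightarrow> pb (\<lambda>s. f s ^ n)"
proof (induction n)
  case (Suc n)
  then show ?case using pb_mult by simp
qed (simp add: pb_const)

lemma pb_comp:
  assumes "pb f" "pb g"
  shows "pb (\<lambda>s. f (g s))"
proof -
  from assms(1) obtain a where a: "\<And>s. f s \<le> (s + 2) ^ a" unfolding pb_def by blast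
  have "pb (\<lambda>s. (g s + 2) ^ a)" using assms(2) by (intro pb_power pb_add pb_const)
  then show ?thesis unfolding pb_def by (meson a order_trans)
qed

lemma pb_bounds:
  "pb wdist_B" "pb filt_B" "pb pick_B" "pb greedy_B" "pb clist_B" "pb best_B" "pb radii_B"
  "pb (words_B d)" "pb viol_B" "pb find_B" "pb succs_B"
proof -
  note i = pb_const pb_id pb_add pb_mult
  show 1: "pb wdist_B" unfolding wdist_B_def[abs_def] by (intro i)
  show 2: "pb filt_B" unfolding filt_B_def[abs_def] by (intro i 1)
  show 3: "pb pick_B" unfolding pick_B_def[abs_def] by (intro i 2)
  show 4: "pb greedy_B" unfolding greedy_B_def[abs_def] by (intro i 3)
  show 5: "pb clist_B" unfolding clist_B_def[abs_def] by (intro i)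
  show "pb best_B" unfolding best_B_def[abs_def] by (intro i 4 5)
  show "pb radii_B" unfolding radii_B_def[abs_def] by (intro i)
  show "pb (words_B d)" unfolding words_B_def[abs_def] ext_B_def by (intro i)
  show 6: "pb viol_B" unfolding viol_B_def[abs_def] by (intro i)
  show 7: "pb find_B" unfolding find_B_def[abs_def] by (intro i 6)
  show "pb succs_B" unfolding succs_B_def[abs_def] by (intro i 7)
qed

section \<open>Cost of the complete program\<close>

definition prep_B :: "nat \<Rightarrow> nat \<Rightarrow> nat" where
  "prep_B d s = words_B d s + radii_B s + best_B s"

text \<open>The cost per unit of \<open>X\<close>: the bounds are affine in \<open>X\<close> with
  nonnegative coefficients, so for \<open>1 \<le> X\<close> they are at most \<open>X\<close> times
  their value at 1.\<close>

definition search_B :: "nat \<Rightarrow> nat \<Rightarrow> nat" where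
  "search_B b s = starts_B b s 1 + rounds_B b s 1 + find_B s +
  s * (7 * b + 50) + 7 * b + 200"

lemma starts_B_le:
  assumes "1 \<le> X"
  shows "starts_B b s X \<le> X * starts_B b s 1"
proof -
  have "starts_B b s Y = Y * (b * (28 * s + 45)) + (27 * b + 20)" for Y
    by (simp add: starts_B_def algebra_simps)
  moreover have "27 * b + 20 \<le> X * (27 * b + 20)" using assms by simp
  ultimately show ?thesis by (simp only: distrib_left mult_1 add_left_mono)
qed

lemma rounds_B_le:
  assumes "1 \<le> X"
  shows "rounds_B b s X \<le> X * rounds_B b s 1"
proof -
  have "rounds_B b s Y = Y * (b * (s * (succs_B s + 20))) + (b * (s * 40) + 47 * b + 20)" for Y
    by (simp add: rounds_B_def algebra_simps)
  moreover have "b * (s * 40) + 47 * b + 20 \<le> X * (b * (s * 40) + 47 * b + 20)" using assms by simp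
  ultimately show ?thesis by (simp only: distrib_left mult_1 add_left_mono)
qed

text \<open>The cost splits into a preparation, polynomial in \<open>(d * k ^ d) ^ m\<close>, and a
  search, linear in \<open>X\<close> with a factor polynomial in \<open>s\<close>.\<close>

lemma main_e:
  fixes d k b n :: nat and F :: formula
  defines "m \<equiv> n div b + 1"
  defines "W \<equiv> words d m"
  defines "r \<equiv> best d k W (rev [0..<Suc (d * m)])"
  defines "X \<equiv> weight d k W r ^ b"
  assumes "1 \<le> d" "2 \<le> k" "1 \<le> b"
    and F: "\<forall>C\<in>set F. length C \<le> k \<and> set C \<subseteq> {1..n} \<times> {1..d}"
    and s: "length F \<le> s" "k \<le> s" "m * b \<le> s" "d * m \<le> s"
  shows "eval (main_e d k b) [un n, enc_formula F] \<noteq> Lf \<longleftrightarrow> satisfiable d n F"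
    "cost (main_e d k b) [un n, enc_formula F] \<le> prep_B d ((d * k ^ d) ^ m) + X * search_B b s"
    "1 \<le> X"
proof -
  \<comment> \<open>There are \<open>d ^ m\<close> words, and a code of radius at most
    \<open>d * m\<close> has weight at most \<open>k ^ (d * m) * d ^ m\<close>, which is this
    number. It also bounds the number of radii.\<close>
  let ?s = "(d * k ^ d) ^ m"
  let ?K = "greedy d W r"
  let ?L = "m * b"
  have m: "1 \<le> m" by (simp add: m_def)
  have kd: "1 \<le> k ^ i" for i using assms(6) by simp
  have Q: "?s = d ^ m * k ^ (d * m)" by (simp add: power_mult_distrib power_mult)
  have "k ^ (d * m) \<le> d ^ m * k ^ (d * m)" using assms(5) by simp
  then have k1: "k ^ (d * m) \<le> ?s" by (simp only: Q)
  have s1: "d ^ m \<le> ?s" unfolding Q using kd[of "d * m"] by simp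
  have "Suc (d * m) \<le> 2 ^ (d * m)" by (simp add: Suc_leI)
  also have "\<dots> \<le> k ^ (d * m)" using assms(6) by (intro power_mono) auto
  finally have s2: "Suc (d * m) \<le> ?s" using k1 by linarith
  have s3: "m \<le> ?s" "d \<le> ?s"
    using s2 m assms(5) mult_le_mono1[OF assms(5), of m] mult_le_mono2[OF m, of d] by linarith+
  have "k ^ 1 \<le> k ^ (d * m)" using assms(5,6) m by (intro power_increasing) auto
  then have s4: "k \<le> ?s" using k1 by simp
  have W: "set W \<subseteq> words_over d m" "length W \<le> ?s"
    using s1 by (simp_all add: W_def set_words length_words)
  have wt: "\<forall>r\<in>insert 0 (set (rev [0..<Suc (d * m)])). r \<le> ?s \<and> weight d k W r \<le> ?s"
  proof
    fix r assume "r \<in> insert 0 (set (rev [0..<Suc (d * m)]))"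
    then have r: "r \<le> d * m" by auto
    have "weight d k W r \<le> k ^ (d * m) * d ^ m"
      unfolding weight_def W_def using r assms(5,6) greedy_covers(3)[OF assms(5), of m r]
      by (intro mult_le_mono power_increasing) auto
    then show "r \<le> ?s \<and> weight d k W r \<le> ?s" using r s2 by (simp add: Q mult.commute)
  qed
  have r: "r \<le> d * m" using best_in[of d k W "rev [0..<Suc (d * m)]"] unfolding r_def by auto
  have K: "set ?K \<subseteq> words_over d m" "1 \<le> length ?K"
    "\<And>u. u \<in> words_over d m \<Longrightarrow> \<exists>c\<in>set ?K. wdist d c u \<le> r"
    using greedy_covers(1,2)[OF assms(5)] greedy_nonempty[OF assms(5)] by (simp_all add: W_def)
  \<comment> \<open>Number of starting points of the product code times number of branches from each
    of them.\<close>
  have X: "X = length ?K ^ b * k ^ (b * r)"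
    by (simp add: X_def weight_def power_mult_distrib mult.commute power_mult[symmetric])
  show X1: "1 \<le> X" unfolding X using K(2) assms(6) by simp
  have n: "n \<le> ?L"
  proof -
    have "n mod b < b" using assms(7) by simp
    then show ?thesis unfolding m_def using div_mult_mod_eq[of n b] unfolding distrib_right by linarith
  qed
  have ok: "form_ok s k ?L F"
    unfolding form_ok_def lits_ok_def
  proof (intro conjI ballI)
    fix C l assume C: "C \<in> set F" "l \<in> set C"
    then have "l \<in> {1..n} \<times> {1..d}" using F by blast
    moreover have "d \<le> s" using s(4) m mult_le_mono2[OF m, of d] by linarith
    ultimately show "1 \<le> fst l" "fst l \<le> ?L" "snd l \<le> s" using n by (auto simp: mem_Times_iff)
  qed (use s F in auto)
  have ds: "d \<le> s" "r \<le> s" "m \<le> s" using s(4) m r mult_le_mono2[OF m, of d] mult_le_mono1[OF assms(5), of m]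
    by linarith+
  let ?S = "starts ?K b"
  have S: "set ?S \<subseteq> words_over d ?L" by (rule starts_words_over[OF K(1)])
  have SX: "length ?S * k ^ (b * r) \<le> X" by (simp add: length_starts X)
  have k1': "1 \<le> k" using assms(6) by simp
  let ?A = "(search_round d F ^^ (b * r)) ?S"
  note rounds = rounds_e[OF ok S ds(1) k1' ds(2) SX]
  note sat = sat_e[OF ok rounds(4) ds(1)]
  have KX: "length ?K ^ b \<le> X" unfolding X using assms(6) by simp
  have Km: "\<forall>c\<in>set ?K. length c \<le> s" using K(1) ds(3) by (auto simp: words_over_def)
  note starts = starts_e[OF Km KX K(2)]
  note best = best_e[OF W(1) s3(2,1) W(2) wt k1' s4, folded r_def]
  have lr: "length (rev [0..<Suc (d * m)]) \<le> ?s" using s2 by simp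
  note words = words_e[OF assms(5) s1 s3(1), folded W_def]
  have dms: "d * m \<le> ?s" using s2 by simp
  note radii = radii_e(1)[of d m] radii_e(2)[OF s3(2) s3(1) dms]
  note blocks = blocks_e[OF assms(7), of n, folded m_def]
  note best = best[OF lr]
  have e: "eval (main_e d k b) [un n, enc_formula F] = eval sat_e [enc_formula F, enc_words ?A]"
    by (simp add: main_e_def main2_e_def main3_e_def main4_e_def blocks words radii best starts rounds del: upt_Suc)
  have "eval (main_e d k b) [un n, enc_formula F] \<noteq> Lf \<longleftrightarrow> (\<exists>a\<in>set ?A. \<forall>C\<in>set F. \<not> violates a C)"
    unfolding e by (rule sat)
  also have "\<dots> \<longleftrightarrow> (\<exists>a\<in>words_over d ?L. \<forall>C\<in>set F. \<not> violates a C)"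
  proof
    assume "\<exists>a\<in>set ?A. \<forall>C\<in>set F. \<not> violates a C"
    then show "\<exists>a\<in>words_over d ?L. \<forall>C\<in>set F. \<not> violates a C" using rounds(4) by blast
  next
    assume "\<exists>a\<in>words_over d ?L. \<forall>C\<in>set F. \<not> violates a C"
    then obtain y where y: "y \<in> words_over d ?L" "\<forall>C\<in>set F. \<not> violates y C" by blast
    from starts_cover[OF K(3) K(1) y(1)] obtain a where "a \<in> set ?S" "wdist d a y \<le> b * r" by blast
    then show "\<exists>a\<in>set ?A. \<forall>C\<in>set F. \<not> violates a C"
      using rounds_find[OF ok k1' y S] by blast
  qed
  also have "\<dots> \<longleftrightarrow> satisfiable d n F"
    using F n assms(5) by (subst satisfiable_iff[of F n d ?L]) auto
  finally show "eval (main_e d k b) [un n, enc_formula F] \<noteq> Lf \<longleftrightarrow> satisfiable d n F" .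
  have fA: "length ?A * (find_B s + 30) \<le> X * (find_B s + 30)" using rounds(3) by (rule mult_le_mono1)
  have ns: "n * (7 * b + 50) \<le> s * (7 * b + 50)" using n s(3) by (intro mult_le_mono1) linarith
  have "cost (main_e d k b) [un n, enc_formula F] \<le> cost (blocks_e b) [un n] + cost (words_e d) [un m] +
      cost (radii_e d) [un m] + cost (best_e d k) [enc_words W, enc_list (map un (rev [0..<Suc (d * m)]))] +
      cost (starts_e b) [enc_words ?K] + cost (rounds_e d b) [enc_formula F, un r, enc_words ?S] +
      cost sat_e [enc_formula F, enc_words ?A] + 60"
    by (simp add: main_e_def main2_e_def main3_e_def main4_e_def blocks(1) words(1) radii(1) best(1) starts(1)
      rounds(1) del: upt_Suc)
  then have "cost (main_e d k b) [un n, enc_formula F] \<le> prep_B d ?s + starts_B b s X + rounds_B b s X +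
      X * (find_B s + 30) + s * (7 * b + 50) + 7 * b + 120"
    using blocks(2) words(2) radii(2) best(2) starts(2) rounds(2) sat(2) fA ns unfolding prep_B_def by linarith
  also have "\<dots> \<le> prep_B d ?s + X * starts_B b s 1 + X * rounds_B b s 1 +
      X * (find_B s + 30) + X * (s * (7 * b + 50) + 7 * b + 120)"
  proof -
    have "s * (7 * b + 50) + 7 * b + 120 \<le> X * (s * (7 * b + 50) + 7 * b + 120)" using X1 by simp
    then show ?thesis using starts_B_le[OF X1, of b s] rounds_B_le[OF X1, of b s] by linarith
  qed
  also have "\<dots> \<le> prep_B d ?s + X * search_B b s"
    by (simp add: search_B_def algebra_simps)
  finally show "cost (main_e d k b) [un n, enc_formula F] \<le> prep_B d ?s + X * search_B b s" .
qed

section \<open>Size of the input\<close>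

lemma sum_list_le: "(\<And>x. x \<in> set xs \<Longrightarrow> f x \<le> B) \<Longrightarrow> (\<Sum>x\<leftarrow>xs. f x) \<le> length xs * (B :: nat)"
  by (induction xs) (auto intro: add_mono)

lemma formula_cost_le:
  assumes "length F \<le> s" "\<forall>C\<in>set F. length C \<le> s \<and> (\<forall>l\<in>set C. fst l \<le> s \<and> snd l \<le> s)"
  shows "formula_cost F \<le> s * (s * (18 * s + 25) + 13)"
proof -
  have "con_cost C + 13 \<le> s * (18 * s + 25) + 13" if "C \<in> set F" for C
  proof -
    have "con_cost C \<le> length C * (18 * s + 25)"
      unfolding con_cost_def using assms(2) that by (intro sum_list_le) fastforce
    also have "\<dots> \<le> s * (18 * s + 25)" using assms(2) that by (intro mult_le_mono1) blast
    finally show ?thesis by simp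
  qed
  then have "formula_cost F \<le> length F * (s * (18 * s + 25) + 13)"
    unfolding formula_cost_def by (intro sum_list_le)
  also have "\<dots> \<le> s * (s * (18 * s + 25) + 13)" using assms(1) by (rule mult_le_mono1)
  finally show ?thesis .
qed

text \<open>The constraints are distinct lists of length at most \<open>k\<close> over
  \<open>n * d\<close> literals, so their number is bounded by a polynomial in
  \<open>n\<close>.\<close>

lemma length_csp_formula:
  assumes "csp_formula d k n F"
  shows "length F \<le> (k + 1) * (n * d + 1) ^ k"
proof -
  let ?A = "{1..n} \<times> {1..d}"
  have F: "set F \<subseteq> {C. set C \<subseteq> ?A \<and> length C \<le> k}" "distinct F"
    using assms unfolding csp_formula_def by blast+
  have "finite {C. set C \<subseteq> ?A \<and> length C \<le> k}" by (rule finite_lists_length_le) simp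
  from card_mono[OF this F(1)] have "length F \<le> card {C. set C \<subseteq> ?A \<and> length C \<le> k}"
    by (simp only: distinct_card[OF F(2)])
  also have "\<dots> = (\<Sum>i\<le>k. (n * d) ^ i)"
    by (subst card_lists_length_le) (simp_all add: card_cartesian_product)
  also have "\<dots> \<le> (\<Sum>i\<le>k. (n * d + 1) ^ k)"
  proof (rule sum_mono)
    fix i assume "i \<in> {..k}"
    have "(n * d) ^ i \<le> (n * d + 1) ^ i" by (rule power_mono) auto
    also have "\<dots> \<le> (n * d + 1) ^ k" using \<open>i \<in> {..k}\<close> by (intro power_increasing) auto
    finally show "(n * d) ^ i \<le> (n * d + 1) ^ k" .
  qed
  finally show ?thesis by simp
qed

lemma num_size_le_log: "1 \<le> v \<Longrightarrow> real (num_size v) \<le> log 2 (real v) + 1"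
proof -
  assume v: "1 \<le> v"
  then have "0 \<le> log 2 (real v)" by simp
  then show ?thesis using v by (simp add: num_size_def floorlog_def)
qed

section \<open>The base of the exponential bound\<close>

definition growth :: "nat \<Rightarrow> nat \<Rightarrow> real" where
  "growth d k = real d * (real k - 1) / real k * (real k ^ d / (real k ^ d - 1))"

text \<open>Summing the geometric series links the closed form in the theorem to the generating
  function at \<open>1 / k\<close>.\<close>

lemma growth_eq:
  assumes "1 \<le> d" "2 \<le> k"
  shows "growth d k = real d / (\<Sum>j<d. (1 / real k) ^ j)"
proof -
  have k: "real k > 1" "1 < real k ^ d" using assms by (auto intro: one_less_power)
  have "(\<Sum>j<d. (1 / real k) ^ j) = (1 - (1 / real k) ^ d) / (1 - 1 / real k)"
    using k by (simp add: sum_gp_strict)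
  also have "\<dots> = ((real k ^ d - 1) / real k ^ d) / ((real k - 1) / real k)"
    using k by (simp add: field_simps)
  finally have S: "(\<Sum>j<d. (1 / real k) ^ j) = ((real k ^ d - 1) / real k ^ d) / ((real k - 1) / real k)" .
  show ?thesis unfolding growth_def S using k by (simp add: divide_simps)
qed

text \<open>All \<open>d\<close> summands are at most 1 and the one for \<open>j = 1\<close> is
  smaller. A base above 1 is what later allows the number of blocks to make the preparation
  affordable.\<close>

lemma growth_gt_1:
  assumes "2 \<le> d" "2 \<le> k"
  shows "1 < growth d k"
proof -
  let ?G = "\<Sum>j<d. (1 / real k) ^ j"
  have "?G < (\<Sum>j<d. 1)"
  proof (rule sum_strict_mono_ex1)
    show "\<forall>j\<in>{..<d}. (1 / real k) ^ j \<le> 1" using assms by (auto intro!: power_le_one)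
    show "\<exists>j\<in>{..<d}. (1 / real k) ^ j < 1" using assms by (intro bexI[of _ 1]) auto
  qed simp
  moreover have "0 < ?G" using assms by (intro sum_pos) (auto simp: lessThan_empty_iff)
  ultimately show ?thesis using growth_eq[of d k] assms by simp
qed

text \<open>For a good radius, \<open>k ^ r\<close> is at most
  \<open>(d * m + 1) * V / G ^ m\<close> and the code has at most \<open>N / V * ln N + 1\<close>
  words; the ball size \<open>V\<close> cancels in the product. One factor \<open>d * m + 1\<close>
  comes from the pigeonhole principle, the other from the logarithm.\<close>

lemma weight_best:
  assumes "1 \<le> d" "2 \<le> k"
  shows "real (weight d k (words d m) (best d k (words d m) (rev [0..<Suc (d * m)])))
    \<le> real (d * m + 1) ^ 2 * growth d k ^ m"
proof -
  let ?W = "words d m" and ?rs = "rev [0..<Suc (d * m)]"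
  let ?G = "(\<Sum>j<d. (1 / real k) ^ j)"
  let ?N = "real (d ^ m)"
  have k: "0 < 1 / real k" using assms by simp
  obtain r where r: "r \<le> d * m" "?G ^ m \<le> real (d * m + 1) * ((1 / real k) ^ r * real (ball_size d m r))"
    using good_radius[OF k assms(1)] by blast
  let ?V = "real (ball_size d m r)"
  have G: "0 < ?G" using assms by (intro sum_pos) (auto simp: lessThan_empty_iff)
  have V: "1 \<le> ?V" "?V \<le> ?N"
    using ball_size_pos[OF assms(1), of m r] ball_size_le[OF assms(1), of m r] by linarith+
  have N: "1 \<le> ?N" using V by linarith
  have kr: "real k ^ r \<le> real (d * m + 1) * ?V / ?G ^ m"
  proof -
    have "?G ^ m * real k ^ r \<le> real (d * m + 1) * ((1 / real k) ^ r * ?V) * real k ^ r"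
      using r(2) by (rule mult_right_mono) simp
    also have "\<dots> = real (d * m + 1) * ?V" using assms by (simp add: power_one_over)
    finally show ?thesis using G by (subst pos_le_divide_eq) (auto simp: mult.commute)
  qed
  have lnN: "ln ?N \<le> real (d * m)"
  proof -
    have "ln ?N = real m * ln (real d)" using assms by (simp add: ln_realpow)
    also have "\<dots> \<le> real m * real d" using assms ln_le_minus_one[of "real d"] by (intro mult_left_mono) auto
    finally show ?thesis by (simp add: mult.commute)
  qed
  have ln0: "0 \<le> ln ?N" using N by simp
  have "weight d k ?W (best d k ?W ?rs) \<le> weight d k ?W r"
    using r(1) by (intro weight_best_le) auto
  then have "real (weight d k ?W (best d k ?W ?rs)) \<le> real (weight d k ?W r)" by (rule of_nat_mono)
  also have "\<dots> = real k ^ r * real (length (greedy d ?W r))" by (simp add: weight_def)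
  also have "\<dots> \<le> (real (d * m + 1) * ?V / ?G ^ m) * (?N / ?V * ln ?N + 1)"
    using kr greedy_covers(4)[OF assms(1), of m r] G by (intro mult_mono) auto
  also have "\<dots> = real (d * m + 1) / ?G ^ m * (?N * ln ?N + ?V)"
  proof -
    have "?V * (?N / ?V * ln ?N + 1) = ?N * ln ?N + ?V" using V by (simp add: distrib_left)
    then show ?thesis by (simp only: times_divide_eq_left times_divide_eq_right mult.assoc)
  qed
  also have "\<dots> \<le> real (d * m + 1) / ?G ^ m * (?N * (real (d * m) + 1))"
  proof (rule mult_left_mono)
    have "?N * ln ?N \<le> ?N * real (d * m)" using lnN N by (intro mult_left_mono) auto
    then show "?N * ln ?N + ?V \<le> ?N * (real (d * m) + 1)" using V unfolding distrib_left by linarith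
  qed (use G in simp)
  also have "\<dots> = real (d * m + 1) ^ 2 * growth d k ^ m"
  proof -
    have "a / g * (x * a) = a ^ 2 * (x / g)" for a g x :: real by (simp add: power2_eq_square)
    moreover have "real (d * m) + 1 = real (d * m + 1)" by simp
    ultimately show ?thesis unfolding growth_eq[OF assms] by (simp only: power_divide[of "real d" ?G m] of_nat_power)
  qed
  finally show ?thesis .
qed

section \<open>Assembly of the bound\<close>

lemma satisfiable_rev: "satisfiable d n (rev (map rev F)) \<longleftrightarrow> satisfiable d n F"
  by (simp add: satisfiable_def satisfies_def)

lemma pb_real: "pb f \<Longrightarrow> \<exists>c. \<forall>s. real (f s) \<le> (real s + 2) ^ c"
  unfolding pb_def by (metis of_nat_add of_nat_le_iff of_nat_numeral of_nat_power)

text \<open>The exponent \<open>c\<close> of the preparation does not depend on the number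
  \<open>b\<close> of blocks, so \<open>b\<close> can be chosen after it.\<close>

lemma total_steps_bound:
  fixes d k :: nat
  assumes "2 \<le> d" "2 \<le> k"
  obtains b A g where "1 \<le> A" "\<And>n F. csp_formula d k n F \<Longrightarrow>
      (eval (main_e d k b) [un n, enc_formula (rev (map rev F))] \<noteq> Lf \<longleftrightarrow> satisfiable d n F) \<and>
      real (total_steps (main_e d k b) n F) \<le> A * growth d k ^ n * (real n + 2) ^ g"
proof -
  let ?\<beta> = "growth d k"
  let ?Q = "d * k ^ d"
  have \<beta>: "1 < ?\<beta>" using growth_gt_1[OF assms] .
  have Q: "1 \<le> ?Q" using assms by simp
  have "pb (prep_B d)" unfolding prep_B_def[abs_def] by (intro pb_add pb_bounds)
  then obtain c where c: "\<And>s. prep_B d s \<le> (s + 2) ^ c" unfolding pb_def by blast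
  \<comment> \<open>As \<open>m\<close> is about \<open>n / b\<close>, the preparation costs about
    \<open>(?Q ^ c) ^ (n / b)\<close>, which this choice keeps below
    \<open>growth d k ^ n\<close>.\<close>
  obtain b where b: "real ?Q ^ c < ?\<beta> ^ b" using real_arch_pow[OF \<beta>] by blast
  have b1: "1 \<le> b"
  proof (rule ccontr)
    assume "\<not> 1 \<le> b"
    then have "b = 0" by simp
    then have "real ?Q ^ c < 1" using b by (simp only: power_0)
    moreover have "1 \<le> real ?Q ^ c" using Q by (intro one_le_power) linarith
    ultimately show False by linarith
  qed
  \<comment> \<open>The summands serve the hypotheses of \<open>main_e\<close> in turn: number of
    constraints, \<open>k\<close>, padded length, largest radius.\<close>
  define s where "s n = (k + 1) * (n * d + 1) ^ k + k + (n + b) + d * (n + 1)" for n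
  define R where "R s = search_B b s + (9 * s + s * (s * (18 * s + 25) + 13) + 14)" for s
  have pbs: "pb s" unfolding s_def[abs_def]
    by (intro pb_add pb_mult pb_power pb_const pb_id)
  have "pb R" unfolding R_def[abs_def] search_B_def starts_B_def rounds_B_def
    by (intro pb_add pb_mult pb_const pb_id pb_bounds)
  then have "pb (\<lambda>n. R (s n))" using pbs by (rule pb_comp)
  from pb_real[OF this] obtain e where e: "\<And>n. real (R (s n)) \<le> (real n + 2) ^ e" by blast
  have "pb (\<lambda>n. (d * (n + 1) + 1) ^ (2 * b))" by (intro pb_power pb_add pb_mult pb_const pb_id)
  from pb_real[OF this] obtain f where f: "\<And>n. real ((d * (n + 1) + 1) ^ (2 * b)) \<le> (real n + 2) ^ f" by blast
  \<comment> \<open>The first summand pays for the \<open>+ 1\<close> in the block length during the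
    preparation, the second for the padding of the words, whose length is at most
    \<open>n + b\<close>.\<close>
  define A where "A = 3 ^ c * real ?Q ^ c + ?\<beta> ^ b"
  have A1: "1 \<le> A"
  proof -
    have "1 \<le> ?\<beta> ^ b" using \<beta> by (intro one_le_power) simp
    then show ?thesis unfolding A_def by (simp add: add_increasing)
  qed
  show ?thesis
  proof (rule that[of A b "f + e"])
    show "1 \<le> A" by (rule A1)
    fix n F assume csp: "csp_formula d k n F"
    let ?G = "rev (map rev F)"
    let ?m = "n div b + 1"
    define X where "X = weight d k (words d ?m) (best d k (words d ?m) (rev [0..<Suc (d * ?m)])) ^ b"
    have FC: "\<forall>C\<in>set F. length C \<le> k \<and> set C \<subseteq> {1..n} \<times> {1..d}"
      using csp by (auto simp: csp_formula_def)
    then have GC: "\<forall>C\<in>set ?G. length C \<le> k \<and> set C \<subseteq> {1..n} \<times> {1..d}" by auto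
    have lF: "length F \<le> s n" using length_csp_formula[OF csp] unfolding s_def by linarith
    then have lG: "length ?G \<le> s n" by simp
    have ks: "k \<le> s n" unfolding s_def by linarith
    have mb: "?m * b \<le> n + b" using div_times_less_eq_dividend[of n b] unfolding distrib_right by linarith
    then have mbs: "?m * b \<le> s n" unfolding s_def by linarith
    have mn: "?m \<le> n + 1" by (simp add: div_le_dividend)
    then have dm: "d * ?m \<le> d * (n + 1)" by (rule mult_le_mono2)
    then have dms: "d * ?m \<le> s n" unfolding s_def by linarith
    have "1 \<le> d" using assms by simp
    note main = main_e[OF this assms(2) b1 GC lG ks mbs dms, folded X_def]
    have ns: "n \<le> s n" unfolding s_def by linarith
    have "d * 1 \<le> d * (n + 1)" by (rule mult_le_mono2) simp
    then have ds: "d \<le> s n" unfolding s_def by linarith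
    have fc: "formula_cost F \<le> s n * (s n * (18 * s n + 25) + 13)"
    proof (rule formula_cost_le[OF lF], intro ballI conjI)
      fix C l assume C: "C \<in> set F"
      then show "length C \<le> s n" using FC ks by (meson order_trans)
      assume "l \<in> set C"
      then have "l \<in> {1..n} \<times> {1..d}" using FC C by blast
      then show "fst l \<le> s n" "snd l \<le> s n" using ns ds by (auto simp: mem_Times_iff)
    qed
    have "total_steps (main_e d k b) n F \<le> prep_B d (?Q ^ ?m) + X * R (s n)"
    proof -
      let ?y = "9 * s n + s n * (s n * (18 * s n + 25) + 13) + 14"
      have "?y \<le> X * ?y" using main(3) by simp
      then show ?thesis using main(2) fc ns unfolding total_steps_def R_def distrib_left[of X] by linarith
    qed
    from of_nat_mono[OF this]
    have "real (total_steps (main_e d k b) n F) \<le> real (prep_B d (?Q ^ ?m)) + real X * real (R (s n))"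
      by (simp only: of_nat_add of_nat_mult)
    also have "\<dots> \<le> 3 ^ c * real ?Q ^ c * ?\<beta> ^ n + (real n + 2) ^ f * ?\<beta> ^ b * ?\<beta> ^ n * (real n + 2) ^ e"
    proof (rule add_mono)
      \<comment> \<open>The factor 3 absorbs the \<open>+ 2\<close> of the polynomial bound, because
        \<open>?Q ^ ?m\<close> is at least 1.\<close>
      have "prep_B d (?Q ^ ?m) \<le> (3 * ?Q ^ ?m) ^ c"
        using one_le_power[OF Q, of ?m] by (intro order_trans[OF c] power_mono) auto
      also have "\<dots> = 3 ^ c * (?Q ^ c) ^ ?m" 
        unfolding power_mult_distrib[of 3 "?Q ^ ?m" c] power_mult[symmetric] mult.commute[of ?m c] ..
      finally have "prep_B d (?Q ^ ?m) \<le> 3 ^ c * (?Q ^ c) ^ ?m" .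
      from of_nat_mono[OF this] have "real (prep_B d (?Q ^ ?m)) \<le> 3 ^ c * (real ?Q ^ c) ^ ?m"
        by (simp only: of_nat_mult of_nat_power of_nat_numeral)
      also have "\<dots> = 3 ^ c * real ?Q ^ c * (real ?Q ^ c) ^ (n div b)" by simp
      also have "\<dots> \<le> 3 ^ c * real ?Q ^ c * ?\<beta> ^ n"
      proof (rule mult_left_mono)
        have "(real ?Q ^ c) ^ (n div b) \<le> (?\<beta> ^ b) ^ (n div b)" using b by (intro power_mono) auto
        also have "\<dots> = ?\<beta> ^ (b * (n div b))" by (simp add: power_mult)
        also have "\<dots> \<le> ?\<beta> ^ n" using \<beta> by (intro power_increasing) auto
        finally show "(real ?Q ^ c) ^ (n div b) \<le> ?\<beta> ^ n" .
      qed simp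
      finally show "real (prep_B d (?Q ^ ?m)) \<le> 3 ^ c * real ?Q ^ c * ?\<beta> ^ n" .
    next
      have "real X \<le> (real (d * ?m + 1) ^ 2 * ?\<beta> ^ ?m) ^ b"
        unfolding X_def of_nat_power using assms by (intro power_mono weight_best) auto
      also have "\<dots> = real ((d * ?m + 1) ^ (2 * b)) * ?\<beta> ^ (?m * b)"
        by (simp only: power_mult_distrib power_mult[symmetric] of_nat_power)
      also have "\<dots> \<le> (real n + 2) ^ f * ?\<beta> ^ (n + b)"
      proof (rule mult_mono)
        have "(d * ?m + 1) ^ (2 * b) \<le> (d * (n + 1) + 1) ^ (2 * b)" using dm by (intro power_mono) auto
        then have "real ((d * ?m + 1) ^ (2 * b)) \<le> real ((d * (n + 1) + 1) ^ (2 * b))" by (rule of_nat_mono)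
        then show "real ((d * ?m + 1) ^ (2 * b)) \<le> (real n + 2) ^ f" using f[of n] by linarith
        show "?\<beta> ^ (?m * b) \<le> ?\<beta> ^ (n + b)" using \<beta> mb by (intro power_increasing) auto
      qed (use \<beta> in auto)
      finally have "real X \<le> (real n + 2) ^ f * ?\<beta> ^ b * ?\<beta> ^ n" by (simp add: power_add mult_ac)
      then show "real X * real (R (s n)) \<le> (real n + 2) ^ f * ?\<beta> ^ b * ?\<beta> ^ n * (real n + 2) ^ e"
        using e[of n] \<beta> by (intro mult_mono) auto
    qed
    also have "\<dots> \<le> A * ?\<beta> ^ n * (real n + 2) ^ (f + e)"
    proof -
      have "1 \<le> (real n + 2) ^ (f + e)" by (intro one_le_power) simp
      then have "3 ^ c * real ?Q ^ c * ?\<beta> ^ n * 1 \<le> 3 ^ c * real ?Q ^ c * ?\<beta> ^ n * (real n + 2) ^ (f + e)"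
        using \<beta> by (intro mult_left_mono) auto
      then show ?thesis by (simp add: A_def algebra_simps power_add)
    qed
    finally have "real (total_steps (main_e d k b) n F) \<le> A * ?\<beta> ^ n * (real n + 2) ^ (f + e)" .
    then show "(eval (main_e d k b) [un n, enc_formula ?G] \<noteq> Lf \<longleftrightarrow> satisfiable d n F) \<and>
      real (total_steps (main_e d k b) n F) \<le> A * ?\<beta> ^ n * (real n + 2) ^ (f + e)"
      using main(1) satisfiable_rev by blast
  qed
qed

text \<open>The logarithm of an exponential number of steps is linear in \<open>n\<close>, so the
  logarithmic cost of an instruction contributes a linear factor. The summand \<open>h n\<close>
  stands for the constants of the program and the numbers in the input.\<close>

lemma log_cost_le:
  fixes \<beta> A :: real
  assumes "1 < \<beta>" "1 \<le> A" "pb h"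
  obtains D where "0 \<le> D" "\<And>n S. real S \<le> A * \<beta> ^ n * (real n + 2) ^ g \<Longrightarrow>
    real (num_size (h n + S)) \<le> D * (real n + 2)"
proof -
  obtain e where e: "\<And>n. real (h n) \<le> (real n + 2) ^ e" using pb_real[OF assms(3)] by blast
  define D where "D = log 2 (A + 1) + log 2 \<beta> + real (g + e) + 1"
  have l: "0 \<le> log 2 (A + 1)" "0 \<le> log 2 \<beta>" using assms by auto
  show ?thesis
  proof (rule that[of D])
    show "0 \<le> D" using l by (simp add: D_def)
    fix n S assume S: "real S \<le> A * \<beta> ^ n * (real n + 2) ^ g"
    let ?x = "real n + 2"
    have lx: "log 2 ?x \<le> ?x"
    proof -
      have "n + 2 \<le> 2 ^ (n + 2)" by (simp only: less_exp less_imp_le)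
      then have "log 2 (real (n + 2)) \<le> real (n + 2)" by (rule log2_of_power_le) simp
      then show ?thesis by (simp add: add.commute)
    qed
    show "real (num_size (h n + S)) \<le> D * ?x"
    proof (cases "h n + S = 0")
      case True
      have "1 \<le> D" using l by (simp add: D_def)
      then have "1 * 1 \<le> D * ?x" by (intro mult_mono) auto
      then show ?thesis using True by (simp add: num_size_def floorlog_def)
    next
      case False
      have p: "1 \<le> \<beta> ^ n" "1 \<le> ?x ^ g" "1 \<le> ?x ^ e" using assms by (auto intro!: one_le_power)
      have "?x ^ e * 1 \<le> ?x ^ e * (\<beta> ^ n * ?x ^ g)"
        using p mult_mono[OF p(1,2)] by (intro mult_left_mono) auto
      moreover have "A * \<beta> ^ n * ?x ^ g * 1 \<le> A * \<beta> ^ n * ?x ^ g * ?x ^ e"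
        using p assms by (intro mult_left_mono) auto
      ultimately have "real (h n + S) \<le> A * \<beta> ^ n * ?x ^ g * ?x ^ e + ?x ^ e * (\<beta> ^ n * ?x ^ g)"
        using S e[of n] unfolding of_nat_add by linarith
      also have "\<dots> = (A + 1) * \<beta> ^ n * ?x ^ (g + e)" by (simp add: algebra_simps power_add)
      finally have "real (h n + S) \<le> (A + 1) * \<beta> ^ n * ?x ^ (g + e)" .
      then have "log 2 (real (h n + S)) \<le> log 2 ((A + 1) * \<beta> ^ n * ?x ^ (g + e))"
        using False assms by (subst log_le_cancel_iff) auto
      also have "\<dots> = log 2 (A + 1) + real n * log 2 \<beta> + real (g + e) * log 2 ?x"
        using assms by (simp add: log_mult log_nat_power)
      also have "\<dots> \<le> log 2 (A + 1) * ?x + ?x * log 2 \<beta> + real (g + e) * ?x"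
      proof (intro add_mono)
        show "log 2 (A + 1) \<le> log 2 (A + 1) * ?x" using l mult_left_mono[of 1 ?x "log 2 (A + 1)"] by simp
        show "real n * log 2 \<beta> \<le> ?x * log 2 \<beta>" using l by (intro mult_right_mono) auto
        show "real (g + e) * log 2 ?x \<le> real (g + e) * ?x" using lx by (intro mult_left_mono) auto
      qed
      finally have "log 2 (real (h n + S)) + 1 \<le> D * ?x" by (simp add: D_def algebra_simps)
      moreover have "1 \<le> h n + S" using False by linarith
      ultimately show ?thesis using num_size_le_log by (meson order_trans)
    qed
  qed
qed

theorem theorem3:
  fixes d k :: nat
  assumes "d \<ge> 2" and "k \<ge> 2"
  shows "\<exists>(P :: program) (p :: real poly).
           solves_csp_in_time P d k
             (\<lambda>n. (real d * (real k - 1) / real k * (real k ^ d / (real k ^ d - 1))) ^ n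
                    * poly p (real n))"
proof -
  have \<beta>: "1 < growth d k" using growth_gt_1[OF assms] .
  obtain b A g where A: "1 \<le> A" and steps: "\<And>n F. csp_formula d k n F \<Longrightarrow>
      (eval (main_e d k b) [un n, enc_formula (rev (map rev F))] \<noteq> Lf \<longleftrightarrow> satisfiable d n F) \<and>
      real (total_steps (main_e d k b) n F) \<le> A * growth d k ^ n * (real n + 2) ^ g"
    using total_steps_bound[OF assms] by metis
  let ?e = "main_e d k b"
  obtain P K where P: "\<And>n F B. \<lbrakk>n \<le> B; length F \<le> B; \<forall>C\<in>set F. length C \<le> B \<and> (\<forall>(i, c)\<in>set C. i \<le> B \<and> c \<le> B)\<rbrakk> \<Longrightarrow>
    \<exists>t. computes_in_time P (encode_formula n F)
      (if eval ?e [un n, enc_formula (rev (map rev F))] = Lf then 0 else 1) t \<and>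
      t \<le> total_steps ?e n F * (5 * num_size (K + B + total_steps ?e n F))"
    using program_of_exp[of ?e] by metis
  define B where "B n = n + (k + 1) * (n * d + 1) ^ k + k + d" for n
  have "pb (\<lambda>n. K + B n)" unfolding B_def by (intro pb_add pb_mult pb_power pb_const pb_id)
  from log_cost_le[OF \<beta> A this] obtain D where D: "0 \<le> D"
    "\<And>n S. real S \<le> A * growth d k ^ n * (real n + 2) ^ g \<Longrightarrow> real (num_size (K + B n + S)) \<le> D * (real n + 2)"
    by metis
  \<comment> \<open>\<open>[:2, 1:]\<close> is the polynomial \<open>x + 2\<close>. Of its powers,
    \<open>g\<close> come from the number of steps and one from the cost per instruction, which also
    yields the factor \<open>5 * D\<close>.\<close>
  define p where "p = smult (5 * A * D) ([:2, 1:] ^ (g + 1))"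
  have p: "poly p (real n) = 5 * A * D * (real n + 2) ^ (g + 1)" for n
    by (simp add: p_def algebra_simps)
  have "solves_csp_in_time P d k (\<lambda>n. growth d k ^ n * poly p (real n))"
    unfolding solves_csp_in_time_def
  proof (intro allI impI)
    fix n F assume csp: "csp_formula d k n F"
    let ?S = "total_steps ?e n F"
    note st = steps[OF csp]
    have "n \<le> B n" by (simp add: B_def)
    moreover have "length F \<le> B n" using length_csp_formula[OF csp] unfolding B_def by linarith
    moreover have "\<forall>C\<in>set F. length C \<le> B n \<and> (\<forall>(i, c)\<in>set C. i \<le> B n \<and> c \<le> B n)"
      using csp unfolding csp_formula_def B_def by fastforce
    ultimately obtain t where t: "computes_in_time P (encode_formula n F)
      (if eval ?e [un n, enc_formula (rev (map rev F))] = Lf then 0 else 1) t"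
      "t \<le> ?S * (5 * num_size (K + B n + ?S))" using P by blast
    have "real t \<le> real ?S * (5 * real (num_size (K + B n + ?S)))"
      using of_nat_mono[OF t(2)] by simp
    also have "\<dots> \<le> (A * growth d k ^ n * (real n + 2) ^ g) * (5 * (D * (real n + 2)))"
      using st D \<beta> A by (intro mult_mono) auto
    also have "\<dots> = growth d k ^ n * poly p (real n)" by (simp add: p mult_ac)
    finally show "\<exists>t. computes_in_time P (encode_formula n F) (if satisfiable d n F then 1 else 0) t \<and>
        real t \<le> growth d k ^ n * poly p (real n)"
      using t(1) st by (intro exI[of _ t]) (auto split: if_splits)
  qed
  then show ?thesis unfolding growth_def by blast
qed

end
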